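(* For every integer $n\geq2$, each of the groups $W(S_n)$, $\operatorname{FSym}(S_n)$ and $H_n$ has finite twin-width and infinite uniform twin-width. For $n\geq3$, the group $H_n$ is finitely presented.
   Context: Twin-width of matrices. A matrix (of any cardinality, with totally ordered rows and columns) is binary if its entries are $0$ or $1$; it is a bijection matrix if each row and each column contains exactly one $1$. A row/column identification replaces two consecutive rows (or two consecutive columns) by a single row (column) each of whose entries is the maximum of the two corresponding entries. For a finite $m\times n$ binary matrix $M$, consider sequences $M=M_{m+n},M_{m+n-1},\dots,M_2$, each term obtained from the previous one by one row/column identification, ending in a $1\times1$ matrix. The width of the sequence is the maximum number of $1$'s in a single row or column of any matrix of the sequence. The strict twin-width $\operatorname{stww}(M)$ is the minimum width over all such sequences. For an infinite matrix, $\operatorname{stww}$ is the supremum of $\operatorname{stww}$ over its finite submatrices (with the induced orders). For a permutation $\sigma$ of a totally ordered set $(X,<)$, $M_\sigma$ is the $X\times X$ matrix with $M_\sigma(x,y)=1$ iff $\sigma(x)=y$ (and $0$ otherwise), rows and columns ordered by $<$. Twin-width of groups. For a group $G$ and $g\in G$ let $R_g\colon G\to G$, $R_g(x)=xg$. $G$ has finite twin-width if there is a total order on $G$ such that $\operatorname{stww}(M_{R_g})<\infty$ for every $g\in G$. The uniform twin-width is $\operatorname{utww}(G)=\min_{<}\sup_{g\in G}\operatorname{stww}(M_{R_g})\in\mathbb N\cup\{\infty\}$, the minimum over all total orders $<$ on $G$; $G$ has infinite uniform twin-width if $\operatorname{utww}(G)=\infty$. The groups. For $n\geq2$, $S_n$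 is the infinite star graph with vertex set $V(S_n)=\{0\}\cup\{(i,m): 1\le i\le n,\ m\in\mathbb N_{\geq1}\}$, where $0$ is adjacent to each $(i,1)$ and $(i,m)$ is adjacent to $(i,m+1)$; $d_{S_n}$ is its graph metric and $\operatorname{Sym}(S_n)$ the full permutation group of $V(S_n)$. The wobbling group is \[W(S_n)=\Bigl\{\sigma\in\operatorname{Sym}(S_n):\ \sup_{v\in V(S_n)}d_{S_n}(\sigma(v),v)<\infty\Bigr\}.\] $\operatorname{FSym}(S_n)$ is the group of finitely supported permutations of $V(S_n)$. For $n=2$, $S_2$ is a double ray, identified with $\mathbb Z$, and $H_2=\operatorname{FSym}(\mathbb Z)\rtimes\langle t\rangle$ is the group of permutations of $\mathbb Z$ generated by the finitely supported permutations and the translation $t(\ell)=\ell+1$. For $n\geq3$, $H_n$ is the subgroup of $\operatorname{Sym}(S_n)$ generated by $g_2,\dots,g_n$, where $g_k(1,m)=(1,m+1)$, $g_k(0)=(1,1)$, $g_k(k,1)=0$, $g_k(k,m)=(k,m-1)$ for $m\geq2$, and $g_k(i,m)=(i,m)$ for $i\neq1,k$. *)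

theory Defs
  imports
    "HOL-Algebra.Bij"
    "HOL-Algebra.Coset"
    "HOL-Algebra.Elementary_Groups"
    "HOL-Library.Extended_Nat"
    "Jordan_Normal_Form.Matrix"
begin

section \<open>Strict twin-width of matrices\<close>

subsection \<open>Finite matrices\<close>

definition identify_rows :: "nat mat \<Rightarrow> nat \<Rightarrow> nat mat" where
  "identify_rows A i =
     mat (dim_row A - 1) (dim_col A)
       (\<lambda>(a, b). if a < i then A $$ (a, b)
                 else if a = i then max (A $$ (i, b)) (A $$ (i + 1, b))
                 else A $$ (a + 1, b))"

definition identify_cols :: "nat mat \<Rightarrow> nat \<Rightarrow> nat mat" where
  "identify_cols A j = transpose_mat (identify_rows (transpose_mat A) j)"

definition identification :: "nat mat \<Rightarrow> nat mat \<Rightarrow> bool" where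
  "identification A B \<longleftrightarrow>
     (\<exists>i. i + 1 < dim_row A \<and> B = identify_rows A i) \<or>
     (\<exists>j. j + 1 < dim_col A \<and> B = identify_cols A j)"

definition mat_width :: "nat mat \<Rightarrow> nat" where
  "mat_width A =
     Max ({card {j. j < dim_col A \<and> A $$ (i, j) = 1} | i. i < dim_row A} \<union>
          {card {i. i < dim_row A \<and> A $$ (i, j) = 1} | j. j < dim_col A})"

text \<open>The matrices are indexed by the sum of their dimensions; only the indices from 2 to the
  sum of the dimensions of the initial matrix matter.\<close>

definition identification_sequence :: "nat mat \<Rightarrow> (nat \<Rightarrow> nat mat) \<Rightarrow> bool" where
  "identification_sequence A Ms \<longleftrightarrow>
     Ms (dim_row A + dim_col A) = A \<and>
     (\<forall>k\<in>{2..<dim_row A + dim_col A}. identification (Ms (Suc k)) (Ms k)) \<and>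
     Ms 2 \<in> carrier_mat 1 1"

definition sequence_width :: "nat mat \<Rightarrow> (nat \<Rightarrow> nat mat) \<Rightarrow> nat" where
  "sequence_width A Ms = Max ((\<lambda>k. mat_width (Ms k)) ` {2..dim_row A + dim_col A})"

text \<open>An identification sequence exists as soon as both dimensions are positive; matrices with
  an empty set of rows or columns do not occur below.\<close>

definition stww_fin :: "nat mat \<Rightarrow> nat" where
  "stww_fin A = (LEAST w. \<exists>Ms. identification_sequence A Ms \<and> w = sequence_width A Ms)"

subsection \<open>Matrices with totally ordered rows and columns\<close>

text \<open>A matrix is given by its set of rows \<open>X\<close> with a linear order \<open>r\<close>, its set of columns \<open>Y\<close>
  with a linear order \<open>s\<close>, and its entries \<open>M\<close>. As usual for \<^const>\<open>linear_order_on\<close>,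
  orders are reflexive relations.\<close>

definition increasing_enum :: "'a rel \<Rightarrow> 'a set \<Rightarrow> 'a list" where
  "increasing_enum r A = (THE xs. set xs = A \<and> sorted_wrt (\<lambda>x y. (x, y) \<in> r \<and> x \<noteq> y) xs)"

definition finite_submatrix ::
    "'a rel \<Rightarrow> 'b rel \<Rightarrow> ('a \<Rightarrow> 'b \<Rightarrow> nat) \<Rightarrow> 'a set \<Rightarrow> 'b set \<Rightarrow> nat mat" where
  "finite_submatrix r s M A B =
     mat (card A) (card B) (\<lambda>(i, j). M (increasing_enum r A ! i) (increasing_enum s B ! j))"

definition stww ::
    "'a set \<Rightarrow> 'a rel \<Rightarrow> 'b set \<Rightarrow> 'b rel \<Rightarrow> ('a \<Rightarrow> 'b \<Rightarrow> nat) \<Rightarrow> enat" where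
  "stww X r Y s M =
     (if finite X \<and> finite Y then enat (stww_fin (finite_submatrix r s M X Y))
      else (SUP (A, B) \<in> {(A, B). A \<subseteq> X \<and> finite A \<and> A \<noteq> {} \<and> B \<subseteq> Y \<and> finite B \<and> B \<noteq> {}}.
              enat (stww_fin (finite_submatrix r s M A B))))"

definition perm_matrix :: "('a \<Rightarrow> 'a) \<Rightarrow> 'a \<Rightarrow> 'a \<Rightarrow> nat" where
  "perm_matrix \<sigma> x y = (if \<sigma> x = y then 1 else 0)"


section \<open>Twin-width of groups\<close>

definition right_mult_stww :: "('a, 'b) monoid_scheme \<Rightarrow> 'a rel \<Rightarrow> 'a \<Rightarrow> enat" where
  "right_mult_stww G r g =
     stww (carrier G) r (carrier G) r (perm_matrix (\<lambda>x. x \<otimes>\<^bsub>G\<^esub> g))"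

definition finite_twin_width :: "('a, 'b) monoid_scheme \<Rightarrow> bool" where
  "finite_twin_width G \<longleftrightarrow>
     (\<exists>r. linear_order_on (carrier G) r \<and> (\<forall>g\<in>carrier G. right_mult_stww G r g < \<infinity>))"

definition utww :: "('a, 'b) monoid_scheme \<Rightarrow> enat" where
  "utww G =
     (INF r \<in> {r. linear_order_on (carrier G) r}. SUP g \<in> carrier G. right_mult_stww G r g)"


section \<open>Finite presentations\<close>

text \<open>Elements of the free group on \<open>X\<close> are the reduced words in the letters \<open>(x, True)\<close>,
  standing for \<open>x\<close>, and \<open>(x, False)\<close>, standing for its inverse.\<close>

definition inv_letter :: "'x \<times> bool \<Rightarrow> 'x \<times> bool" where
  "inv_letter a = (fst a, \<not> snd a)"

fun cons_letter :: "'x \<times> bool \<Rightarrow> ('x \<times> bool) list \<Rightarrow> ('x \<times> bool) list" where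
  "cons_letter a [] = [a]"
| "cons_letter a (b # w) = (if b = inv_letter a then w else a # b # w)"

definition free_group :: "'x set \<Rightarrow> ('x \<times> bool) list monoid" where
  "free_group X =
     \<lparr>carrier = {w. fst ` set w \<subseteq> X \<and> successively (\<lambda>a b. b \<noteq> inv_letter a) w},
      monoid.mult = (\<lambda>u v. foldr cons_letter u v),
      one = []\<rparr>"

definition normal_closure :: "('a, 'b) monoid_scheme \<Rightarrow> 'a set \<Rightarrow> 'a set" where
  "normal_closure G R = \<Inter> {N. N \<lhd> G \<and> R \<subseteq> N}"

text \<open>A finite set of generators may be taken to consist of natural numbers.\<close>

definition finitely_presented :: "('a, 'b) monoid_scheme \<Rightarrow> bool" where
  "finitely_presented G \<longleftrightarrow>
     (\<exists>(X :: nat set) R. finite X \<and> finite R \<and> R \<subseteq> carrier (free_group X) \<and>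
        G \<cong> free_group X Mod normal_closure (free_group X) R)"


section \<open>Wobbling groups, finitary symmetric groups and Houghton groups\<close>

datatype star_vertex = Centre | Ray nat nat

definition star_vertices :: "nat \<Rightarrow> star_vertex set" where
  "star_vertices n = insert Centre {Ray i m | i m. 1 \<le> i \<and> i \<le> n \<and> 1 \<le> m}"

definition star_adj :: "nat \<Rightarrow> star_vertex rel" where
  "star_adj n =
     (let E = {(Centre, Ray i 1) | i. 1 \<le> i \<and> i \<le> n} \<union>
              {(Ray i m, Ray i (m + 1)) | i m. 1 \<le> i \<and> i \<le> n \<and> 1 \<le> m}
      in E \<union> E\<inverse>)"

definition star_dist :: "nat \<Rightarrow> star_vertex \<Rightarrow> star_vertex \<Rightarrow> nat" where
  "star_dist n u v = (LEAST k. (u, v) \<in> star_adj n ^^ k)"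

definition wobbling_group :: "nat \<Rightarrow> (star_vertex \<Rightarrow> star_vertex) monoid" where
  "wobbling_group n =
     (BijGroup (star_vertices n))
       \<lparr>carrier := {\<sigma> \<in> Bij (star_vertices n).
                     (SUP v \<in> star_vertices n. enat (star_dist n (\<sigma> v) v)) < \<infinity>}\<rparr>"

definition finitary_perms :: "'a set \<Rightarrow> ('a \<Rightarrow> 'a) set" where
  "finitary_perms X = {\<sigma> \<in> Bij X. finite {x \<in> X. \<sigma> x \<noteq> x}}"

definition FSym :: "'a set \<Rightarrow> ('a \<Rightarrow> 'a) monoid" where
  "FSym X = (BijGroup X)\<lparr>carrier := finitary_perms X\<rparr>"

definition houghton_gen :: "nat \<Rightarrow> nat \<Rightarrow> star_vertex \<Rightarrow> star_vertex" where
  "houghton_gen n k =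
     (\<lambda>v\<in>star_vertices n. case v of
        Centre \<Rightarrow> Ray 1 1
      | Ray i m \<Rightarrow>
          if i = 1 then Ray 1 (m + 1)
          else if i = k then (if m = 1 then Centre else Ray k (m - 1))
          else Ray i m)"

definition houghton_group :: "nat \<Rightarrow> (star_vertex \<Rightarrow> star_vertex) monoid" where
  "houghton_group n =
     subgroup_generated (BijGroup (star_vertices n)) (houghton_gen n ` {2..n})"

text \<open>The generators above do not give the second Houghton group (for \<open>n = 2\<close> they generate only
  an infinite cyclic group), which is defined separately as a group of permutations of the
  integers.\<close>

definition houghton_group_2 :: "(int \<Rightarrow> int) monoid" where
  "houghton_group_2 =
     subgroup_generated (BijGroup UNIV) (insert (\<lambda>l. l + 1) (finitary_perms UNIV))"

end

theory Submission
  imports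
    Defs
    "HOL-Analysis.Convex"
    "HOL-Library.Indicator_Function"
    "HOL-Library.Nat_Bijection"
    "HOL-Number_Theory.Residues"
    "HOL-Combinatorics.Transposition"
begin

text \<open>Three facts are behind the theorem.

  Finite twin-width. Enumerate the permuted set \<open>X\<close> by the natural numbers so that every member of
  the group moves every point by a bounded amount. Code a permutation by the sequence of the values of
  its inverse and order the group lexicographically. Right multiplication by \<open>g\<close> applies the fixed map
  \<open>g\<inverse>\<close> to every term of a code, so it changes each term by at most a constant \<open>k\<close> and preserves the
  length of the common prefix of two codes. Identify rows and columns along partitions into
  intervals: two codes are in one class of level \<open>(m, s)\<close> if they agree below \<open>m\<close> and their \<open>m\<close>-th
  terms are in the same dyadic interval of length \<open>2 ^ s\<close>. A class of level \<open>(m, s + 1)\<close> meets at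
  most \<open>2 * k + 2\<close> classes of level \<open>(m, s)\<close> in this matrix, hence so do all intermediate
  partitions (\<open>near_matching_contractible\<close>, \<open>finite_twin_width_bounded_displacement\<close>).

  Infinite uniform twin-width. If the rows and the columns of a matrix are cut into \<open>k\<close> consecutive
  blocks of at least two lines such that every pair of blocks contains a 1, then the strict twin-width is at least \<open>k / 2\<close>:
  at the first identification which shrinks a block to one line, that line meets all \<open>k\<close> blocks
  in the other direction, and at least half of them are disjoint (\<open>grid_stww_fin\<close>). Every finite
  group embeds into the finitary symmetric group, in particular \<open>SL\<^sub>2(p)\<close> does. For large primes \<open>p\<close> with \<open>p mod 4 = 3\<close> this group is quasirandom:
  for any choice of dense sets \<open>X\<^sub>1, \<dots>, X\<^sub>L\<close> there is one \<open>g\<close> with \<open>X\<^sub>i g \<inter> X\<^sub>j \<noteq> {}\<close> for all \<open>i\<close>, \<open>j\<close>.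
  Whatever the order is, the blocks of a copy of \<open>SL\<^sub>2(p)\<close> are such dense sets, so right multiplication
  by \<open>g\<close> produces a grid (\<open>quasirandom_SL2_exists\<close>, \<open>utww_infinite\<close>). Quasirandomness is proved without
  representation theory: correlations of a function are compared along the unipotent subgroup, whose
  nontrivial elements are all conjugate up to inversion since \<open>-1\<close> is not a square mod \<open>p\<close>, and the sum
  of the correlations over the conjugates of this subgroup is controlled by the action on the nonzero
  vectors of the plane over the field with \<open>p\<close> elements.

  Finite presentation. The commutator \<open>a\<close> of the first two generators of the Houghton group is the
  transposition of the centre and its neighbour on the first ray. In any group with
  generators \<open>g\<^sub>2, \<dots>, g\<^sub>n\<close> that satisfies a certain finite list of relations and acts on the star like the Houghton
  group, two applications of Schreier's method show that the stabiliser of the pair formed by the centre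
  and that neighbour centralises \<open>a\<close> (\<open>stabiliser_of_pair_centralises\<close>). So the conjugates of \<open>a\<close> are
  labelled by pairs of vertices; they multiply like transpositions and generate a copy of the
  finitary symmetric group. The relations make the quotient by this normal subgroup abelian, and the
  translation lengths on the rays detect its elements. Hence the action is faithful
  (\<open>houghton_presented.faithful\<close>), and the relations present the Houghton group.\<close>

section \<open>Grids bound the strict twin-width from below\<close>

text \<open>The blocks are \<open>{l i..u i}\<close> and \<open>{l' j..u' j}\<close>. Consecutive blocks may share an end point, because an
  identification across the border of two blocks puts a line into both of them.\<close>

definition has_grid :: "nat mat \<Rightarrow> nat \<Rightarrow> (nat \<Rightarrow> nat) \<Rightarrow> (nat \<Rightarrow> nat) \<Rightarrow> (nat \<Rightarrow> nat) \<Rightarrow> (nat \<Rightarrow> nat) \<Rightarrow> bool" where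
  "has_grid A k l u l' u' \<longleftrightarrow>
     (\<forall>i<k. l i \<le> u i \<and> u i < dim_row A \<and> l' i \<le> u' i \<and> u' i < dim_col A) \<and>
     (\<forall>i. Suc i < k \<longrightarrow> u i \<le> l (Suc i) \<and> u' i \<le> l' (Suc i)) \<and>
     (\<forall>i<k. \<forall>j<k. \<exists>x\<in>{l i..u i}. \<exists>y\<in>{l' j..u' j}. A $$ (x, y) = 1) \<and>
     (\<forall>x<dim_row A. \<forall>y<dim_col A. A $$ (x, y) \<le> 1)"

lemma has_gridD:
  assumes "has_grid A k l u l' u'"
  shows "i < k \<Longrightarrow> l i \<le> u i" "i < k \<Longrightarrow> u i < dim_row A"
    "i < k \<Longrightarrow> l' i \<le> u' i" "i < k \<Longrightarrow> u' i < dim_col A"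
    "Suc i < k \<Longrightarrow> u i \<le> l (Suc i)" "Suc i < k \<Longrightarrow> u' i \<le> l' (Suc i)"
    "x < dim_row A \<Longrightarrow> y < dim_col A \<Longrightarrow> A $$ (x, y) \<le> 1"
  using assms by (auto simp: has_grid_def)

lemma has_grid_entry:
  assumes "has_grid A k l u l' u'" "i < k" "j < k"
  obtains x y where "x \<in> {l i..u i}" "y \<in> {l' j..u' j}" "A $$ (x, y) = 1"
    "x < dim_row A" "y < dim_col A"
proof -
  have "\<exists>x\<in>{l i..u i}. \<exists>y\<in>{l' j..u' j}. A $$ (x, y) = 1"
    using assms unfolding has_grid_def by (elim conjE) (drule spec, erule (1) impE, blast)+
  then obtain x y where xy: "x \<in> {l i..u i}" "y \<in> {l' j..u' j}" "A $$ (x, y) = 1" by blast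
  moreover have "x < dim_row A" "y < dim_col A"
    using xy has_gridD(2)[OF assms(1,2)] has_gridD(4)[OF assms(1,3)] by auto
  ultimately show thesis using that by blast
qed

lemma dim_identify_rows [simp]:
  "dim_row (identify_rows A i) = dim_row A - 1" "dim_col (identify_rows A i) = dim_col A"
  by (simp_all add: identify_rows_def)

lemma dim_identify_cols [simp]:
  "dim_row (identify_cols A i) = dim_row A" "dim_col (identify_cols A i) = dim_col A - 1"
  by (simp_all add: identify_cols_def)

text \<open>The position of row \<open>x\<close> after the rows \<open>i\<close> and \<open>i + 1\<close> have been identified.\<close>

definition merge_index :: "nat \<Rightarrow> nat \<Rightarrow> nat" where
  "merge_index i x = (if x \<le> i then x else x - 1)"

lemma merge_index_mono: "x \<le> y \<Longrightarrow> merge_index i x \<le> merge_index i y"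
  by (auto simp: merge_index_def)

lemma identify_rows_ge_entry:
  assumes "i + 1 < dim_row A" "x < dim_row A" "y < dim_col A"
  shows "A $$ (x, y) \<le> identify_rows A i $$ (merge_index i x, y)"
  using assms by (auto simp: identify_rows_def merge_index_def)

lemma identify_rows_le_1:
  assumes "i + 1 < dim_row A" "\<forall>x<dim_row A. \<forall>y<dim_col A. A $$ (x, y) \<le> 1"
    "x < dim_row A - 1" "y < dim_col A"
  shows "identify_rows A i $$ (x, y) \<le> 1"
  using assms by (auto simp: identify_rows_def)

lemma has_grid_transpose:
  "has_grid (transpose_mat A) k l u l' u' \<longleftrightarrow> has_grid A k l' u' l u"
proof -
  have *: "has_grid A k l' u' l u" if h: "has_grid (transpose_mat A) k l u l' u'"
    for A and l u l' u' :: "nat \<Rightarrow> nat"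
  proof -
    have e: "\<exists>x\<in>{l' i..u' i}. \<exists>y\<in>{l j..u j}. A $$ (x, y) = 1" if ij: "i < k" "j < k" for i j
    proof -
      obtain x y where "x \<in> {l j..u j}" "y \<in> {l' i..u' i}" "transpose_mat A $$ (x, y) = 1"
        "x < dim_col A" "y < dim_row A"
        using has_grid_entry[OF h ij(2,1)] by auto
      then show ?thesis by (intro bexI[of _ y] bexI[of _ x]) auto
    qed
    have "A $$ (x, y) \<le> 1" if "x < dim_row A" "y < dim_col A" for x y
      using has_gridD(7)[OF h, of y x] that by simp
    then show ?thesis using has_gridD[OF h] e unfolding has_grid_def by auto
  qed
  show ?thesis using *[of A] *[of "transpose_mat A"] by (metis transpose_transpose)
qed

lemma has_grid_identify_rows:
  assumes g: "has_grid A k l u l' u'" and i: "i + 1 < dim_row A"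
  shows "has_grid (identify_rows A i) k (merge_index i \<circ> l) (merge_index i \<circ> u) l' u'"
proof -
  have r: "merge_index i x < dim_row A - 1" if "x < dim_row A" for x
    using that i by (auto simp: merge_index_def)
  have le1: "identify_rows A i $$ (x, y) \<le> 1" if "x < dim_row A - 1" "y < dim_col A" for x y
    using identify_rows_le_1[OF i _ that] g by (simp add: has_grid_def)
  have "\<exists>x\<in>{merge_index i (l a)..merge_index i (u a)}. \<exists>y\<in>{l' b..u' b}.
          identify_rows A i $$ (x, y) = 1" if ab: "a < k" "b < k" for a b
  proof -
    obtain x y where xy: "x \<in> {l a..u a}" "y \<in> {l' b..u' b}" "A $$ (x, y) = 1"
      and d: "x < dim_row A" "y < dim_col A"
      using has_grid_entry[OF g ab] by blast
    have "identify_rows A i $$ (merge_index i x, y) = 1"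
      using identify_rows_ge_entry[OF i d] le1[OF r[OF d(1)] d(2)] xy(3) by simp
    then show ?thesis using xy by (metis atLeastAtMost_iff merge_index_mono)
  qed
  then show ?thesis
    using g le1 r unfolding has_grid_def by (auto simp: merge_index_mono)
qed

lemma finite_mat_width_set:
  fixes A :: "nat mat"
  shows "finite ({card {j. j < dim_col A \<and> A $$ (i, j) = 1} | i. i < dim_row A} \<union>
          {card {i. i < dim_row A \<and> A $$ (i, j) = 1} | j. j < dim_col A})"
  by auto

lemma mat_width_ge_row:
  "i < dim_row A \<Longrightarrow> card {j. j < dim_col A \<and> A $$ (i, j) = 1} \<le> mat_width A"
  unfolding mat_width_def by (intro Max_ge finite_mat_width_set) auto

lemma mat_width_transpose: "mat_width (transpose_mat A) = mat_width A"
proof -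
  have 1: "{j. j < dim_row A \<and> transpose_mat A $$ (i, j) = 1} = {j. j < dim_row A \<and> A $$ (j, i) = 1}"
    if "i < dim_col A" for i
    using that by auto
  have 2: "{i. i < dim_col A \<and> transpose_mat A $$ (i, j) = 1} = {i. i < dim_col A \<and> A $$ (j, i) = 1}"
    if "j < dim_row A" for j
    using that by auto
  have "{card {j. j < dim_row A \<and> transpose_mat A $$ (i, j) = 1} | i. i < dim_col A} =
      {card {j. j < dim_row A \<and> A $$ (j, i) = 1} | i. i < dim_col A}"
    unfolding setcompr_eq_image by (rule image_cong) (use 1 in auto)
  moreover have "{card {i. i < dim_col A \<and> transpose_mat A $$ (i, j) = 1} | j. j < dim_row A} =
      {card {i. i < dim_col A \<and> A $$ (j, i) = 1} | j. j < dim_row A}"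
    unfolding setcompr_eq_image by (rule image_cong) (use 2 in auto)
  ultimately show ?thesis unfolding mat_width_def by (simp add: Un_commute)
qed

lemma mono_parts:
  fixes l u :: "nat \<Rightarrow> nat"
  assumes "\<And>i. i < k \<Longrightarrow> l i < u i" "\<And>i. Suc i < k \<Longrightarrow> u i \<le> l (Suc i)" "i < j" "j < k"
  shows "u i \<le> l j"
  using assms(3,4)
proof (induction j)
  case (Suc j)
  have uj: "u j \<le> l (Suc j)" using assms(2) Suc.prems by blast
  show ?case
  proof (cases "i = j")
    case True
    then show ?thesis using uj by simp
  next
    case False
    then have "u i \<le> l j" "l j < u j" using Suc assms(1) by simp_all
    then show ?thesis using uj by linarith
  qed
qed simp

text \<open>A block that consists of a single row gives a row with a 1 in each of the \<open>k\<close> column blocks. Column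
  blocks whose numbers have the same parity are disjoint, since no column block is a single column, so
  at least half of these entries are different.\<close>

lemma collapsed_row_width:
  assumes g: "has_grid A k l u l' u'" and s: "\<And>j. j < k \<Longrightarrow> l' j < u' j"
    and i: "i < k" "l i = u i"
  shows "k \<le> 2 * mat_width A"
proof -
  let ?J = "{j. j < dim_col A \<and> A $$ (l i, j) = 1}"
  have "\<forall>j. j < k \<longrightarrow> (\<exists>y. y \<in> {l' j..u' j} \<and> A $$ (l i, y) = 1)"
  proof (intro allI impI)
    fix j assume "j < k"
    then obtain x y where "x \<in> {l i..u i}" "y \<in> {l' j..u' j}" "A $$ (x, y) = 1"
      using has_grid_entry[OF g i(1)] by blast
    then show "\<exists>y. y \<in> {l' j..u' j} \<and> A $$ (l i, y) = 1" using i(2) by auto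
  qed
  then obtain y where y: "\<And>j. j < k \<Longrightarrow> y j \<in> {l' j..u' j} \<and> A $$ (l i, y j) = 1"
    by metis
  \<comment> \<open>distinct parts of the same parity are disjoint\<close>
  have ne: "y a < y b" if "Suc a < b" "b < k" for a b
  proof -
    have gap: "u' i \<le> l' (Suc i)" if "Suc i < k" for i
      using g that by (simp add: has_grid_def)
    have "u' a \<le> l' (Suc a)" "l' (Suc a) < u' (Suc a)"
      using gap[of a] s[of "Suc a"] that by simp_all
    moreover have "u' (Suc a) \<le> l' b"
      by (rule mono_parts[of k l' u', OF s gap that])
    moreover have "y a \<le> u' a" "l' b \<le> y b" using y[of a] y[of b] that by simp_all
    ultimately show ?thesis by linarith
  qed
  have inj: "inj_on (\<lambda>m. y (2 * m)) {..<(k + 1) div 2}"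
  proof (rule linorder_inj_onI')
    fix a b assume "a \<in> {..<(k + 1) div 2}" "b \<in> {..<(k + 1) div 2}" "a < b"
    then have "y (2 * a) < y (2 * b)" by (intro ne) auto
    then show "y (2 * a) \<noteq> y (2 * b)" by simp
  qed
  have "(\<lambda>m. y (2 * m)) ` {..<(k + 1) div 2} \<subseteq> ?J"
  proof
    fix z assume "z \<in> (\<lambda>m. y (2 * m)) ` {..<(k + 1) div 2}"
    then obtain m where m: "z = y (2 * m)" "2 * m < k" by auto
    then have "u' (2 * m) < dim_col A" using g by (simp add: has_grid_def)
    then show "z \<in> ?J" using y[OF m(2)] m(1) by auto
  qed
  then have "card ((\<lambda>m. y (2 * m)) ` {..<(k + 1) div 2}) \<le> card ?J"
    by (intro card_mono) auto
  then have "(k + 1) div 2 \<le> card ?J"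
    unfolding card_image[OF inj] by simp
  also have "\<dots> \<le> mat_width A"
    using g i by (intro mat_width_ge_row) (auto simp: has_grid_def)
  finally show ?thesis by linarith
qed

text \<open>As long as all blocks have at least two lines, the grid gives no bound on the width, but it survives an
  identification.\<close>

definition strict_parts :: "nat \<Rightarrow> (nat \<Rightarrow> nat) \<Rightarrow> (nat \<Rightarrow> nat) \<Rightarrow> bool" where
  "strict_parts k l u \<longleftrightarrow> (\<forall>j<k. l j < u j)"

text \<open>An identification maps blocks to blocks. Only one direction is affected, so if a block collapses then
  the blocks in the other direction are still strict.\<close>

lemma grid_identification:
  assumes "has_grid A k l u l' u'" "strict_parts k l u" "strict_parts k l' u'" "identification A B"
  shows "k \<le> 2 * mat_width B \<or>
    (\<exists>l u l' u'. has_grid B k l u l' u' \<and> strict_parts k l u \<and> strict_parts k l' u')"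
proof -
  have row: "k \<le> 2 * mat_width (identify_rows A i) \<or> (\<exists>l u l' u'. has_grid (identify_rows A i) k l u l' u' \<and>
      strict_parts k l u \<and> strict_parts k l' u')"
    if "i + 1 < dim_row A" "has_grid A k l u l' u'" "strict_parts k l' u'" for A i l u l' u'
  proof (cases "strict_parts k (merge_index i \<circ> l) (merge_index i \<circ> u)")
    case True
    then show ?thesis using has_grid_identify_rows[OF that(2,1)] that(3) by blast
  next
    case False
    then obtain a where a: "a < k" "\<not> merge_index i (l a) < merge_index i (u a)"
      by (auto simp: strict_parts_def)
    note g = has_grid_identify_rows[OF that(2,1)]
    have "(merge_index i \<circ> l) a = (merge_index i \<circ> u) a"
      using has_gridD(1)[OF g a(1)] a(2) by simp
    then show ?thesis
      using collapsed_row_width[OF g _ a(1)] that(3) by (auto simp: strict_parts_def)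
  qed
  from assms(4) consider (r) i where "i + 1 < dim_row A" "B = identify_rows A i"
    | (c) j where "j + 1 < dim_col A" "B = identify_cols A j"
    by (auto simp: identification_def)
  then show ?thesis
  proof cases
    case r
    then show ?thesis using row assms by blast
  next
    case c
    have "k \<le> 2 * mat_width (identify_rows (transpose_mat A) j) \<or> (\<exists>l u l' u'.
       has_grid (identify_rows (transpose_mat A) j) k l u l' u' \<and>
      strict_parts k l u \<and> strict_parts k l' u')"
      by (rule row[where l=l' and u=u' and l'=l and u'=u]) (use c assms has_grid_transpose in auto)
    moreover have "identify_rows (transpose_mat A) j = transpose_mat B"
      using c by (simp add: identify_cols_def)
    ultimately show ?thesis by (metis has_grid_transpose mat_width_transpose)
  qed
qed

lemma mat_width_le_sequence_width:
  "2 \<le> k \<Longrightarrow> k \<le> dim_row A + dim_col A \<Longrightarrow> mat_width (Ms k) \<le> sequence_width A Ms"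
  unfolding sequence_width_def by (intro Max_ge) auto

text \<open>The last matrix of the sequence has no room for strict blocks, so some block has to collapse on the
  way.\<close>

lemma grid_sequence_width:
  assumes g: "has_grid A k l u l' u'" "strict_parts k l u" "strict_parts k l' u'" and k: "k > 0"
    and Ms: "identification_sequence A Ms"
  shows "k \<le> 2 * sequence_width A Ms"
proof (rule ccontr)
  let ?d = "dim_row A + dim_col A"
  assume c: "\<not> k \<le> 2 * sequence_width A Ms"
  have "u 0 < dim_row A" "l 0 < u 0" "u' 0 < dim_col A" "l' 0 < u' 0"
    using g k by (auto simp: has_grid_def strict_parts_def)
  then have d: "2 \<le> ?d" by linarith
  have "\<exists>l u l' u'. has_grid (Ms m) k l u l' u' \<and> strict_parts k l u \<and> strict_parts k l' u'"
    if "2 \<le> m" "m \<le> ?d" for m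
    using that(2,1)
  proof (induction m rule: inc_induct)
    case base
    then show ?case using Ms g by (metis identification_sequence_def)
  next
    case (step m)
    then have "identification (Ms (Suc m)) (Ms m)"
      using Ms by (simp add: identification_sequence_def)
    moreover have "\<not> k \<le> 2 * mat_width (Ms m)"
      using c mat_width_le_sequence_width[of m A Ms] step by linarith
    ultimately show ?case using step grid_identification by (metis le_SucI)
  qed
  then obtain l u l' u' where "has_grid (Ms 2) k l u l' u'" "strict_parts k l u"
    using d by blast
  then have "u 0 < dim_row (Ms 2)" "l 0 < u 0"
    using k by (auto simp: has_grid_def strict_parts_def)
  moreover have "Ms 2 \<in> carrier_mat 1 1" using Ms by (simp add: identification_sequence_def)
  ultimately show False by auto
qed

section \<open>Contractions along a chain of interval partitions\<close>

definition contractible :: "nat mat \<Rightarrow> nat \<Rightarrow> bool" where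
  "contractible A w \<longleftrightarrow> (\<exists>Ms. identification_sequence A Ms \<and> sequence_width A Ms \<le> w)"

lemma identification_dims:
  assumes "identification A B"
  shows "dim_row A + dim_col A = Suc (dim_row B + dim_col B)"
  using assms by (auto simp: identification_def)

lemma contractible_1:
  assumes A: "A \<in> carrier_mat 1 1" and "mat_width A \<le> w"
  shows "contractible A w"
proof -
  have d: "dim_row A + dim_col A = 2" using A by auto
  have "identification_sequence A (\<lambda>_. A)"
    unfolding identification_sequence_def d using A by auto
  moreover have "sequence_width A (\<lambda>_. A) \<le> w"
    unfolding sequence_width_def d using assms by auto
  ultimately show ?thesis unfolding contractible_def by blast
qed

lemma contractible_step:
  assumes AB: "identification A B" and w: "mat_width A \<le> w" and B: "contractible B w"
    and pos: "0 < dim_row A" "0 < dim_col A"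
  shows "contractible A w"
proof -
  obtain Ms where Ms: "identification_sequence B Ms" "sequence_width B Ms \<le> w"
    using B by (auto simp: contractible_def)
  let ?b = "dim_row B + dim_col B"
  note d = identification_dims[OF AB]
  have b: "Ms ?b = B" "Ms 2 \<in> carrier_mat 1 1"
    using Ms by (auto simp: identification_sequence_def)
  have b2: "2 \<le> ?b"
    using AB pos d by (auto simp: identification_def)
  let ?Ms = "Ms(Suc ?b := A)"
  have "identification_sequence A ?Ms"
    unfolding identification_sequence_def d
  proof (intro conjI ballI)
    fix k assume k: "k \<in> {2..<Suc ?b}"
    show "identification (?Ms (Suc k)) (?Ms k)"
      using k AB b Ms(1) by (cases "k = ?b") (auto simp: identification_sequence_def)
  qed (use b b2 in auto)
  moreover have "sequence_width A ?Ms \<le> w"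
  proof -
    have "mat_width (?Ms k) \<le> w" if "k \<in> {2..Suc ?b}" for k
      using mat_width_le_sequence_width[of k B Ms] that w Ms(2) by (cases "k = Suc ?b") auto
    then show ?thesis unfolding sequence_width_def d using b2 by (subst Max_le_iff) auto
  qed
  ultimately show ?thesis unfolding contractible_def by blast
qed

lemma stww_fin_le: "contractible A w \<Longrightarrow> stww_fin A \<le> w"
  unfolding stww_fin_def contractible_def by (elim exE conjE, rule le_trans[OF Least_le]) blast+

lemma stww_fin_attained:
  assumes "contractible A w"
  shows "\<exists>Ms. identification_sequence A Ms \<and> stww_fin A = sequence_width A Ms"
proof -
  obtain Ms where "identification_sequence A Ms" using assms by (auto simp: contractible_def)
  then have "\<exists>Ms'. identification_sequence A Ms' \<and> sequence_width A Ms = sequence_width A Ms'"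
    by (intro exI[of _ Ms]) simp
  from LeastI[of "\<lambda>w. \<exists>Ms. identification_sequence A Ms \<and> w = sequence_width A Ms", OF this]
  show ?thesis unfolding stww_fin_def .
qed

text \<open>A partition of \<open>{0, 1, \<dots>}\<close> into intervals is given by its set of cuts, where the cut \<open>c\<close> separates
  \<open>c - 1\<close> from \<open>c\<close>. Removing one cut is one identification.\<close>

definition cut_index :: "nat set \<Rightarrow> nat \<Rightarrow> nat" where
  "cut_index C x = card {c \<in> C. c \<le> x}"

definition quotient_mat :: "nat mat \<Rightarrow> nat set \<Rightarrow> nat set \<Rightarrow> nat mat" where
  "quotient_mat Q C D = mat (card C + 1) (card D + 1)
     (\<lambda>(i, j). if \<exists>x<dim_row Q. \<exists>y<dim_col Q. cut_index C x = i \<and> cut_index D y = j \<and> Q $$ (x, y) = 1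
               then 1 else 0)"

lemma quotient_mat_eq_1:
  assumes "i < dim_row (quotient_mat Q C D)" "j < dim_col (quotient_mat Q C D)"
  shows "quotient_mat Q C D $$ (i, j) = 1 \<longleftrightarrow>
    (\<exists>x<dim_row Q. \<exists>y<dim_col Q. cut_index C x = i \<and> cut_index D y = j \<and> Q $$ (x, y) = 1)"
  using assms unfolding quotient_mat_def by simp

lemma cut_index_eq_iff:
  assumes C: "finite C" and xy: "x \<le> y"
  shows "cut_index C x = cut_index C y \<longleftrightarrow> (\<forall>c\<in>C. \<not> (x < c \<and> c \<le> y))"
proof
  assume "cut_index C x = cut_index C y"
  then have "{c \<in> C. c \<le> x} = {c \<in> C. c \<le> y}"
    unfolding cut_index_def by (intro card_subset_eq) (use C xy in auto)
  then have "c \<le> x" if "c \<in> C" "c \<le> y" for c using that by blast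
  then show "\<forall>c\<in>C. \<not> (x < c \<and> c \<le> y)" by (meson not_less)
next
  assume "\<forall>c\<in>C. \<not> (x < c \<and> c \<le> y)"
  then have "{c \<in> C. c \<le> x} = {c \<in> C. c \<le> y}" using xy by (meson le_trans not_less)
  then show "cut_index C x = cut_index C y" by (simp add: cut_index_def)
qed

lemma cut_index_coarser:
  assumes "finite C" "C' \<subseteq> C" "cut_index C x = cut_index C y"
  shows "cut_index C' x = cut_index C' y"
proof -
  have "cut_index C' x = cut_index C' y" if "cut_index C x = cut_index C y" "x \<le> y" for x y
  proof -
    have "\<forall>c\<in>C. \<not> (x < c \<and> c \<le> y)" using that cut_index_eq_iff[OF assms(1)] by simp
    then have "\<forall>c\<in>C'. \<not> (x < c \<and> c \<le> y)" using assms(2) by (meson subsetD)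
    then show ?thesis using cut_index_eq_iff[OF finite_subset[OF assms(2,1)] that(2)] by simp
  qed
  from this[OF assms(3)] this[OF assms(3)[symmetric]] show ?thesis
    using le_cases[of x y] by metis
qed

lemma cut_index_remove:
  assumes C: "finite C" "c \<in> C"
  shows "cut_index (C - {c}) x = merge_index (card {c' \<in> C. c' < c}) (cut_index C x)"
proof (cases "c \<le> x")
  case True
  have "{d \<in> C - {c}. d \<le> x} = {d \<in> C. d \<le> x} - {c}" by auto
  then have 1: "cut_index (C - {c}) x = cut_index C x - 1"
    using True C by (simp add: cut_index_def)
  have "card (insert c {c' \<in> C. c' < c}) \<le> cut_index C x"
    unfolding cut_index_def by (rule card_mono) (use C True in auto)
  then have "Suc (card {c' \<in> C. c' < c}) \<le> cut_index C x" using C by simp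
  then show ?thesis using 1 by (simp add: merge_index_def)
next
  case False
  then have "{d \<in> C - {c}. d \<le> x} = {d \<in> C. d \<le> x}" by auto
  moreover have "cut_index C x \<le> card {c' \<in> C. c' < c}"
    unfolding cut_index_def by (rule card_mono) (use C False in auto)
  ultimately show ?thesis by (simp add: cut_index_def merge_index_def)
qed

lemma identify_rows_quotient:
  assumes C: "finite C" "c \<in> C" and D: "finite D"
  defines "i \<equiv> card {c' \<in> C. c' < c}"
  shows "i + 1 < dim_row (quotient_mat Q C D)"
    and "quotient_mat Q (C - {c}) D = identify_rows (quotient_mat Q C D) i"
proof -
  have "card (insert c {c' \<in> C. c' < c}) \<le> card C" by (rule card_mono) (use C in auto)
  then have i: "i + 1 \<le> card C" using C by (simp add: i_def)
  then show "i + 1 < dim_row (quotient_mat Q C D)" by (simp add: quotient_mat_def)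
  have m: "merge_index i z = a \<longleftrightarrow> (if a < i then z = a else if a = i then z = i \<or> z = i + 1 else z = a + 1)"
    for z a by (auto simp: merge_index_def)
  have cc: "card (C - {c}) + 1 = card C" using C by (metis Suc_eq_plus1 card_Suc_Diff1)
  show "quotient_mat Q (C - {c}) D = identify_rows (quotient_mat Q C D) i"
  proof (rule eq_matI)
    fix a b assume "a < dim_row (identify_rows (quotient_mat Q C D) i)"
      "b < dim_col (identify_rows (quotient_mat Q C D) i)"
    then have ab: "a < card C" "b < card D + 1" by (auto simp: quotient_mat_def)
    show "quotient_mat Q (C - {c}) D $$ (a, b) = identify_rows (quotient_mat Q C D) i $$ (a, b)"
      using ab i cc unfolding quotient_mat_def identify_rows_def
      by (auto simp: cut_index_remove[OF C, folded i_def] m)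
  qed (use cc in \<open>simp_all add: quotient_mat_def\<close>)
qed

lemma transpose_quotient:
  "transpose_mat (quotient_mat Q C D) = quotient_mat (transpose_mat Q) D C"
  by (rule eq_matI) (auto simp: quotient_mat_def)

lemma quotient_remove_row_cut:
  assumes "finite C" "c \<in> C" "finite D"
  shows "identification (quotient_mat Q C D) (quotient_mat Q (C - {c}) D)"
  using identify_rows_quotient[OF assms] unfolding identification_def by blast

lemma quotient_remove_col_cut:
  assumes "finite C" "finite D" "d \<in> D"
  shows "identification (quotient_mat Q C D) (quotient_mat Q C (D - {d}))"
proof -
  let ?j = "card {c' \<in> D. c' < d}"
  have "?j + 1 < dim_col (quotient_mat Q C D)"
    using identify_rows_quotient(1)[OF assms(2,3,1), of "transpose_mat Q"]
    by (simp add: quotient_mat_def)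
  moreover have "quotient_mat Q C (D - {d}) = identify_cols (quotient_mat Q C D) ?j"
    using identify_rows_quotient(2)[OF assms(2,3,1), of "transpose_mat Q"]
    by (metis identify_cols_def transpose_quotient transpose_transpose)
  ultimately show ?thesis unfolding identification_def by blast
qed

lemma quotient_all_cuts:
  assumes "dim_row Q > 0" "dim_col Q > 0" "\<And>x y. x < dim_row Q \<Longrightarrow> y < dim_col Q \<Longrightarrow> Q $$ (x, y) \<le> 1"
  shows "quotient_mat Q {1..<dim_row Q} {1..<dim_col Q} = Q"
proof -
  have c: "cut_index {1..<N} x = x" if "x < N" for x N
  proof -
    have "{c \<in> {1..<N}. c \<le> x} = {1..x}" using that by auto
    then show ?thesis by (simp add: cut_index_def)
  qed
  show ?thesis
  proof (rule eq_matI)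
    fix i j assume ij: "i < dim_row Q" "j < dim_col Q"
    then have "Q $$ (i, j) = 0 \<or> Q $$ (i, j) = 1" using assms(3)[OF ij] by linarith
    then show "quotient_mat Q {1..<dim_row Q} {1..<dim_col Q} $$ (i, j) = Q $$ (i, j)"
      using ij by (auto simp: quotient_mat_def c c[unfolded One_nat_def])
  qed (use assms in \<open>auto simp: quotient_mat_def\<close>)
qed

text \<open>Every class of rows for the cuts \<open>C\<close> is incident with at most \<open>w\<close> classes of columns for the cuts
  \<open>D\<close>.\<close>

definition block_degrees_le :: "nat mat \<Rightarrow> nat set \<Rightarrow> nat set \<Rightarrow> nat \<Rightarrow> bool" where
  "block_degrees_le Q C D w \<longleftrightarrow>
     (\<forall>x<dim_row Q. card (cut_index D ` {y. y < dim_col Q \<and>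
        (\<exists>x'<dim_row Q. cut_index C x' = cut_index C x \<and> Q $$ (x', y) = 1)}) \<le> w)"

lemma quotient_row_le:
  assumes "block_degrees_le Q C D w" "finite C" "finite D" "i < dim_row (quotient_mat Q C D)"
  shows "card {j. j < dim_col (quotient_mat Q C D) \<and> quotient_mat Q C D $$ (i, j) = 1} \<le> w"
proof (cases "\<exists>x<dim_row Q. cut_index C x = i")
  case True
  then obtain x where x: "x < dim_row Q" "cut_index C x = i" by blast
  let ?S = "{y. y < dim_col Q \<and> (\<exists>x'<dim_row Q. cut_index C x' = cut_index C x \<and> Q $$ (x', y) = 1)}"
  have "{j. j < dim_col (quotient_mat Q C D) \<and> quotient_mat Q C D $$ (i, j) = 1} \<subseteq> cut_index D ` ?S"
  proof
    fix j assume j: "j \<in> {j. j < dim_col (quotient_mat Q C D) \<and> quotient_mat Q C D $$ (i, j) = 1}"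
    then have jd: "j < dim_col (quotient_mat Q C D)" "quotient_mat Q C D $$ (i, j) = 1" by simp_all
    from jd(2)[unfolded quotient_mat_eq_1[OF assms(4) jd(1)]]
    obtain x' y where "x' < dim_row Q" "y < dim_col Q" "cut_index C x' = i" "cut_index D y = j" "Q $$ (x', y) = 1"
      by (elim exE conjE)
    then show "j \<in> cut_index D ` ?S" using x(2) by (intro image_eqI[of _ _ y]) auto
  qed
  then have "card {j. j < dim_col (quotient_mat Q C D) \<and> quotient_mat Q C D $$ (i, j) = 1} \<le> card (cut_index D ` ?S)"
    by (intro card_mono) auto
  also have "\<dots> \<le> w" using assms(1) x(1) unfolding block_degrees_le_def by blast
  finally show ?thesis .
next
  case False
  then have "{j. j < dim_col (quotient_mat Q C D) \<and> quotient_mat Q C D $$ (i, j) = 1} = {}"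
    using quotient_mat_eq_1[OF assms(4)] by (metis (mono_tags, lifting) Collect_empty_eq)
  then show ?thesis by (metis card.empty zero_le)
qed

lemma quotient_width:
  assumes "block_degrees_le Q C D w" "block_degrees_le (transpose_mat Q) D C w" "finite C" "finite D"
  shows "mat_width (quotient_mat Q C D) \<le> w"
proof -
  let ?A = "quotient_mat Q C D"
  have r: "card {j. j < dim_col ?A \<and> ?A $$ (i, j) = 1} \<le> w" if "i < dim_row ?A" for i
    using quotient_row_le assms that by blast
  have c: "card {i. i < dim_row ?A \<and> ?A $$ (i, j) = 1} \<le> w" if j: "j < dim_col ?A" for j
  proof -
    have "card {i. i < dim_col (transpose_mat ?A) \<and> transpose_mat ?A $$ (j, i) = 1} \<le> w"
      using quotient_row_le[OF assms(2,4,3)] j by (simp add: transpose_quotient[symmetric])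
    moreover have "{i. i < dim_col (transpose_mat ?A) \<and> transpose_mat ?A $$ (j, i) = 1}
        = {i. i < dim_row ?A \<and> ?A $$ (i, j) = 1}"
      using j by auto
    ultimately show ?thesis by simp
  qed
  have "0 < dim_row ?A" by (simp add: quotient_mat_def)
  then have ne: "{card {j. j < dim_col ?A \<and> ?A $$ (i, j) = 1} | i. i < dim_row ?A} \<noteq> {}" by blast
  show ?thesis unfolding mat_width_def
    by (subst Max_le_iff[OF finite_mat_width_set]) (use ne r c in auto)
qed

lemma card_image_le_of_factor:
  assumes "finite S" "\<And>y y'. y \<in> S \<Longrightarrow> y' \<in> S \<Longrightarrow> f y = f y' \<Longrightarrow> g y = g y'"
  shows "card (g ` S) \<le> card (f ` S)"
proof -
  have "g (SOME y'. y' \<in> S \<and> f y' = f y) = g y" if "y \<in> S" for y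
    by (rule assms(2)) (use someI_ex[of "\<lambda>y'. y' \<in> S \<and> f y' = f y"] that in auto)
  then have "g ` S = (\<lambda>z. g (SOME y. y \<in> S \<and> f y = z)) ` (f ` S)"
    by (simp add: image_image cong: image_cong_simp)
  then show ?thesis using card_image_le[OF finite_imageI[OF assms(1)]] by simp
qed

text \<open>The rows of a quotient are a coarsening of the rows of a finer one, so a bound for the
  coarsest rows against the finest columns covers all quotients in between.\<close>

lemma block_degrees_between:
  assumes "block_degrees_le Q C\<^sub>0 D w" "C\<^sub>0 \<subseteq> C'" "D' \<subseteq> D" "finite C'" "finite D"
  shows "block_degrees_le Q C' D' w"
  unfolding block_degrees_le_def
proof (intro allI impI)
  fix x assume x: "x < dim_row Q"
  let ?S = "\<lambda>C. {y. y < dim_col Q \<and> (\<exists>x'<dim_row Q. cut_index C x' = cut_index C x \<and> Q $$ (x', y) = 1)}"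
  have "?S C' \<subseteq> ?S C\<^sub>0"
    by (intro Collect_mono) (use cut_index_coarser[OF assms(4,2)] in metis)
  then have "card (cut_index D' ` ?S C') \<le> card (cut_index D' ` ?S C\<^sub>0)"
    by (intro card_mono image_mono) auto
  also have "\<dots> \<le> card (cut_index D ` ?S C\<^sub>0)"
  proof (rule card_image_le_of_factor)
    show "cut_index D' y = cut_index D' y'" if "cut_index D y = cut_index D y'" for y y'
      by (rule cut_index_coarser[OF assms(5,3) that])
  qed simp
  also have "\<dots> \<le> w" using assms(1) x by (simp add: block_degrees_le_def)
  finally show "card (cut_index D' ` ?S C') \<le> w" .
qed

text \<open>First all superfluous row cuts are removed and then all superfluous column cuts. Every quotient on the
  way lies between the two given ones.\<close>

lemma contractible_coarsen:
  assumes fin: "finite C" "finite D" and sub: "C\<^sub>0 \<subseteq> C" "D\<^sub>0 \<subseteq> D"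
    and rows: "block_degrees_le Q C\<^sub>0 D w" and cols: "block_degrees_le (transpose_mat Q) D\<^sub>0 C w"
    and fin0: "contractible (quotient_mat Q C\<^sub>0 D\<^sub>0) w"
  shows "contractible (quotient_mat Q C D) w"
proof -
  have wd: "mat_width (quotient_mat Q C' D') \<le> w"
    if "C\<^sub>0 \<subseteq> C'" "C' \<subseteq> C" "D\<^sub>0 \<subseteq> D'" "D' \<subseteq> D" for C' D'
    using that fin rows cols
    by (intro quotient_width block_degrees_between[OF rows] block_degrees_between[OF cols])
       (auto intro: finite_subset)
  have "contractible (quotient_mat Q (C\<^sub>0 \<union> E) D\<^sub>0) w" if "E \<subseteq> C - C\<^sub>0" for E
    using finite_subset[OF that finite_Diff[OF fin(1)]] that
  proof (induction E)
    case empty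
    then show ?case using fin0 by simp
  next
    case (insert e E)
    have "(C\<^sub>0 \<union> insert e E) - {e} = C\<^sub>0 \<union> E" using insert by auto
    moreover have "finite (C\<^sub>0 \<union> insert e E)" "finite D\<^sub>0"
      using fin sub insert by (auto intro: finite_subset)
    ultimately have "identification (quotient_mat Q (C\<^sub>0 \<union> insert e E) D\<^sub>0) (quotient_mat Q (C\<^sub>0 \<union> E) D\<^sub>0)"
      using quotient_remove_row_cut[of "C\<^sub>0 \<union> insert e E" e D\<^sub>0 Q] by simp
    moreover have "mat_width (quotient_mat Q (C\<^sub>0 \<union> insert e E) D\<^sub>0) \<le> w"
      using insert.prems sub by (intro wd) blast+
    moreover have "contractible (quotient_mat Q (C\<^sub>0 \<union> E) D\<^sub>0) w"
      using insert.IH insert.prems by simp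
    ultimately show ?case by (rule contractible_step) (simp_all add: quotient_mat_def)
  qed
  from this[of "C - C\<^sub>0"] have 1: "contractible (quotient_mat Q C D\<^sub>0) w"
    using sub by (simp add: Un_absorb1)
  have "contractible (quotient_mat Q C (D\<^sub>0 \<union> E)) w" if "E \<subseteq> D - D\<^sub>0" for E
    using finite_subset[OF that finite_Diff[OF fin(2)]] that
  proof (induction E)
    case empty
    then show ?case using 1 by simp
  next
    case (insert e E)
    have "(D\<^sub>0 \<union> insert e E) - {e} = D\<^sub>0 \<union> E" using insert by auto
    moreover have "finite (D\<^sub>0 \<union> insert e E)"
      using fin sub insert by (auto intro: finite_subset)
    ultimately have "identification (quotient_mat Q C (D\<^sub>0 \<union> insert e E)) (quotient_mat Q C (D\<^sub>0 \<union> E))"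
      using quotient_remove_col_cut[of C "D\<^sub>0 \<union> insert e E" e Q] fin by simp
    moreover have "mat_width (quotient_mat Q C (D\<^sub>0 \<union> insert e E)) \<le> w"
      using insert.prems sub by (intro wd) blast+
    moreover have "contractible (quotient_mat Q C (D\<^sub>0 \<union> E)) w"
      using insert.IH insert.prems by simp
    ultimately show ?case by (rule contractible_step) (simp_all add: quotient_mat_def)
  qed
  from this[of "D - D\<^sub>0"] show ?thesis
    using sub by (simp add: Un_absorb1)
qed

lemma quotient_no_cuts_contractible:
  assumes "dim_row Q > 0" "dim_col Q > 0" "w \<ge> 1"
  shows "contractible (quotient_mat Q {} {}) w"
proof (rule contractible_1)
  show "quotient_mat Q {} {} \<in> carrier_mat 1 1" by (simp add: quotient_mat_def)
  have "block_degrees_le Q {} {} w" for Q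
    unfolding block_degrees_le_def
  proof (intro allI impI)
    fix x assume "x < dim_row Q"
    have "card (cut_index {} ` S) \<le> w" for S
    proof -
      have "card (cut_index {} ` S) \<le> card {0::nat}"
        by (rule card_mono) (auto simp: cut_index_def)
      then show ?thesis using assms(3) by simp
    qed
    then show "card (cut_index {} ` {y. y < dim_col Q \<and>
        (\<exists>x'<dim_row Q. cut_index {} x' = cut_index {} x \<and> Q $$ (x', y) = 1)}) \<le> w" .
  qed
  then show "mat_width (quotient_mat Q {} {}) \<le> w" by (intro quotient_width) auto
qed

text \<open>The strict twin-width is a least element, which has no useful properties unless there is some
  sequence at all; one is obtained by removing all cuts.\<close>

lemma contractible_exists:
  assumes "dim_row Q > 0" "dim_col Q > 0" "\<And>x y. x < dim_row Q \<Longrightarrow> y < dim_col Q \<Longrightarrow> Q $$ (x, y) \<le> 1"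
  shows "\<exists>w. contractible Q w"
proof -
  define w where "w = Suc (dim_row Q + dim_col Q)"
  have b: "block_degrees_le Q' C D w" if "dim_col Q' < w" for Q' C D
    unfolding block_degrees_le_def
  proof (intro allI impI)
    fix x
    let ?S = "{y. y < dim_col Q' \<and> (\<exists>x'<dim_row Q'. cut_index C x' = cut_index C x \<and> Q' $$ (x', y) = 1)}"
    have "card (cut_index D ` ?S) \<le> card ?S" by (rule card_image_le) simp
    also have "\<dots> \<le> card {..<dim_col Q'}" by (rule card_mono) auto
    finally show "card (cut_index D ` ?S) \<le> w" using that by simp
  qed
  have "contractible (quotient_mat Q {1..<dim_row Q} {1..<dim_col Q}) w"
    by (rule contractible_coarsen[where C\<^sub>0="{}" and D\<^sub>0="{}"])
       (use b quotient_no_cuts_contractible[OF assms(1,2)] in \<open>auto simp: w_def\<close>)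
  then show ?thesis using quotient_all_cuts[OF assms] by auto
qed

lemma grid_stww_fin:
  assumes "has_grid A k l u l' u'" "strict_parts k l u" "strict_parts k l' u'" "k > 0"
  shows "k \<le> 2 * stww_fin A"
proof -
  have "u 0 < dim_row A" "l 0 < u 0" "u' 0 < dim_col A" "l' 0 < u' 0"
    "\<And>x y. x < dim_row A \<Longrightarrow> y < dim_col A \<Longrightarrow> A $$ (x, y) \<le> 1"
    using assms by (auto simp: has_grid_def strict_parts_def)
  then obtain w where "contractible A w" using contractible_exists[of A] by fastforce
  then show ?thesis using stww_fin_attained grid_sequence_width[OF assms] by metis
qed

section \<open>Finite submatrices of lexicographically ordered matrices\<close>

lemma sorted_wrt_unique:
  assumes "antisym r" "sorted_wrt (\<lambda>x y. (x, y) \<in> r \<and> x \<noteq> y) xs"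
    "sorted_wrt (\<lambda>x y. (x, y) \<in> r \<and> x \<noteq> y) ys" "set xs = set ys"
  shows "xs = ys"
  using assms(2,3,4)
proof (induction xs arbitrary: ys)
  case (Cons x xs)
  then obtain y ys' where ys: "ys = y # ys'" by (cases ys) auto
  have "x = y"
  proof (rule ccontr)
    assume ne: "x \<noteq> y"
    then have "x \<in> set ys'" "y \<in> set xs" using Cons.prems(3) ys by (auto simp: set_eq_iff)
    then have "(x, y) \<in> r" "(y, x) \<in> r" using Cons.prems ys by auto
    then show False using assms(1) ne by (auto simp: antisym_def)
  qed
  moreover have "x \<notin> set xs" "y \<notin> set ys'" using Cons.prems ys by auto
  ultimately have "set xs = set ys'" using Cons.prems(3) ys by (metis insert_ident list.simps(15))
  then show ?case using Cons ys \<open>x = y\<close> by auto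
qed simp

lemma increasing_enum:
  assumes lin: "linear_order_on X r" and A: "A \<subseteq> X" "finite A"
  shows "set (increasing_enum r A) = A"
    and "sorted_wrt (\<lambda>x y. (x, y) \<in> r \<and> x \<noteq> y) (increasing_enum r A)"
    and "length (increasing_enum r A) = card A"
proof -
  let ?P = "\<lambda>A xs. set xs = A \<and> sorted_wrt (\<lambda>x y. (x, y) \<in> r \<and> x \<noteq> y) xs"
  have tr: "trans r" and asym: "antisym r" and tot: "total_on X r"
    using lin by (auto simp: order_on_defs)
  have "\<exists>xs. ?P A xs"
    using A(2,1)
  proof (induction A rule: finite_psubset_induct)
    case (psubset A)
    show ?case
    proof (cases "A = {}")
      case False
      have "\<exists>m\<in>A. \<forall>a\<in>A. (m, a) \<in> r \<or> m = a"
        using psubset(1) False psubset(3)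
      proof (induction A rule: finite_ne_induct)
        case (insert x F)
        then obtain m where m: "m \<in> F" "\<forall>a\<in>F. (m, a) \<in> r \<or> m = a" by blast
        have "(m, x) \<in> r \<or> (x, m) \<in> r \<or> m = x"
          using tot insert.prems m by (auto simp: total_on_def)
        then show ?case using m tr by (metis insertE insertI1 insertI2 transE)
      qed auto
      then obtain m where m: "m \<in> A" "\<And>a. a \<in> A \<Longrightarrow> (m, a) \<in> r \<or> m = a" by blast
      obtain xs where "?P (A - {m}) xs" using psubset(2)[of "A - {m}"] psubset(3) m(1) by blast
      then have "?P A (m # xs)" using m by auto
      then show ?thesis by blast
    qed (auto intro: exI[of _ "[]"])
  qed
  then obtain xs where xs: "?P A xs" by blast
  have "?P A (THE xs. ?P A xs)"
  proof (rule theI[of "?P A", OF xs])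
    fix ys assume "?P A ys"
    then show "ys = xs" using sorted_wrt_unique[OF asym, of ys xs] xs by simp
  qed
  then have *: "?P A (increasing_enum r A)" unfolding increasing_enum_def .
  then show 1: "set (increasing_enum r A) = A"
    and 2: "sorted_wrt (\<lambda>x y. (x, y) \<in> r \<and> x \<noteq> y) (increasing_enum r A)" by auto
  have "distinct (increasing_enum r A)"
    using 2 unfolding distinct_conv_nth sorted_wrt_iff_nth_less by (metis nat_neq_iff)
  then show "length (increasing_enum r A) = card A" using 1 by (metis distinct_card)
qed

definition lexless :: "(nat \<Rightarrow> nat) \<Rightarrow> (nat \<Rightarrow> nat) \<Rightarrow> bool" where
  "lexless a b \<longleftrightarrow> (\<exists>i. a i < b i \<and> (\<forall>j<i. a j = b j))"

lemma lexless_trans: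
  assumes "lexless a b" "lexless b c"
  shows "lexless a c"
proof -
  obtain i k where i: "a i < b i" "\<forall>j<i. a j = b j" and k: "b k < c k" "\<forall>j<k. b j = c j"
    using assms by (auto simp: lexless_def)
  show ?thesis unfolding lexless_def
  proof (intro exI[of _ "min i k"] conjI allI impI)
    show "a (min i k) < c (min i k)"
    proof (cases i k rule: linorder_cases)
      case less
      then show ?thesis using i(1) k(2) by (simp add: min_def)
    next
      case equal
      then show ?thesis using i(1) k(1) by simp
    next
      case greater
      then show ?thesis using i(2) k(1) by (simp add: min_def)
    qed
  qed (use i(2) k(2) in simp)
qed

lemma lexless_irrefl: "\<not> lexless a a"
  by (auto simp: lexless_def)

lemma lexless_total:
  assumes "a \<noteq> b"
  shows "lexless a b \<or> lexless b a"
proof -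
  have ex: "\<exists>i. a i \<noteq> b i" using assms by auto
  define i where "i = (LEAST i. a i \<noteq> b i)"
  have i: "a i \<noteq> b i" unfolding i_def by (rule LeastI_ex[OF ex])
  have lt: "\<forall>j<i. a j = b j" unfolding i_def by (meson not_less_Least)
  from i consider "a i < b i" | "b i < a i" by linarith
  then show ?thesis
  proof cases
    case 1
    then show ?thesis using lt unfolding lexless_def by blast
  next
    case 2
    then have "lexless b a" unfolding lexless_def using lt by (intro exI[of _ i]) simp
    then show ?thesis ..
  qed
qed

definition lex_rel :: "'a set \<Rightarrow> ('a \<Rightarrow> nat \<Rightarrow> nat) \<Rightarrow> 'a rel" where
  "lex_rel X c = {(x, y). x \<in> X \<and> y \<in> X \<and> (x = y \<or> lexless (c x) (c y))}"

lemma linear_order_lex_rel: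
  assumes "inj_on c X"
  shows "linear_order_on X (lex_rel X c)"
proof -
  have "trans (lex_rel X c)"
    by (rule transI) (auto simp: lex_rel_def intro: lexless_trans)
  moreover have "antisym (lex_rel X c)"
    by (rule antisymI) (auto simp: lex_rel_def dest: lexless_trans simp: lexless_irrefl)
  moreover have "total_on X (lex_rel X c)"
  proof (rule total_onI)
    fix x y assume "x \<in> X" "y \<in> X" "x \<noteq> y"
    then show "(x, y) \<in> lex_rel X c \<or> (y, x) \<in> lex_rel X c"
      using lexless_total[of "c x" "c y"] inj_onD[OF assms] by (auto simp: lex_rel_def)
  qed
  ultimately show ?thesis
    by (auto simp: order_on_defs refl_on_def lex_rel_def)
qed

text \<open>Two codes lie in the same class of level \<open>(m, s)\<close> if they agree below \<open>m\<close> and their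
  \<open>m\<close>-th entries lie in the same dyadic interval of length \<open>2 ^ s\<close>. Level \<open>(m + 1, 0)\<close> is finer than
  every level \<open>(m, s)\<close>, and \<open>(m, s)\<close> is the level \<open>(m - 1, 0)\<close> on a finite set once \<open>s\<close> is large.\<close>

definition same_class :: "nat \<Rightarrow> nat \<Rightarrow> (nat \<Rightarrow> nat) \<Rightarrow> (nat \<Rightarrow> nat) \<Rightarrow> bool" where
  "same_class m s a b \<longleftrightarrow> (\<forall>i<m. a i = b i) \<and> a m div 2 ^ s = b m div 2 ^ s"

definition class_cuts :: "nat \<Rightarrow> nat \<Rightarrow> (nat \<Rightarrow> nat) list \<Rightarrow> nat set" where
  "class_cuts m s as = {q \<in> {1..<length as}. \<not> same_class m s (as ! (q - 1)) (as ! q)}"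

lemma same_class_trans: "same_class m s a b \<Longrightarrow> same_class m s b d \<Longrightarrow> same_class m s a d"
  by (auto simp: same_class_def)

lemma same_class_sym: "same_class m s a b \<Longrightarrow> same_class m s b a"
  by (auto simp: same_class_def)

lemma same_class_coarser: "same_class m s a b \<Longrightarrow> same_class m (Suc s) a b"
  by (auto simp: same_class_def div_mult2_eq power_Suc2 simp del: power_Suc)

text \<open>Between two codes with a common prefix of length \<open>m\<close> the order compares the entries at \<open>m\<close>.\<close>

lemma lexless_agree:
  assumes "lexless a b" "lexless b d" "\<forall>i<m. a i = d i"
  shows "\<forall>i<m. a i = b i" "a m \<le> b m" "b m \<le> d m"
proof -
  obtain i k where i: "a i < b i" "\<forall>j<i. a j = b j" and k: "b k < d k" "\<forall>j<k. b j = d j"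
    using assms by (auto simp: lexless_def)
  have im: "m \<le> i \<and> m \<le> k"
  proof (rule ccontr)
    assume "\<not> (m \<le> i \<and> m \<le> k)"
    then have mk: "min i k < m" by auto
    have "a (min i k) < d (min i k)"
    proof (cases i k rule: linorder_cases)
      case less
      then show ?thesis using i(1) k(2) by (simp add: min_def)
    next
      case equal
      then show ?thesis using i(1) k(1) by simp
    next
      case greater
      then show ?thesis using i(2) k(1) by (simp add: min_def)
    qed
    then show False using assms(3) mk by simp
  qed
  then show "\<forall>i<m. a i = b i" using i(2) by simp
  show "a m \<le> b m"
  proof (cases "m = i")
    case False
    then show ?thesis using i(2) im by simp
  qed (use i in simp)
  show "b m \<le> d m"
  proof (cases "m = k")
    case False
    then show ?thesis using k(2) im by simp
  qed (use k in simp)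
qed

lemma same_class_convex:
  assumes "lexless a b" "lexless b d" "same_class m s a d"
  shows "same_class m s a b"
proof -
  have ad: "\<forall>i<m. a i = d i" "a m div 2 ^ s = d m div 2 ^ s"
    using assms(3) by (auto simp: same_class_def)
  note l = lexless_agree[OF assms(1,2) ad(1)]
  have "a m div 2 ^ s \<le> b m div 2 ^ s" "b m div 2 ^ s \<le> d m div 2 ^ s"
    using l by (auto intro: div_le_mono)
  then show ?thesis using l ad by (simp add: same_class_def)
qed

lemma finite_class_cuts [simp]: "finite (class_cuts m s as)"
  by (simp add: class_cuts_def)

lemma class_cuts_coarser: "class_cuts m (Suc s) as \<subseteq> class_cuts m s as"
  using same_class_coarser by (auto simp: class_cuts_def)

text \<open>The classes are intervals of a lexicographically sorted list, so they are given by cuts.\<close>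

lemma cut_index_class_cuts:
  assumes "sorted_wrt lexless as" "p < length as" "q < length as"
  shows "cut_index (class_cuts m s as) p = cut_index (class_cuts m s as) q
     \<longleftrightarrow> same_class m s (as ! p) (as ! q)"
proof -
  have *: "cut_index (class_cuts m s as) p = cut_index (class_cuts m s as) q
     \<longleftrightarrow> same_class m s (as ! p) (as ! q)" if pq: "p \<le> q" "q < length as" for p q
    unfolding cut_index_eq_iff[OF finite_class_cuts pq(1)]
  proof
    assume h: "\<forall>c\<in>class_cuts m s as. \<not> (p < c \<and> c \<le> q)"
    have "same_class m s (as ! p) (as ! r)" if "p \<le> r" "r \<le> q" for r
      using that
    proof (induction r rule: dec_induct)
      case base
      then show ?case by (simp add: same_class_def)
    next
      case (step r)
      then have "Suc r \<notin> class_cuts m s as" using h by auto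
      then have "same_class m s (as ! r) (as ! Suc r)"
        using step pq by (auto simp: class_cuts_def)
      then show ?case using step same_class_trans by (metis Suc_leD)
    qed
    then show "same_class m s (as ! p) (as ! q)" using pq by simp
  next
    assume h: "same_class m s (as ! p) (as ! q)"
    have cl: "same_class m s (as ! p) (as ! r)" if "p \<le> r" "r \<le> q" for r
    proof (cases "p = r \<or> r = q")
      case True
      then show ?thesis using h by (auto simp: same_class_def)
    next
      case False
      then have "lexless (as ! p) (as ! r)" "lexless (as ! r) (as ! q)"
        using assms(1) that pq by (auto simp: sorted_wrt_iff_nth_less)
      then show ?thesis using h same_class_convex by blast
    qed
    show "\<forall>c\<in>class_cuts m s as. \<not> (p < c \<and> c \<le> q)"
    proof (intro ballI notI)
      fix c assume c: "c \<in> class_cuts m s as" "p < c \<and> c \<le> q"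
      then have "same_class m s (as ! p) (as ! (c - 1))" "same_class m s (as ! p) (as ! c)"
        using cl by auto
      then have "same_class m s (as ! (c - 1)) (as ! c)"
        using same_class_trans same_class_sym by blast
      then show False using c by (simp add: class_cuts_def)
    qed
  qed
  show ?thesis
  proof (cases "p \<le> q")
    case True
    then show ?thesis using * assms by blast
  next
    case False
    then show ?thesis using *[of q p] assms same_class_sym by (metis nle_le)
  qed
qed

text \<open>Here \<open>R a b\<close> means that the entry in the row with code \<open>a\<close> and the column with code \<open>b\<close> is 1.\<close>

definition near_matching :: "((nat \<Rightarrow> nat) \<Rightarrow> (nat \<Rightarrow> nat) \<Rightarrow> bool) \<Rightarrow> nat \<Rightarrow> bool" where
  "near_matching R k \<longleftrightarrow>
     (\<forall>a b i. R a b \<longrightarrow> b i \<le> a i + k \<and> a i \<le> b i + k) \<and>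
     (\<forall>a b a' b' m. R a b \<longrightarrow> R a' b' \<longrightarrow> ((\<forall>i<m. a i = a' i) \<longleftrightarrow> (\<forall>i<m. b i = b' i)))"

lemma near_matching_converse: "near_matching R k \<Longrightarrow> near_matching (\<lambda>a b. R b a) k"
  unfolding near_matching_def by blast

text \<open>A dyadic interval of length \<open>2 * t\<close> is enlarged by \<open>k\<close> on both sides, which is at most \<open>k\<close> intervals
  of length \<open>t\<close> on each side.\<close>

lemma dyadic_spread:
  fixes a b k t :: nat
  assumes "a div (2 * t) = u" "b \<le> a + k" "a \<le> b + k" "t > 0"
  shows "b div t \<in> {2 * u - k..2 * u + 1 + k}"
proof -
  have a: "2 * u \<le> a div t" "a div t \<le> 2 * u + 1"
    using assms(1,4) by (auto simp: div_mult2_eq mult.commute[of 2])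
  have "b div t \<le> (a + k * t) div t" using assms by (intro div_le_mono) (simp add: order_trans)
  also have "\<dots> = a div t + k" using assms(4) by simp
  finally have 1: "b div t \<le> a div t + k" .
  have "a div t \<le> (b + k * t) div t" using assms by (intro div_le_mono) (simp add: order_trans)
  also have "\<dots> = b div t + k" using assms(4) by simp
  finally show ?thesis using 1 a by auto
qed

lemma class_block_degrees:
  assumes srt: "sorted_wrt lexless as" "sorted_wrt lexless bs"
    and dims: "dim_row Q = length as" "dim_col Q = length bs"
    and R: "near_matching R k" "\<And>x y. x < dim_row Q \<Longrightarrow> y < dim_col Q \<Longrightarrow> Q $$ (x, y) = 1 \<Longrightarrow> R (as ! x) (bs ! y)"
  shows "block_degrees_le Q (class_cuts m (Suc s) as) (class_cuts m s bs) (2 * k + 2)"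
  unfolding block_degrees_le_def
proof (intro allI impI)
  fix x assume x: "x < dim_row Q"
  let ?S = "{y. y < dim_col Q \<and> (\<exists>x'<dim_row Q. cut_index (class_cuts m (Suc s) as) x' =
      cut_index (class_cuts m (Suc s) as) x \<and> Q $$ (x', y) = 1)}"
  define u where "u = (as ! x) m div 2 ^ Suc s"
  have S: "\<exists>x'. R (as ! x') (bs ! y) \<and> same_class m (Suc s) (as ! x') (as ! x)" if y: "y \<in> ?S" for y
  proof -
    obtain x' where "x' < dim_row Q" "cut_index (class_cuts m (Suc s) as) x' =
      cut_index (class_cuts m (Suc s) as) x" "Q $$ (x', y) = 1" "y < dim_col Q" using y by blast
    then show ?thesis using R(2) cut_index_class_cuts[OF srt(1)] x dims by metis
  qed
  have fac: "cut_index (class_cuts m s bs) y = cut_index (class_cuts m s bs) y'"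
    if y: "y \<in> ?S" "y' \<in> ?S" and e: "(bs ! y) m div 2 ^ s = (bs ! y') m div 2 ^ s" for y y'
  proof -
    obtain x1 x2 where 1: "R (as ! x1) (bs ! y)" "same_class m (Suc s) (as ! x1) (as ! x)"
      and 2: "R (as ! x2) (bs ! y')" "same_class m (Suc s) (as ! x2) (as ! x)"
      using S y by meson
    have "\<forall>i<m. (as ! x1) i = (as ! x2) i" using 1 2 by (simp add: same_class_def)
    then have "\<forall>i<m. (bs ! y) i = (bs ! y') i"
      using R(1) 1(1) 2(1) unfolding near_matching_def by blast
    then have "same_class m s (bs ! y) (bs ! y')" using e by (simp add: same_class_def)
    moreover have "y < length bs" "y' < length bs" using y dims by simp_all
    ultimately show ?thesis using cut_index_class_cuts[OF srt(2)] by blast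
  qed
  have "card (cut_index (class_cuts m s bs) ` ?S) \<le> card ((\<lambda>y. (bs ! y) m div 2 ^ s) ` ?S)"
    by (rule card_image_le_of_factor[OF _ fac]) simp
  also have "\<dots> \<le> card {2 * u - k..2 * u + 1 + k}"
  proof (rule card_mono)
    show "(\<lambda>y. (bs ! y) m div 2 ^ s) ` ?S \<subseteq> {2 * u - k..2 * u + 1 + k}"
    proof (rule image_subsetI)
      fix y assume "y \<in> ?S"
      then obtain x' where x': "R (as ! x') (bs ! y)" "same_class m (Suc s) (as ! x') (as ! x)"
        using S by blast
      then have "(as ! x') m div (2 * 2 ^ s) = u" by (simp add: same_class_def u_def)
      then show "(bs ! y) m div 2 ^ s \<in> {2 * u - k..2 * u + 1 + k}"
        by (rule dyadic_spread) (use x'(1) R(1) in \<open>auto simp: near_matching_def\<close>)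
    qed
  qed simp
  also have "\<dots> \<le> 2 * k + 2" by simp
  finally show "card (cut_index (class_cuts m s bs) ` ?S) \<le> 2 * k + 2" .
qed

text \<open>Starting from a level that separates all codes, the exponent \<open>s\<close> is increased until the level \<open>(m, s)\<close>
  coincides with \<open>(m - 1, 0)\<close>. In the end the level is \<open>(0, s)\<close> with \<open>s\<close> large, which has only one
  class.\<close>

lemma near_matching_contractible:
  assumes srt: "sorted_wrt lexless as" "sorted_wrt lexless bs"
    and dims: "dim_row Q = length as" "dim_col Q = length bs" "as \<noteq> []" "bs \<noteq> []"
    and le1: "\<And>x y. x < dim_row Q \<Longrightarrow> y < dim_col Q \<Longrightarrow> Q $$ (x, y) \<le> 1"
    and R: "near_matching R k" "\<And>x y. x < dim_row Q \<Longrightarrow> y < dim_col Q \<Longrightarrow> Q $$ (x, y) = 1 \<Longrightarrow> R (as ! x) (bs ! y)"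
  shows "contractible Q (2 * k + 2)"
proof -
  let ?w = "2 * k + 2"
  let ?P = "\<lambda>m s. contractible (quotient_mat Q (class_cuts m s as) (class_cuts m s bs)) ?w"
  have coarsen: "?P m s" if "?P m (Suc s)" for m s
  proof (rule contractible_coarsen)
    show "block_degrees_le Q (class_cuts m (Suc s) as) (class_cuts m s bs) ?w"
      by (rule class_block_degrees[OF srt dims(1,2) R])
    show "block_degrees_le (transpose_mat Q) (class_cuts m (Suc s) bs) (class_cuts m s as) ?w"
      by (rule class_block_degrees[OF srt(2,1) _ _ near_matching_converse[OF R(1)]])
         (use dims R(2) in auto)
  qed (use that class_cuts_coarser in auto)
  have down: "?P m 0" if "?P m S" for m S
    using that coarsen by (induction S) auto
  \<comment> \<open>all entries at position \<open>m\<close> are less than \<open>2 ^ S m\<close>, so they lie in one dyadic interval of that length\<close>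
  define S where "S m = (\<Sum>a\<leftarrow>as @ bs. a m)" for m
  have big: "a m div 2 ^ S m = 0" if "a \<in> set (as @ bs)" for a m
  proof -
    have "a m \<le> S m" unfolding S_def
      by (rule member_le_sum_list) (use that in auto)
    also have "S m < 2 ^ S m" by (rule less_exp)
    finally show ?thesis by simp
  qed
  have large: "class_cuts m (S m) cs = {q \<in> {1..<length cs}. \<not> (\<forall>i<m. (cs ! (q - 1)) i = (cs ! q) i)}"
    if cs: "cs = as \<or> cs = bs" for m cs
  proof -
    have "same_class m (S m) (cs ! (q - 1)) (cs ! q) \<longleftrightarrow> (\<forall>i<m. (cs ! (q - 1)) i = (cs ! q) i)"
      if q: "q \<in> {1..<length cs}" for q
    proof -
      have "cs ! (q - 1) \<in> set (as @ bs)" "cs ! q \<in> set (as @ bs)"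
        using q cs by (auto simp: nth_mem)
      then show ?thesis using big unfolding same_class_def by metis
    qed
    then show ?thesis unfolding class_cuts_def by blast
  qed
  have nxt: "class_cuts (Suc m) (S (Suc m)) cs = class_cuts m 0 cs" if cs: "cs = as \<or> cs = bs" for m cs
    unfolding large[OF cs] by (auto simp: class_cuts_def same_class_def less_Suc_eq)
  have P: "?P m 0" for m
  proof (induction m)
    case 0
    have "class_cuts 0 (S 0) as = {}" "class_cuts 0 (S 0) bs = {}"
      using large[of as 0] large[of bs 0] by auto
    then have "?P 0 (S 0)" using dims by (simp add: quotient_no_cuts_contractible)
    then show ?case by (rule down)
  next
    case (Suc m)
    then have "?P (Suc m) (S (Suc m))" using nxt by simp
    then show ?case by (rule down)
  qed
  have sep: "\<exists>M. \<forall>m\<ge>M. class_cuts m 0 cs = {1..<length cs}" if cs: "sorted_wrt lexless cs" for cs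
  proof -
    have "\<exists>i. (cs ! (q - 1)) i \<noteq> (cs ! q) i" if "q \<in> {1..<length cs}" for q
    proof -
      have "lexless (cs ! (q - 1)) (cs ! q)" using cs that by (auto simp: sorted_wrt_iff_nth_less)
      then show ?thesis unfolding lexless_def by (metis nat_neq_iff)
    qed
    then obtain d where d: "\<And>q. q \<in> {1..<length cs} \<Longrightarrow> (cs ! (q - 1)) (d q) \<noteq> (cs ! q) (d q)"
      by metis
    have "class_cuts m 0 cs = {1..<length cs}" if m: "m \<ge> Suc (\<Sum>q\<in>{1..<length cs}. d q)" for m
    proof -
      have "\<not> same_class m 0 (cs ! (q - 1)) (cs ! q)" if q: "q \<in> {1..<length cs}" for q
      proof -
        have "d q \<le> (\<Sum>q\<in>{1..<length cs}. d q)" using q by (intro member_le_sum) auto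
        then have "d q < m" using m by simp
        then show ?thesis using d[OF q] by (auto simp: same_class_def)
      qed
      then show ?thesis by (auto simp: class_cuts_def)
    qed
    then show ?thesis by blast
  qed
  obtain M1 M2 where "\<forall>m\<ge>M1. class_cuts m 0 as = {1..<length as}" "\<forall>m\<ge>M2. class_cuts m 0 bs = {1..<length bs}"
    using sep srt by meson
  then have "class_cuts (max M1 M2) 0 as = {1..<dim_row Q}" "class_cuts (max M1 M2) 0 bs = {1..<dim_col Q}"
    using dims by auto
  then show ?thesis using P[of "max M1 M2"] quotient_all_cuts[OF _ _ le1] dims by simp
qed

lemma finite_submatrix_contractible:
  assumes inj: "inj_on c X" and A: "A \<subseteq> X" "finite A" "A \<noteq> {}" and B: "B \<subseteq> X" "finite B" "B \<noteq> {}"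
    and M: "\<And>x y. M x y \<le> 1" "near_matching R k" "\<And>x y. x \<in> X \<Longrightarrow> y \<in> X \<Longrightarrow> M x y = 1 \<Longrightarrow> R (c x) (c y)"
  shows "contractible (finite_submatrix (lex_rel X c) (lex_rel X c) M A B) (2 * k + 2)"
proof -
  let ?r = "lex_rel X c"
  let ?as = "map c (increasing_enum ?r A)" and ?bs = "map c (increasing_enum ?r B)"
  note lin = linear_order_lex_rel[OF inj]
  note eA = increasing_enum[OF lin A(1,2)] and eB = increasing_enum[OF lin B(1,2)]
  have srt: "sorted_wrt lexless (map c (increasing_enum ?r C))" if "C \<subseteq> X" "finite C" for C
    using increasing_enum(2)[OF lin that] unfolding sorted_wrt_map
    by (rule sorted_wrt_mono_rel[rotated]) (auto simp: lex_rel_def)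
  show ?thesis
  proof (rule near_matching_contractible[of ?as ?bs, OF srt srt _ _ _ _ _ M(2)])
    show "?as \<noteq> []" "?bs \<noteq> []" using eA(1) eB(1) A B by auto
    fix x y assume xy: "x < dim_row (finite_submatrix ?r ?r M A B)" "y < dim_col (finite_submatrix ?r ?r M A B)"
    then have lt: "x < length (increasing_enum ?r A)" "y < length (increasing_enum ?r B)"
      using eA(3) eB(3) by (simp_all add: finite_submatrix_def)
    have "increasing_enum ?r A ! x \<in> X" "increasing_enum ?r B ! y \<in> X"
      using nth_mem[OF lt(1)] nth_mem[OF lt(2)] eA(1) eB(1) A(1) B(1) by blast+
    then show "finite_submatrix ?r ?r M A B $$ (x, y) \<le> 1"
      "finite_submatrix ?r ?r M A B $$ (x, y) = 1 \<Longrightarrow> R (?as ! x) (?bs ! y)"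
      using xy M(1)[of "increasing_enum ?r A ! x" "increasing_enum ?r B ! y"]
        M(3)[of "increasing_enum ?r A ! x" "increasing_enum ?r B ! y"] lt
      by (simp_all add: finite_submatrix_def)
  qed (use A B eA eB in \<open>auto simp: finite_submatrix_def\<close>)
qed

lemma stww_lex_le:
  assumes "inj_on c X" "X \<noteq> {}" "\<And>x y. M x y \<le> 1" "near_matching R k"
    "\<And>x y. x \<in> X \<Longrightarrow> y \<in> X \<Longrightarrow> M x y = 1 \<Longrightarrow> R (c x) (c y)"
  shows "stww X (lex_rel X c) X (lex_rel X c) M \<le> enat (2 * k + 2)"
proof -
  have *: "stww_fin (finite_submatrix (lex_rel X c) (lex_rel X c) M A B) \<le> 2 * k + 2"
    if "A \<subseteq> X" "finite A" "A \<noteq> {}" "B \<subseteq> X" "finite B" "B \<noteq> {}" for A B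
    by (rule stww_fin_le, rule finite_submatrix_contractible[of c X A B M R k])
       (fact assms that)+
  show ?thesis
  proof (cases "finite X")
    case True
    then show ?thesis using *[OF order_refl True assms(2) order_refl True assms(2)] by (simp add: stww_def)
  next
    case False
    have "enat (stww_fin (finite_submatrix (lex_rel X c) (lex_rel X c) M A B)) \<le> enat (2 * k + 2)"
      if "(A, B) \<in> {(A, B). A \<subseteq> X \<and> finite A \<and> A \<noteq> {} \<and> B \<subseteq> X \<and> finite B \<and> B \<noteq> {}}" for A B
      using *[of A B] that by simp
    then show ?thesis using False unfolding stww_def by (auto intro!: SUP_least simp del: enat_ord_simps)
  qed
qed

section \<open>Correlations of functions on finite groups\<close>

locale finite_group = group G for G (structure) +
  assumes finite_carrier: "finite (carrier G)"
begin

lemma sum_left_mult: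
  assumes "a \<in> carrier G"
  shows "(\<Sum>x\<in>carrier G. f (a \<otimes> x)) = (\<Sum>x\<in>carrier G. f x)"
  by (rule sum.reindex_bij_witness[of _ "\<lambda>x. inv a \<otimes> x" "\<lambda>x. a \<otimes> x"])
     (use assms in \<open>auto simp: m_assoc[symmetric]\<close>)

lemma sum_right_mult:
  assumes "a \<in> carrier G"
  shows "(\<Sum>x\<in>carrier G. f (x \<otimes> a)) = (\<Sum>x\<in>carrier G. f x)"
  by (rule sum.reindex_bij_witness[of _ "\<lambda>x. x \<otimes> inv a" "\<lambda>x. x \<otimes> a"])
     (use assms in \<open>auto simp: m_assoc\<close>)

lemma sum_inv: "(\<Sum>x\<in>carrier G. f (inv x)) = (\<Sum>x\<in>carrier G. f x)"
  by (rule sum.reindex_bij_witness[of _ "\<lambda>x. inv x" "\<lambda>x. inv x"]) auto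

lemma subgroup_sum_left_mult:
  assumes U: "subgroup U G" "a \<in> U"
  shows "(\<Sum>x\<in>U. f (a \<otimes> x)) = (\<Sum>x\<in>U. f x)"
proof -
  have "x \<in> carrier G" if "x \<in> insert a U" for x using subgroup.mem_carrier[OF U(1)] that U(2) by auto
  then show ?thesis
    by (intro sum.reindex_bij_witness[of _ "\<lambda>x. inv a \<otimes> x" "\<lambda>x. a \<otimes> x"])
       (use U subgroup.m_closed[OF U(1)] subgroup.m_inv_closed[OF U(1)] in \<open>auto simp: m_assoc[symmetric]\<close>)
qed

lemma subgroup_sum_div:
  assumes U: "subgroup U G" "a \<in> U"
  shows "(\<Sum>x\<in>U. f (x \<otimes> inv a)) = (\<Sum>x\<in>U. f x)"
proof -
  have "x \<in> carrier G" if "x \<in> insert a U" for x using subgroup.mem_carrier[OF U(1)] that U(2) by auto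
  then show ?thesis
    by (intro sum.reindex_bij_witness[of _ "\<lambda>x. x \<otimes> a" "\<lambda>x. x \<otimes> inv a"])
       (use U subgroup.m_closed[OF U(1)] subgroup.m_inv_closed[OF U(1)] in \<open>auto simp: m_assoc\<close>)
qed

definition corr :: "('a \<Rightarrow> real) \<Rightarrow> 'a \<Rightarrow> real" where
  "corr F k = (\<Sum>x\<in>carrier G. F x * F (k \<otimes> x))"

text \<open>For an abelian subgroup \<open>U\<close> this is Bessel's inequality for the Fourier transform on \<open>U\<close> in
  disguise. Writing \<open>D x y\<close> for the convolution along \<open>U\<close> of \<open>A\<close> at \<open>x\<close> with \<open>B\<close> at \<open>y\<close>, the
  difference of the two sides is half the sum of the squares of \<open>D x y - D y x\<close>.\<close>

lemma abelian_correlation: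
  fixes A B :: "'a \<Rightarrow> real"
  assumes U: "subgroup U G" and comm: "\<And>u v. u \<in> U \<Longrightarrow> v \<in> U \<Longrightarrow> u \<otimes> v = v \<otimes> u"
  shows "(\<Sum>u\<in>U. (\<Sum>x\<in>carrier G. A (u \<otimes> x) * B x)\<^sup>2) \<le> (\<Sum>w\<in>U. corr A w * corr B w)"
proof -
  let ?K = "carrier G"
  have UK [simp]: "u \<in> ?K" if "u \<in> U" for u using subgroup.mem_carrier[OF U that] .
  have Ui [simp]: "inv u \<in> U" if "u \<in> U" for u using subgroup.m_inv_closed[OF U that] .
  have Um [simp]: "u \<otimes> v \<in> U" if "u \<in> U" "v \<in> U" for u v using subgroup.m_closed[OF U that] .
  define c where "c u = (\<Sum>x\<in>?K. A (u \<otimes> x) * B x)" for u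
  define D where "D x y = (\<Sum>s\<in>U. A (s \<otimes> x) * B (inv s \<otimes> y))" for x y
  have finU: "finite U" using finite_subset[OF subgroup.subset[OF U] finite_carrier] .
  have "card U > 0" using finU subgroup.one_closed[OF U] by (auto simp: card_gt_0_iff)
  have sw: "(\<Sum>x\<in>?K. \<Sum>y\<in>?K. (\<Sum>s\<in>U. \<Sum>t\<in>U. f s t x * g s t y)) =
      (\<Sum>s\<in>U. \<Sum>t\<in>U. (\<Sum>x\<in>?K. f s t x) * (\<Sum>y\<in>?K. g s t y))" for f g :: "'a \<Rightarrow> 'a \<Rightarrow> 'a \<Rightarrow> real"
  proof -
    have "(\<Sum>x\<in>?K. \<Sum>y\<in>?K. (\<Sum>s\<in>U. \<Sum>t\<in>U. f s t x * g s t y)) =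
        (\<Sum>x\<in>?K. \<Sum>s\<in>U. \<Sum>y\<in>?K. \<Sum>t\<in>U. f s t x * g s t y)"
      by (intro sum.cong refl sum.swap)
    also have "\<dots> = (\<Sum>s\<in>U. \<Sum>x\<in>?K. \<Sum>y\<in>?K. \<Sum>t\<in>U. f s t x * g s t y)" by (rule sum.swap)
    also have "\<dots> = (\<Sum>s\<in>U. \<Sum>x\<in>?K. \<Sum>t\<in>U. \<Sum>y\<in>?K. f s t x * g s t y)"
      by (intro sum.cong refl sum.swap)
    also have "\<dots> = (\<Sum>s\<in>U. \<Sum>t\<in>U. \<Sum>x\<in>?K. \<Sum>y\<in>?K. f s t x * g s t y)"
      by (intro sum.cong refl sum.swap)
    finally show ?thesis by (simp add: sum_product)
  qed
  have 1: "(\<Sum>x\<in>?K. \<Sum>y\<in>?K. (D x y)\<^sup>2) = card U * (\<Sum>w\<in>U. corr A w * corr B w)"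
  proof -
    have "(\<Sum>x\<in>?K. \<Sum>y\<in>?K. (D x y)\<^sup>2) = (\<Sum>x\<in>?K. \<Sum>y\<in>?K. \<Sum>s\<in>U. \<Sum>t\<in>U.
        (A (s \<otimes> x) * A (t \<otimes> x)) * (B (inv s \<otimes> y) * B (inv t \<otimes> y)))"
      by (simp add: D_def power2_eq_square sum_product mult_ac)
    also have "\<dots> = (\<Sum>s\<in>U. \<Sum>t\<in>U. (\<Sum>x\<in>?K. A (s \<otimes> x) * A (t \<otimes> x)) * (\<Sum>y\<in>?K. B (inv s \<otimes> y) * B (inv t \<otimes> y)))"
      by (rule sw)
    also have "\<dots> = (\<Sum>s\<in>U. \<Sum>t\<in>U. corr A (t \<otimes> inv s) * corr B (t \<otimes> inv s))"
    proof (intro sum.cong refl arg_cong2[where f="(*)"])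
      fix s t assume st: "s \<in> U" "t \<in> U"
      show "(\<Sum>x\<in>?K. A (s \<otimes> x) * A (t \<otimes> x)) = corr A (t \<otimes> inv s)"
        unfolding corr_def using st
        by (subst sum_left_mult[of s "\<lambda>x. A x * A (t \<otimes> inv s \<otimes> x)", symmetric]) (auto simp: m_assoc l_inv_ex inv_solve_left intro!: sum.cong arg_cong2[where f="(*)"] arg_cong[where f=A])
      have "inv s \<otimes> (t \<otimes> y) = t \<otimes> inv s \<otimes> y" if "y \<in> ?K" for y
        using comm[of "inv s" t] st that by (simp add: m_assoc[symmetric])
      then show "(\<Sum>y\<in>?K. B (inv s \<otimes> y) * B (inv t \<otimes> y)) = corr B (t \<otimes> inv s)"
        unfolding corr_def using st
        by (subst sum_left_mult[of t, symmetric]) (auto simp: m_assoc[symmetric] mult.commute intro!: sum.cong)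
    qed
    also have "\<dots> = (\<Sum>s\<in>U. \<Sum>w\<in>U. corr A w * corr B w)"
      by (intro sum.cong refl subgroup_sum_div[OF U, of _ "\<lambda>w. corr A w * corr B w"])
    finally show ?thesis by simp
  qed
  have 2: "(\<Sum>x\<in>?K. \<Sum>y\<in>?K. D x y * D y x) = card U * (\<Sum>u\<in>U. (c u)\<^sup>2)"
  proof -
    have "(\<Sum>x\<in>?K. \<Sum>y\<in>?K. D x y * D y x) = (\<Sum>x\<in>?K. \<Sum>y\<in>?K. \<Sum>s\<in>U. \<Sum>t\<in>U.
        (A (s \<otimes> x) * B (inv t \<otimes> x)) * (A (t \<otimes> y) * B (inv s \<otimes> y)))"
      by (simp add: D_def power2_eq_square sum_product mult_ac)
    also have "\<dots> = (\<Sum>s\<in>U. \<Sum>t\<in>U. (\<Sum>x\<in>?K. A (s \<otimes> x) * B (inv t \<otimes> x)) * (\<Sum>y\<in>?K. A (t \<otimes> y) * B (inv s \<otimes> y)))"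
      by (rule sw)
    also have "\<dots> = (\<Sum>s\<in>U. \<Sum>t\<in>U. c (s \<otimes> t) * c (s \<otimes> t))"
    proof (intro sum.cong refl arg_cong2[where f="(*)"])
      have *: "(\<Sum>x\<in>?K. A (s \<otimes> x) * B (inv t \<otimes> x)) = c (s \<otimes> t)" if "s \<in> U" "t \<in> U" for s t
        unfolding c_def using that
        by (subst sum_left_mult[of t, symmetric]) (auto simp: m_assoc[symmetric] intro!: sum.cong)
      fix s t assume "s \<in> U" "t \<in> U"
      then show "(\<Sum>x\<in>?K. A (s \<otimes> x) * B (inv t \<otimes> x)) = c (s \<otimes> t)"
        "(\<Sum>x\<in>?K. A (t \<otimes> x) * B (inv s \<otimes> x)) = c (s \<otimes> t)"
        using *[of s t] *[of t s] comm[of s t] by simp_all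
    qed
    also have "\<dots> = (\<Sum>s\<in>U. \<Sum>u\<in>U. c u * c u)"
      by (intro sum.cong refl subgroup_sum_left_mult[OF U, of _ "\<lambda>w. c w * c w"])
    finally show ?thesis by (simp add: power2_eq_square)
  qed
  have "0 \<le> (\<Sum>x\<in>?K. \<Sum>y\<in>?K. (D x y - D y x)\<^sup>2)" by (intro sum_nonneg) simp
  also have "\<dots> = (\<Sum>x\<in>?K. \<Sum>y\<in>?K. (D x y)\<^sup>2) + (\<Sum>x\<in>?K. \<Sum>y\<in>?K. (D y x)\<^sup>2)
      - 2 * (\<Sum>x\<in>?K. \<Sum>y\<in>?K. D x y * D y x)"
    by (simp add: power2_diff sum.distrib sum_subtractf sum_distrib_left mult.assoc)
  also have "(\<Sum>x\<in>?K. \<Sum>y\<in>?K. (D y x)\<^sup>2) = (\<Sum>x\<in>?K. \<Sum>y\<in>?K. (D x y)\<^sup>2)" by (rule sum.swap)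
  finally have "card U * (\<Sum>u\<in>U. (c u)\<^sup>2) \<le> card U * (\<Sum>w\<in>U. corr A w * corr B w)"
    using 1 2 by simp
  then show ?thesis using \<open>card U > 0\<close> unfolding c_def by simp
qed

text \<open>Averaging over conjugates makes the correlation a class function, which is how conjugacy of the elements
  of a subgroup enters below.\<close>

definition class_corr :: "('a \<Rightarrow> real) \<Rightarrow> 'a \<Rightarrow> real" where
  "class_corr F w = (\<Sum>k\<in>carrier G. corr F (inv k \<otimes> w \<otimes> k))"

lemma corr_inv:
  assumes "w \<in> carrier G"
  shows "corr F (inv w) = corr F w"
  unfolding corr_def using assms
  by (subst sum_left_mult[of w, symmetric]) (auto simp: m_assoc[symmetric] mult.commute intro!: sum.cong)

lemma class_corr_inv: "w \<in> carrier G \<Longrightarrow> class_corr F (inv w) = class_corr F w"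
proof -
  assume w: "w \<in> carrier G"
  have "inv k \<otimes> inv w \<otimes> k = inv (inv k \<otimes> w \<otimes> k)" if "k \<in> carrier G" for k
    using w that by (simp add: inv_mult_group m_assoc)
  then show ?thesis unfolding class_corr_def using w by (simp add: corr_inv cong: sum.cong)
qed

lemma class_corr_conj:
  assumes "w \<in> carrier G" "h \<in> carrier G"
  shows "class_corr F (inv h \<otimes> w \<otimes> h) = class_corr F w"
proof -
  have "inv k \<otimes> (inv h \<otimes> w \<otimes> h) \<otimes> k = inv (h \<otimes> k) \<otimes> w \<otimes> (h \<otimes> k)" if "k \<in> carrier G" for k
    using assms that by (simp add: inv_mult_group m_assoc)
  then have "class_corr F (inv h \<otimes> w \<otimes> h) = (\<Sum>k\<in>carrier G. corr F (inv (h \<otimes> k) \<otimes> w \<otimes> (h \<otimes> k)))"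
    unfolding class_corr_def by simp
  also have "\<dots> = class_corr F w"
    unfolding class_corr_def by (rule sum_left_mult[OF assms(2)])
  finally show ?thesis .
qed

lemma abs_corr_le:
  assumes "k \<in> carrier G"
  shows "\<bar>corr F k\<bar> \<le> corr F \<one>"
proof -
  have "\<bar>corr F k\<bar> \<le> (\<Sum>x\<in>carrier G. \<bar>F x * F (k \<otimes> x)\<bar>)" unfolding corr_def by (rule sum_abs)
  also have "\<dots> \<le> (\<Sum>x\<in>carrier G. ((F x)\<^sup>2 + (F (k \<otimes> x))\<^sup>2) / 2)"
  proof (intro sum_mono)
    fix x
    have "0 \<le> (\<bar>F x\<bar> - \<bar>F (k \<otimes> x)\<bar>)\<^sup>2" by simp
    then show "\<bar>F x * F (k \<otimes> x)\<bar> \<le> ((F x)\<^sup>2 + (F (k \<otimes> x))\<^sup>2) / 2"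
      by (simp add: power2_diff abs_mult)
  qed
  also have "\<dots> = (\<Sum>x\<in>carrier G. (F x)\<^sup>2)"
    using sum_left_mult[OF assms, of "\<lambda>x. (F x)\<^sup>2"] by (simp add: sum_divide_distrib[symmetric] sum.distrib)
  also have "\<dots> = corr F \<one>" by (simp add: corr_def power2_eq_square)
  finally show ?thesis .
qed

text \<open>This is the abelian case for the subgroup \<open>U\<close>, applied to \<open>F\<close> and each of its translates.\<close>

lemma sum_corr_squared:
  assumes U: "subgroup U G" and comm: "\<And>u v. u \<in> U \<Longrightarrow> v \<in> U \<Longrightarrow> u \<otimes> v = v \<otimes> u"
  shows "card U * (\<Sum>k\<in>carrier G. (corr F k)\<^sup>2) \<le> (\<Sum>w\<in>U. corr F w * class_corr F w)"
proof -
  let ?K = "carrier G"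
  have UK [simp]: "u \<in> ?K" if "u \<in> U" for u using subgroup.mem_carrier[OF U that] .
  have "card U * (\<Sum>k\<in>?K. (corr F k)\<^sup>2) = (\<Sum>u\<in>U. \<Sum>k\<in>?K. (corr F (u \<otimes> k))\<^sup>2)"
    using sum_left_mult[of _ "\<lambda>k. (corr F k)\<^sup>2"] by simp
  also have "\<dots> = (\<Sum>k\<in>?K. \<Sum>u\<in>U. (corr F (u \<otimes> k))\<^sup>2)" by (rule sum.swap)
  also have "\<dots> \<le> (\<Sum>k\<in>?K. \<Sum>w\<in>U. corr F w * corr F (inv k \<otimes> w \<otimes> k))"
  proof (rule sum_mono)
    fix k assume k: "k \<in> ?K"
    have "corr F (u \<otimes> k) = (\<Sum>y\<in>?K. F (u \<otimes> y) * F (inv k \<otimes> y))" if "u \<in> U" for u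
      unfolding corr_def using k that
      by (subst sum_left_mult[of k "\<lambda>y. F (u \<otimes> y) * F (inv k \<otimes> y)", symmetric])
         (auto simp: m_assoc[symmetric] mult.commute intro!: sum.cong)
    moreover have "corr (\<lambda>y. F (inv k \<otimes> y)) w = corr F (inv k \<otimes> w \<otimes> k)" if "w \<in> U" for w
      unfolding corr_def using k that
      by (subst sum_left_mult[of k, symmetric]) (auto simp: m_assoc[symmetric] intro!: sum.cong)
    ultimately show "(\<Sum>u\<in>U. (corr F (u \<otimes> k))\<^sup>2) \<le> (\<Sum>w\<in>U. corr F w * corr F (inv k \<otimes> w \<otimes> k))"
      using abelian_correlation[OF U comm, of F "\<lambda>y. F (inv k \<otimes> y)"] by simp
  qed
  also have "\<dots> = (\<Sum>w\<in>U. corr F w * class_corr F w)"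
    unfolding class_corr_def sum_distrib_left by (rule sum.swap)
  finally show ?thesis .
qed

text \<open>If the class function is constant on \<open>U - {\<one>}\<close>, then its unknown value there is determined by the sum
  over \<open>U\<close>.\<close>

lemma sum_corr_squared_one_class:
  assumes U: "subgroup U G" and comm: "\<And>u v. u \<in> U \<Longrightarrow> v \<in> U \<Longrightarrow> u \<otimes> v = v \<otimes> u"
    and const: "\<And>w. w \<in> U \<Longrightarrow> w \<noteq> \<one> \<Longrightarrow> class_corr F w = \<alpha>"
    and nonneg: "0 \<le> (\<Sum>w\<in>U. class_corr F w)"
  shows "card U * (\<Sum>k\<in>carrier G. (corr F k)\<^sup>2)
    \<le> corr F \<one> * (2 * card (carrier G) * corr F \<one> + (\<Sum>w\<in>U. class_corr F w))"
proof -
  let ?N = "card (carrier G)" and ?S = "\<Sum>w\<in>U. class_corr F w"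
  have finU: "finite U" using finite_subset[OF subgroup.subset[OF U] finite_carrier] .
  have one: "\<one> \<in> U" using subgroup.one_closed[OF U] .
  have UK: "u \<in> carrier G" if "u \<in> U" for u using subgroup.mem_carrier[OF U that] .
  have c1: "class_corr F \<one> = ?N * corr F \<one>" by (simp add: class_corr_def)
  have p: "corr F \<one> \<ge> 0" using abs_corr_le[of \<one> F] by simp
  have "(\<Sum>w\<in>U - {\<one>}. class_corr F w) = card (U - {\<one>}) * \<alpha>" using const by simp
  then have S: "?S = ?N * corr F \<one> + card (U - {\<one>}) * \<alpha>"
    using sum.remove[OF finU one, of "class_corr F"] c1 by simp
  have "(\<Sum>w\<in>U. corr F w * class_corr F w) = corr F \<one> * (?N * corr F \<one>) + (\<Sum>w\<in>U - {\<one>}. corr F w * \<alpha>)"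
    using sum.remove[OF finU one, of "\<lambda>w. corr F w * class_corr F w"] c1 const by simp
  also have "(\<Sum>w\<in>U - {\<one>}. corr F w * \<alpha>) \<le> (\<Sum>w\<in>U - {\<one>}. corr F \<one> * \<bar>\<alpha>\<bar>)"
  proof (intro sum_mono)
    fix w assume "w \<in> U - {\<one>}"
    then have "\<bar>corr F w * \<alpha>\<bar> \<le> corr F \<one> * \<bar>\<alpha>\<bar>"
      using abs_corr_le UK by (simp add: abs_mult mult_right_mono)
    then show "corr F w * \<alpha> \<le> corr F \<one> * \<bar>\<alpha>\<bar>" by linarith
  qed
  also have "\<dots> = corr F \<one> * \<bar>card (U - {\<one>}) * \<alpha>\<bar>" by (simp add: abs_mult)
  also have "\<dots> \<le> corr F \<one> * (?S + ?N * corr F \<one>)"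
  proof (intro mult_left_mono p)
    have "0 \<le> ?N * corr F \<one>" using p by simp
    then show "\<bar>card (U - {\<one>}) * \<alpha>\<bar> \<le> ?S + ?N * corr F \<one>" using S nonneg by linarith
  qed
  finally have "(\<Sum>w\<in>U. corr F w * class_corr F w) \<le> corr F \<one> * (2 * ?N * corr F \<one> + ?S)"
    by (simp add: algebra_simps)
  then show ?thesis using sum_corr_squared[OF U comm, of F] by linarith
qed

text \<open>Expanding the square as a double sum over \<open>x\<close> and \<open>k \<otimes> x\<close> turns the left-hand side into
  the sum of the products \<open>corr F k * corr H k\<close>.\<close>

lemma sum_incidence_squared:
  fixes F H :: "'a \<Rightarrow> real"
  shows "(\<Sum>g\<in>carrier G. (\<Sum>x\<in>carrier G. F x * H (x \<otimes> g))\<^sup>2)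
    \<le> ((\<Sum>k\<in>carrier G. (corr F k)\<^sup>2) + (\<Sum>k\<in>carrier G. (corr H k)\<^sup>2)) / 2"
proof -
  let ?K = "carrier G"
  have "(\<Sum>g\<in>?K. (\<Sum>x\<in>?K. F x * H (x \<otimes> g))\<^sup>2) =
      (\<Sum>g\<in>?K. \<Sum>x\<in>?K. \<Sum>k\<in>?K. (F x * F (k \<otimes> x)) * (H (x \<otimes> g) * H (k \<otimes> x \<otimes> g)))"
  proof (intro sum.cong refl)
    fix g assume "g \<in> ?K"
    have "(\<Sum>x\<in>?K. F x * H (x \<otimes> g))\<^sup>2 = (\<Sum>x\<in>?K. \<Sum>y\<in>?K. (F x * H (x \<otimes> g)) * (F y * H (y \<otimes> g)))"
      by (simp add: power2_eq_square sum_product)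
    also have "\<dots> = (\<Sum>x\<in>?K. \<Sum>k\<in>?K. (F x * H (x \<otimes> g)) * (F (k \<otimes> x) * H (k \<otimes> x \<otimes> g)))"
      by (intro sum.cong refl sum_right_mult[symmetric])
    finally show "(\<Sum>x\<in>?K. F x * H (x \<otimes> g))\<^sup>2 = (\<Sum>x\<in>?K. \<Sum>k\<in>?K. (F x * F (k \<otimes> x)) * (H (x \<otimes> g) * H (k \<otimes> x \<otimes> g)))"
      by (simp add: mult_ac)
  qed
  also have "\<dots> = (\<Sum>x\<in>?K. \<Sum>g\<in>?K. \<Sum>k\<in>?K. (F x * F (k \<otimes> x)) * (H (x \<otimes> g) * H (k \<otimes> x \<otimes> g)))"
    by (rule sum.swap)
  also have "\<dots> = (\<Sum>x\<in>?K. \<Sum>k\<in>?K. \<Sum>g\<in>?K. (F x * F (k \<otimes> x)) * (H (x \<otimes> g) * H (k \<otimes> x \<otimes> g)))"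
    by (intro sum.cong refl sum.swap)
  also have "\<dots> = (\<Sum>x\<in>?K. \<Sum>k\<in>?K. (F x * F (k \<otimes> x)) * corr H k)"
  proof (intro sum.cong refl)
    fix x k assume xk: "x \<in> ?K" "k \<in> ?K"
    have "(\<Sum>g\<in>?K. H (x \<otimes> g) * H (k \<otimes> x \<otimes> g)) = (\<Sum>g\<in>?K. H (x \<otimes> g) * H (k \<otimes> (x \<otimes> g)))"
      using xk by (simp add: m_assoc)
    also have "\<dots> = corr H k"
      unfolding corr_def by (rule sum_left_mult[OF xk(1), of "\<lambda>y. H y * H (k \<otimes> y)"])
    finally show "(\<Sum>g\<in>?K. F x * F (k \<otimes> x) * (H (x \<otimes> g) * H (k \<otimes> x \<otimes> g))) = F x * F (k \<otimes> x) * corr H k"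
      by (simp add: sum_distrib_left[symmetric])
  qed
  also have "\<dots> = (\<Sum>k\<in>?K. corr F k * corr H k)"
    unfolding corr_def[of F] by (subst sum.swap) (simp add: sum_distrib_right)
  also have "\<dots> \<le> (\<Sum>k\<in>?K. ((corr F k)\<^sup>2 + (corr H k)\<^sup>2) / 2)"
  proof (intro sum_mono)
    fix k
    have "0 \<le> (corr F k - corr H k)\<^sup>2" by simp
    then show "corr F k * corr H k \<le> ((corr F k)\<^sup>2 + (corr H k)\<^sup>2) / 2" by (simp add: power2_diff)
  qed
  finally show ?thesis by (simp add: sum_divide_distrib[symmetric] sum.distrib)
qed

text \<open>A weak form of the spectral gap: random elements almost decorrelate every function of mean zero.\<close>

definition quasirandom :: "real \<Rightarrow> bool" where
  "quasirandom \<epsilon> \<longleftrightarrow> (\<forall>F. (\<Sum>x\<in>carrier G. F x) = 0 \<longrightarrow> (\<forall>x\<in>carrier G. \<bar>F x\<bar> \<le> 1) \<longrightarrow>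
     (\<Sum>k\<in>carrier G. (corr F k)\<^sup>2) \<le> \<epsilon> * card (carrier G) ^ 3)"

text \<open>For the balanced functions \<open>1\<^sub>X - |X|/N\<close> and \<open>1\<^sub>Y - |Y|/N\<close>, every translation that separates \<open>X\<close> from
  \<open>Y\<close> contributes the square of the expected number \<open>|X| |Y| / N\<close> of incidences.\<close>

lemma separating_translations:
  fixes \<epsilon> \<delta> :: real
  assumes q: "quasirandom \<epsilon>" and XY: "X \<subseteq> carrier G" "Y \<subseteq> carrier G"
    and \<delta>: "0 < \<delta>" "\<delta> * card (carrier G) \<le> card X" "\<delta> * card (carrier G) \<le> card Y"
  shows "card {g \<in> carrier G. \<forall>x\<in>X. x \<otimes> g \<notin> Y} \<le> \<epsilon> / \<delta> ^ 4 * card (carrier G)"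
proof -
  let ?K = "carrier G"
  define N where "N = real (card ?K)"
  have "?K \<noteq> {}" by auto
  then have N: "N > 0" using finite_carrier by (simp add: N_def card_gt_0_iff)
  define F :: "'a set \<Rightarrow> 'a \<Rightarrow> real" where "F Z x = indicator Z x - card Z / N" for Z x
  have sumF: "(\<Sum>x\<in>?K. F Z x) = 0" if "Z \<subseteq> ?K" for Z
    using N that by (simp add: F_def sum_subtractf N_def[symmetric] Int_absorb1 finite_carrier sum.If_cases indicator_def)
  have cZ: "card Z \<le> N" if "Z \<subseteq> ?K" for Z
    using that finite_carrier by (simp add: N_def card_mono)
  have absF: "\<bar>F Z x\<bar> \<le> 1" if "Z \<subseteq> ?K" for Z x
    using cZ[OF that] N by (auto simp: F_def indicator_def field_simps abs_le_iff)
  have E: "(\<Sum>k\<in>?K. (corr (F Z) k)\<^sup>2) \<le> \<epsilon> * N ^ 3" if "Z \<subseteq> ?K" for Z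
    using q[unfolded quasirandom_def, rule_format, of "F Z"] sumF[OF that] absF[OF that]
    by (simp add: N_def)
  let ?Z = "{g \<in> ?K. \<forall>x\<in>X. x \<otimes> g \<notin> Y}"
  have val: "(\<Sum>x\<in>?K. F X x * F Y (x \<otimes> g)) = - (card X * card Y / N)" if g: "g \<in> ?Z" for g
  proof -
    have z: "indicator X x * indicator Y (x \<otimes> g) = (0::real)" if "x \<in> ?K" for x
      using g by (auto simp: indicator_def)
    have gK: "g \<in> ?K" using g by simp
    have sz: "(\<Sum>x\<in>?K. indicator X x * indicator Y (x \<otimes> g)) = (0::real)"
      by (rule sum.neutral) (use z in blast)
    have iY: "(\<Sum>x\<in>?K. indicator Y (x \<otimes> g) :: real) = card Y"
      using sum_right_mult[OF gK, of "indicator Y :: 'a \<Rightarrow> real"] XY(2) finite_carrier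
      by (simp add: Int_absorb1 indicator_def sum.If_cases)
    have iX: "(\<Sum>x\<in>?K. indicator X x :: real) = card X"
      using XY(1) finite_carrier by (simp add: Int_absorb1 indicator_def sum.If_cases)
    have "(\<Sum>x\<in>?K. F X x * F Y (x \<otimes> g)) = (\<Sum>x\<in>?K. indicator X x * indicator Y (x \<otimes> g)
        - card Y / N * indicator X x - card X / N * indicator Y (x \<otimes> g) + card X * card Y / N\<^sup>2)"
      by (intro sum.cong refl) (simp add: F_def algebra_simps power2_eq_square)
    also have "\<dots> = 0 - card Y / N * card X - card X / N * card Y + N * (card X * card Y / N\<^sup>2)"
      unfolding sum.distrib sum_subtractf sum_distrib_left[symmetric] iX iY
      sz by (simp add: N_def)
    also have "\<dots> = - (card X * card Y / N)"
      using N by (simp add: power2_eq_square field_simps)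
    finally show ?thesis .
  qed
  have "\<delta> ^ 4 * N\<^sup>2 \<le> (card X * card Y / N)\<^sup>2"
  proof -
    have "(\<delta> * N) * (\<delta> * N) \<le> card X * card Y"
      unfolding of_nat_mult using \<delta> N by (intro mult_mono) (auto simp: N_def)
    then have "\<delta>\<^sup>2 * N \<le> card X * card Y / N" using N by (simp add: field_simps power2_eq_square)
    then have "(\<delta>\<^sup>2 * N)\<^sup>2 \<le> (card X * card Y / N)\<^sup>2" using N by (intro power_mono) auto
    then show ?thesis by (simp add: power_mult_distrib)
  qed
  then have "card ?Z * (\<delta> ^ 4 * N\<^sup>2) \<le> card ?Z * (card X * card Y / N)\<^sup>2" by (intro mult_left_mono) auto
  also have "\<dots> = (\<Sum>g\<in>?Z. (\<Sum>x\<in>?K. F X x * F Y (x \<otimes> g))\<^sup>2)" using val by simp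
  also have "\<dots> \<le> (\<Sum>g\<in>?K. (\<Sum>x\<in>?K. F X x * F Y (x \<otimes> g))\<^sup>2)"
    by (rule sum_mono2) (use finite_carrier in auto)
  also have "\<dots> \<le> \<epsilon> * N ^ 3"
  proof (rule order_trans[OF sum_incidence_squared])
    show "((\<Sum>k\<in>?K. (corr (F X) k)\<^sup>2) + (\<Sum>k\<in>?K. (corr (F Y) k)\<^sup>2)) / 2 \<le> \<epsilon> * N ^ 3"
      using add_mono[OF E[OF XY(1)] E[OF XY(2)]] by simp
  qed
  finally have "card ?Z * \<delta> ^ 4 * N\<^sup>2 \<le> (\<epsilon> * N) * N\<^sup>2" by (simp add: power3_eq_cube power2_eq_square mult_ac)
  then have "card ?Z * \<delta> ^ 4 \<le> \<epsilon> * N" using N by simp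
  then show ?thesis using \<delta>(1) unfolding N_def[symmetric] by (simp add: field_simps)
qed

text \<open>Fewer than \<open>N / L\<^sup>2\<close> translations are bad for each of the \<open>L\<^sup>2\<close> pairs.\<close>

lemma simultaneous_incidence:
  fixes \<epsilon> \<delta> :: real and L :: nat
  assumes q: "quasirandom \<epsilon>" and \<delta>: "0 < \<delta>" "L\<^sup>2 * \<epsilon> < \<delta> ^ 4"
    and X: "\<And>i. i < L \<Longrightarrow> X i \<subseteq> carrier G" "\<And>i. i < L \<Longrightarrow> \<delta> * card (carrier G) \<le> card (X i)"
  shows "\<exists>g\<in>carrier G. \<forall>i<L. \<forall>j<L. \<exists>x\<in>X i. x \<otimes> g \<in> X j"
proof (rule ccontr)
  assume c: "\<not> ?thesis"
  let ?K = "carrier G"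
  let ?Z = "\<lambda>(i, j). {g \<in> ?K. \<forall>x\<in>X i. x \<otimes> g \<notin> X j}"
  have "?K \<noteq> {}" by auto
  then have N: "card ?K > 0" using finite_carrier by (simp add: card_gt_0_iff)
  have "?K \<subseteq> (\<Union>ij\<in>{..<L} \<times> {..<L}. ?Z ij)"
  proof
    fix g assume "g \<in> ?K"
    then obtain i j where "i < L" "j < L" "\<forall>x\<in>X i. x \<otimes> g \<notin> X j" using c by metis
    then show "g \<in> (\<Union>ij\<in>{..<L} \<times> {..<L}. ?Z ij)"
      using \<open>g \<in> ?K\<close> by (intro UN_I[of "(i, j)"]) auto
  qed
  then have "card ?K \<le> card (\<Union>ij\<in>{..<L} \<times> {..<L}. ?Z ij)"
    by (intro card_mono) (use finite_carrier in auto)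
  also have "\<dots> \<le> (\<Sum>ij\<in>{..<L} \<times> {..<L}. card (?Z ij))" by (rule card_UN_le) simp
  finally have "real (card ?K) \<le> real (\<Sum>ij\<in>{..<L} \<times> {..<L}. card (?Z ij))"
    by (simp only: of_nat_le_iff)
  then have "real (card ?K) \<le> (\<Sum>ij\<in>{..<L} \<times> {..<L}. real (card (?Z ij)))"
    by (simp only: of_nat_sum)
  also have "\<dots> \<le> (\<Sum>ij\<in>{..<L} \<times> {..<L}. \<epsilon> / \<delta> ^ 4 * card ?K)"
  proof (intro sum_mono)
    fix ij assume ij: "ij \<in> {..<L} \<times> {..<L}"
    obtain i j where e: "ij = (i, j)" by (cases ij)
    have "i < L" "j < L" using ij e by auto
    from separating_translations[OF q X(1)[OF this(1)] X(1)[OF this(2)] \<delta>(1) X(2)[OF this(1)] X(2)[OF this(2)]]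
    show "real (card (?Z ij)) \<le> \<epsilon> / \<delta> ^ 4 * card ?K" by (simp add: e)
  qed
  also have "\<dots> = (L\<^sup>2 * \<epsilon> / \<delta> ^ 4) * card ?K" by (simp add: power2_eq_square)
  finally have "1 * real (card ?K) \<le> (L\<^sup>2 * \<epsilon> / \<delta> ^ 4) * card ?K" by simp
  then have "1 \<le> L\<^sup>2 * \<epsilon> / \<delta> ^ 4" using N by (simp only: mult_le_cancel_right_pos of_nat_0_less_iff)
  then show False using \<delta> by (simp add: field_simps)
qed

end

section \<open>Quasirandomness from a transitive action\<close>

locale transitive_action = finite_group +
  fixes act :: "'a \<Rightarrow> 'v \<Rightarrow> 'v" and \<Omega> :: "'v set" and v\<^sub>0 :: 'v
  assumes act_closed: "x \<in> carrier G \<Longrightarrow> v \<in> \<Omega> \<Longrightarrow> act x v \<in> \<Omega>"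
    and act_one: "v \<in> \<Omega> \<Longrightarrow> act \<one> v = v"
    and act_mult: "x \<in> carrier G \<Longrightarrow> y \<in> carrier G \<Longrightarrow> v \<in> \<Omega> \<Longrightarrow> act (x \<otimes> y) v = act x (act y v)"
    and finite_points: "finite \<Omega>" and base_point: "v\<^sub>0 \<in> \<Omega>"
    and transitive: "z \<in> \<Omega> \<Longrightarrow> v \<in> \<Omega> \<Longrightarrow> \<exists>x\<in>carrier G. act x z = v"
begin

definition stab :: "'a set" where
  "stab = {x \<in> carrier G. act x v\<^sub>0 = v\<^sub>0}"

text \<open>\<open>F\<close> summed over the set of elements that map \<open>z\<close> to \<open>v\<close>, which is a coset of a point stabiliser.\<close>

definition fibre_sum :: "('a \<Rightarrow> real) \<Rightarrow> 'v \<Rightarrow> 'v \<Rightarrow> real" where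
  "fibre_sum F z v = (\<Sum>x\<in>{x \<in> carrier G. act x z = v}. F x)"

definition fibre_energy :: "('a \<Rightarrow> real) \<Rightarrow> real" where
  "fibre_energy F = (\<Sum>z\<in>\<Omega>. \<Sum>v\<in>\<Omega>. (fibre_sum F z v)\<^sup>2)"

lemma act_inv: "x \<in> carrier G \<Longrightarrow> v \<in> \<Omega> \<Longrightarrow> act (inv x) (act x v) = v"
  using act_mult[of "inv x" x v] act_one by simp

lemma act_inv': "x \<in> carrier G \<Longrightarrow> v \<in> \<Omega> \<Longrightarrow> act x (act (inv x) v) = v"
  using act_mult[of x "inv x" v] act_one by simp

lemma subgroup_stab: "subgroup stab G"
proof (rule subgroupI)
  fix a assume "a \<in> stab"
  then show "inv a \<in> stab" using act_inv[of a v\<^sub>0] base_point by (auto simp: stab_def)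
next
  fix a b assume "a \<in> stab" "b \<in> stab"
  then show "a \<otimes> b \<in> stab" using base_point by (auto simp: stab_def act_mult)
next
  have "\<one> \<in> stab" using act_one base_point by (auto simp: stab_def)
  then show "stab \<noteq> {}" by blast
qed (auto simp: stab_def)

lemma card_transporter:
  assumes "z \<in> \<Omega>" "v \<in> \<Omega>"
  shows "card {x \<in> carrier G. act x z = v} = card stab"
proof -
  obtain a b where a: "a \<in> carrier G" "act a v\<^sub>0 = z" and b: "b \<in> carrier G" "act b v = v\<^sub>0"
    using transitive base_point assms by meson
  have ia: "act (inv a) z = v\<^sub>0" using act_inv[OF a(1) base_point] a(2) by simp
  have ib: "act (inv b) v\<^sub>0 = v" using act_inv[OF b(1) assms(2)] b(2) by simp
  have "bij_betw (\<lambda>x. b \<otimes> x \<otimes> a) {x \<in> carrier G. act x z = v} stab"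
  proof (rule bij_betw_byWitness[where f' = "\<lambda>y. inv b \<otimes> y \<otimes> inv a"])
    show "\<forall>x\<in>{x \<in> carrier G. act x z = v}. inv b \<otimes> (b \<otimes> x \<otimes> a) \<otimes> inv a = x"
    proof
      fix x assume x: "x \<in> {x \<in> carrier G. act x z = v}"
      have "inv b \<otimes> (b \<otimes> x \<otimes> a) \<otimes> inv a = (inv b \<otimes> b) \<otimes> x \<otimes> (a \<otimes> inv a)"
        using a(1) b(1) x by (simp only: m_assoc m_closed inv_closed mem_Collect_eq)
      then show "inv b \<otimes> (b \<otimes> x \<otimes> a) \<otimes> inv a = x" using a(1) b(1) x by simp
    qed
    show "\<forall>y\<in>stab. b \<otimes> (inv b \<otimes> y \<otimes> inv a) \<otimes> a = y"
    proof
      fix y assume y: "y \<in> stab"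
      have "b \<otimes> (inv b \<otimes> y \<otimes> inv a) \<otimes> a = (b \<otimes> inv b) \<otimes> y \<otimes> (inv a \<otimes> a)"
        using a(1) b(1) y by (simp only: m_assoc m_closed inv_closed mem_Collect_eq stab_def)
      then show "b \<otimes> (inv b \<otimes> y \<otimes> inv a) \<otimes> a = y" using a(1) b(1) y by (simp add: stab_def)
    qed
    show "(\<lambda>x. b \<otimes> x \<otimes> a) ` {x \<in> carrier G. act x z = v} \<subseteq> stab"
      using a b assms base_point by (auto simp: stab_def act_mult)
    show "(\<lambda>y. inv b \<otimes> y \<otimes> inv a) ` stab \<subseteq> {x \<in> carrier G. act x z = v}"
      using a(1) b(1) ia ib assms base_point by (auto simp: stab_def act_mult)
  qed
  then show ?thesis by (rule bij_betw_same_card)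
qed

lemma sum_fibres:
  assumes "z \<in> \<Omega>"
  shows "(\<Sum>v\<in>\<Omega>. \<Sum>x\<in>{x \<in> carrier G. act x z = v}. f x) = (\<Sum>x\<in>carrier G. f x)"
  by (rule sum.group[OF finite_carrier finite_points]) (use act_closed assms in auto)

lemma sum_act:
  fixes h :: "'v \<Rightarrow> real"
  assumes "z \<in> \<Omega>"
  shows "(\<Sum>x\<in>carrier G. h (act x z)) = card stab * (\<Sum>v\<in>\<Omega>. h v)"
proof -
  have "(\<Sum>x\<in>carrier G. h (act x z)) = (\<Sum>v\<in>\<Omega>. \<Sum>x\<in>{x \<in> carrier G. act x z = v}. h (act x z))"
    by (rule sum_fibres[OF assms, symmetric])
  also have "\<dots> = (\<Sum>v\<in>\<Omega>. card stab * h v)"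
  proof (rule sum.cong[OF refl])
    fix v assume v: "v \<in> \<Omega>"
    have "(\<Sum>x\<in>{x \<in> carrier G. act x z = v}. h (act x z)) = (\<Sum>x\<in>{x \<in> carrier G. act x z = v}. h v)"
      by (rule sum.cong) auto
    then show "(\<Sum>x\<in>{x \<in> carrier G. act x z = v}. h (act x z)) = card stab * h v"
      using card_transporter[OF assms v] by simp
  qed
  finally show ?thesis by (simp add: sum_distrib_left)
qed

lemma sum_fibre_sum:
  assumes "z \<in> \<Omega>"
  shows "(\<Sum>v\<in>\<Omega>. fibre_sum F z v * h v) = (\<Sum>x\<in>carrier G. F x * h (act x z))"
proof -
  have "(\<Sum>x\<in>carrier G. F x * h (act x z)) = (\<Sum>v\<in>\<Omega>. \<Sum>x\<in>{x \<in> carrier G. act x z = v}. F x * h (act x z))"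
    by (rule sum_fibres[OF assms, symmetric])
  also have "\<dots> = (\<Sum>v\<in>\<Omega>. fibre_sum F z v * h v)"
    unfolding fibre_sum_def sum_distrib_right by (intro sum.cong refl) auto
  finally show ?thesis ..
qed

text \<open>The sum of the correlations over the point stabiliser of \<open>v\<close> is the sum of the squares of the sums of \<open>F\<close>
  over its cosets; averaging over conjugates lets \<open>v\<close> run through all points.\<close>

lemma sum_class_corr_stab: "(\<Sum>w\<in>stab. class_corr F w) = card stab * fibre_energy F"
proof -
  let ?K = "carrier G"
  have wK: "w \<in> ?K" "act w v\<^sub>0 = v\<^sub>0" if "w \<in> stab" for w using that by (auto simp: stab_def)
  have inner: "(\<Sum>w\<in>stab. F (inv k \<otimes> w \<otimes> k \<otimes> x)) = fibre_sum F (act (inv x) (act (inv k) v\<^sub>0)) (act (inv k) v\<^sub>0)"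
    if k: "k \<in> ?K" and x: "x \<in> ?K" for k x
  proof -
    let ?v = "act (inv k) v\<^sub>0"
    let ?z = "act (inv x) ?v"
    have v: "?v \<in> \<Omega>" "?z \<in> \<Omega>" using k x base_point act_closed by auto
    have kv: "act k ?v = v\<^sub>0" "act x ?z = ?v" using act_inv' k x v base_point by auto
    have into_fibre: "inv k \<otimes> w \<otimes> k \<otimes> x \<in> {y \<in> ?K. act y ?z = ?v}" if "w \<in> stab" for w
      using wK[OF that] k x v kv base_point act_closed by (simp add: act_mult)
    have into_stab: "k \<otimes> y \<otimes> inv x \<otimes> inv k \<in> stab" if "y \<in> {y \<in> ?K. act y ?z = ?v}" for y
      using that k x v kv base_point act_closed by (simp add: act_mult stab_def)
    show ?thesis unfolding fibre_sum_def
    proof (rule sum.reindex_bij_witness[of _ "\<lambda>y. k \<otimes> y \<otimes> inv x \<otimes> inv k" "\<lambda>w. inv k \<otimes> w \<otimes> k \<otimes> x"])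
      fix w assume w: "w \<in> stab"
      show "k \<otimes> (inv k \<otimes> w \<otimes> k \<otimes> x) \<otimes> inv x \<otimes> inv k = w"
      proof -
        have "k \<otimes> (inv k \<otimes> w \<otimes> k \<otimes> x) \<otimes> inv x \<otimes> inv k = (k \<otimes> inv k) \<otimes> w \<otimes> (k \<otimes> ((x \<otimes> inv x) \<otimes> inv k))"
          using wK[OF w] k x by (simp only: m_assoc m_closed inv_closed)
        then show ?thesis using wK[OF w] k x by simp
      qed
      show "inv k \<otimes> w \<otimes> k \<otimes> x \<in> {y \<in> ?K. act y ?z = ?v}" by (rule into_fibre[OF w])
    next
      fix y assume y: "y \<in> {y \<in> ?K. act y ?z = ?v}"
      then have yK: "y \<in> ?K" by simp
      show "inv k \<otimes> (k \<otimes> y \<otimes> inv x \<otimes> inv k) \<otimes> k \<otimes> x = y"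
      proof -
        have "inv k \<otimes> (k \<otimes> y \<otimes> inv x \<otimes> inv k) \<otimes> k \<otimes> x = (inv k \<otimes> k) \<otimes> y \<otimes> (inv x \<otimes> ((inv k \<otimes> k) \<otimes> x))"
          using yK k x by (simp only: m_assoc m_closed inv_closed)
        then show ?thesis using yK k x by simp
      qed
      show "k \<otimes> y \<otimes> inv x \<otimes> inv k \<in> stab" by (rule into_stab[OF y])
    qed simp
  qed
  have "(\<Sum>w\<in>stab. class_corr F w) = (\<Sum>k\<in>?K. \<Sum>w\<in>stab. corr F (inv k \<otimes> w \<otimes> k))"
    unfolding class_corr_def by (rule sum.swap)
  also have "\<dots> = (\<Sum>k\<in>?K. \<Sum>z\<in>\<Omega>. (fibre_sum F z (act (inv k) v\<^sub>0))\<^sup>2)"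
  proof (rule sum.cong[OF refl])
    fix k assume k: "k \<in> ?K"
    let ?v = "act (inv k) v\<^sub>0"
    have v: "?v \<in> \<Omega>" using k base_point act_closed by auto
    have "(\<Sum>w\<in>stab. corr F (inv k \<otimes> w \<otimes> k)) = (\<Sum>x\<in>?K. F x * (\<Sum>w\<in>stab. F (inv k \<otimes> w \<otimes> k \<otimes> x)))"
      unfolding corr_def sum_distrib_left by (rule sum.swap)
    also have "\<dots> = (\<Sum>x\<in>?K. F x * fibre_sum F (act (inv x) ?v) ?v)"
      using inner[OF k] by simp
    also have "\<dots> = (\<Sum>x\<in>?K. F (inv x) * fibre_sum F (act x ?v) ?v)"
      using sum_inv[of "\<lambda>x. F x * fibre_sum F (act (inv x) ?v) ?v"] by simp
    also have "\<dots> = (\<Sum>z\<in>\<Omega>. fibre_sum (\<lambda>x. F (inv x)) ?v z * fibre_sum F z ?v)"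
      by (rule sum_fibre_sum[OF v, symmetric])
    also have "\<dots> = (\<Sum>z\<in>\<Omega>. (fibre_sum F z ?v)\<^sup>2)"
    proof (rule sum.cong[OF refl])
      fix z assume z: "z \<in> \<Omega>"
      have "fibre_sum (\<lambda>x. F (inv x)) ?v z = fibre_sum F z ?v"
        unfolding fibre_sum_def
      proof (rule sum.reindex_bij_witness[of _ "\<lambda>x. inv x" "\<lambda>x. inv x"])
        fix x assume "x \<in> {x \<in> ?K. act x ?v = z}"
        then show "inv x \<in> {x \<in> ?K. act x z = ?v}" using act_inv[of x ?v] v by auto
      next
        fix x assume "x \<in> {x \<in> ?K. act x z = ?v}"
        then show "inv x \<in> {x \<in> ?K. act x ?v = z}" using act_inv[of x z] z by auto
      qed auto
      then show "fibre_sum (\<lambda>x. F (inv x)) ?v z * fibre_sum F z ?v = (fibre_sum F z ?v)\<^sup>2"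
        by (simp add: power2_eq_square)
    qed
    finally show "(\<Sum>w\<in>stab. corr F (inv k \<otimes> w \<otimes> k)) = (\<Sum>z\<in>\<Omega>. (fibre_sum F z ?v)\<^sup>2)" .
  qed
  also have "\<dots> = (\<Sum>k\<in>?K. \<Sum>z\<in>\<Omega>. (fibre_sum F z (act k v\<^sub>0))\<^sup>2)"
    by (rule sum_inv[of "\<lambda>k. \<Sum>z\<in>\<Omega>. (fibre_sum F z (act k v\<^sub>0))\<^sup>2"])
  also have "\<dots> = card stab * (\<Sum>v\<in>\<Omega>. \<Sum>z\<in>\<Omega>. (fibre_sum F z v)\<^sup>2)"
    by (rule sum_act[OF base_point])
  finally show ?thesis unfolding fibre_energy_def by (subst sum.swap) 
qed

text \<open>\<open>\<kappa> z z'\<close> bounds the correlation of the two random points \<open>act x z\<close> and \<open>act x z'\<close>. The energy is the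
  scalar product of \<open>F\<close> with the function \<open>H\<close> which adds up the fibre sums met by an element, so by the
  Cauchy-Schwarz inequality it suffices to bound the norm of \<open>H\<close> by the energy itself.\<close>

lemma fibre_energy_le:
  fixes \<kappa> :: "'v \<Rightarrow> 'v \<Rightarrow> real" and C :: real
  assumes F: "(\<Sum>x\<in>carrier G. F x) = 0"
    and \<kappa>: "\<And>z z' f h. z \<in> \<Omega> \<Longrightarrow> z' \<in> \<Omega> \<Longrightarrow> (\<Sum>v\<in>\<Omega>. f v) = 0 \<Longrightarrow>
       (\<Sum>x\<in>carrier G. f (act x z) * h (act x z')) \<le> \<kappa> z z' / 2 * ((\<Sum>v\<in>\<Omega>. (f v)\<^sup>2) + (\<Sum>v\<in>\<Omega>. (h v)\<^sup>2))"
    and C: "\<And>z. z \<in> \<Omega> \<Longrightarrow> (\<Sum>z'\<in>\<Omega>. \<kappa> z z') \<le> C" "\<And>z. z \<in> \<Omega> \<Longrightarrow> (\<Sum>z'\<in>\<Omega>. \<kappa> z' z) \<le> C"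
    and C0: "0 \<le> C"
  shows "fibre_energy F \<le> C * (\<Sum>x\<in>carrier G. (F x)\<^sup>2)"
proof -
  let ?K = "carrier G"
  let ?m = "fibre_sum F"
  let ?W = "fibre_energy F"
  define n where "n z = (\<Sum>v\<in>\<Omega>. (?m z v)\<^sup>2)" for z
  define H where "H x = (\<Sum>z\<in>\<Omega>. ?m z (act x z))" for x
  have n: "n z \<ge> 0" for z unfolding n_def by (intro sum_nonneg) simp
  have Wn: "?W = (\<Sum>z\<in>\<Omega>. n z)" by (simp add: fibre_energy_def n_def)
  have mz: "(\<Sum>v\<in>\<Omega>. ?m z v) = 0" if "z \<in> \<Omega>" for z
    using sum_fibre_sum[OF that, of F "\<lambda>_. 1"] F by simp
  have "?W = (\<Sum>z\<in>\<Omega>. \<Sum>x\<in>?K. F x * ?m z (act x z))"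
    unfolding fibre_energy_def by (intro sum.cong refl) (simp add: sum_fibre_sum[symmetric] power2_eq_square)
  also have "\<dots> = (\<Sum>x\<in>?K. F x * H x)"
    unfolding H_def sum_distrib_left by (rule sum.swap)
  finally have W: "?W\<^sup>2 \<le> (\<Sum>x\<in>?K. (F x)\<^sup>2) * (\<Sum>x\<in>?K. (H x)\<^sup>2)"
    using Cauchy_Schwarz_ineq_sum[of F H ?K] by simp
  have "(\<Sum>x\<in>?K. (H x)\<^sup>2) = (\<Sum>x\<in>?K. \<Sum>z\<in>\<Omega>. \<Sum>z'\<in>\<Omega>. ?m z (act x z) * ?m z' (act x z'))"
    by (simp add: H_def power2_eq_square sum_product)
  also have "\<dots> = (\<Sum>z\<in>\<Omega>. \<Sum>x\<in>?K. \<Sum>z'\<in>\<Omega>. ?m z (act x z) * ?m z' (act x z'))" by (rule sum.swap)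
  also have "\<dots> = (\<Sum>z\<in>\<Omega>. \<Sum>z'\<in>\<Omega>. \<Sum>x\<in>?K. ?m z (act x z) * ?m z' (act x z'))"
    by (intro sum.cong refl sum.swap)
  also have "\<dots> \<le> (\<Sum>z\<in>\<Omega>. \<Sum>z'\<in>\<Omega>. \<kappa> z z' / 2 * (n z + n z'))"
    unfolding n_def by (rule sum_mono, rule sum_mono, rule \<kappa>) (use mz in auto)
  also have "\<dots> = (\<Sum>z\<in>\<Omega>. n z / 2 * (\<Sum>z'\<in>\<Omega>. \<kappa> z z')) + (\<Sum>z\<in>\<Omega>. \<Sum>z'\<in>\<Omega>. n z' / 2 * \<kappa> z z')"
    unfolding sum_distrib_left sum.distrib[symmetric]
    by (intro sum.cong refl) (simp add: algebra_simps add_divide_distrib)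
  also have "(\<Sum>z\<in>\<Omega>. \<Sum>z'\<in>\<Omega>. n z' / 2 * \<kappa> z z') = (\<Sum>z\<in>\<Omega>. n z / 2 * (\<Sum>z'\<in>\<Omega>. \<kappa> z' z))"
    unfolding sum_distrib_left by (rule sum.swap)
  also have "(\<Sum>z\<in>\<Omega>. n z / 2 * (\<Sum>z'\<in>\<Omega>. \<kappa> z z')) + (\<Sum>z\<in>\<Omega>. n z / 2 * (\<Sum>z'\<in>\<Omega>. \<kappa> z' z))
      \<le> (\<Sum>z\<in>\<Omega>. n z / 2 * C) + (\<Sum>z\<in>\<Omega>. n z / 2 * C)"
    by (intro add_mono sum_mono mult_left_mono C) (use n in auto)
  also have "\<dots> = C * ?W" unfolding Wn by (simp add: sum_distrib_left sum.distrib[symmetric] mult.commute)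
  finally have "(\<Sum>x\<in>?K. (H x)\<^sup>2) \<le> C * ?W" .
  then have "?W\<^sup>2 \<le> (\<Sum>x\<in>?K. (F x)\<^sup>2) * (C * ?W)"
    by (intro order_trans[OF W] mult_left_mono sum_nonneg) simp_all
  then have *: "?W * ?W \<le> (C * (\<Sum>x\<in>?K. (F x)\<^sup>2)) * ?W" by (simp add: power2_eq_square mult_ac)
  have W0: "?W \<ge> 0" unfolding Wn using n by (intro sum_nonneg)
  have "0 \<le> C * (\<Sum>x\<in>?K. (F x)\<^sup>2)" using C0 by (intro mult_nonneg_nonneg sum_nonneg) simp_all
  then show ?thesis using * W0 by (cases "?W = 0") (auto dest: mult_right_le_imp_le)
qed

text \<open>The point stabiliser is abelian and its nontrivial elements are conjugate up to inversion, so all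
  correlations are bounded by the energy.\<close>

lemma action_quasirandom:
  fixes \<kappa> :: "'v \<Rightarrow> 'v \<Rightarrow> real" and C :: real
  assumes comm: "\<And>u v. u \<in> stab \<Longrightarrow> v \<in> stab \<Longrightarrow> u \<otimes> v = v \<otimes> u"
    and w\<^sub>0: "w\<^sub>0 \<in> carrier G"
    and conj: "\<And>w. w \<in> stab \<Longrightarrow> w \<noteq> \<one> \<Longrightarrow> \<exists>h\<in>carrier G. w = inv h \<otimes> w\<^sub>0 \<otimes> h \<or> inv w = inv h \<otimes> w\<^sub>0 \<otimes> h"
    and \<kappa>: "\<And>z z' f h. z \<in> \<Omega> \<Longrightarrow> z' \<in> \<Omega> \<Longrightarrow> (\<Sum>v\<in>\<Omega>. f v) = 0 \<Longrightarrow>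
       (\<Sum>x\<in>carrier G. f (act x z) * h (act x z')) \<le> \<kappa> z z' / 2 * ((\<Sum>v\<in>\<Omega>. (f v)\<^sup>2) + (\<Sum>v\<in>\<Omega>. (h v)\<^sup>2))"
    and C: "\<And>z. z \<in> \<Omega> \<Longrightarrow> (\<Sum>z'\<in>\<Omega>. \<kappa> z z') \<le> C" "\<And>z. z \<in> \<Omega> \<Longrightarrow> (\<Sum>z'\<in>\<Omega>. \<kappa> z' z) \<le> C"
    and C0: "0 \<le> C"
  shows "quasirandom (2 / card stab + C / card (carrier G))"
  unfolding quasirandom_def
proof (intro allI impI)
  fix F assume F: "(\<Sum>x\<in>carrier G. F x) = 0" "\<forall>x\<in>carrier G. \<bar>F x\<bar> \<le> (1::real)"
  let ?N = "real (card (carrier G))" and ?u = "real (card stab)" and ?W = "fibre_energy F"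
  let ?E = "\<Sum>k\<in>carrier G. (corr F k)\<^sup>2"
  have const: "class_corr F w = class_corr F w\<^sub>0" if w: "w \<in> stab" "w \<noteq> \<one>" for w
  proof -
    have wK: "w \<in> carrier G" using w by (simp add: stab_def)
    obtain h where h: "h \<in> carrier G" "w = inv h \<otimes> w\<^sub>0 \<otimes> h \<or> inv w = inv h \<otimes> w\<^sub>0 \<otimes> h"
      using conj[OF w] by blast
    then have "class_corr F w = class_corr F (inv h \<otimes> w\<^sub>0 \<otimes> h)" using class_corr_inv[OF wK, of F] by metis
    then show ?thesis using class_corr_conj[OF w\<^sub>0 h(1)] by simp
  qed
  have W0: "?W \<ge> 0" unfolding fibre_energy_def by (intro sum_nonneg) simp
  have W: "?W \<le> C * (\<Sum>x\<in>carrier G. (F x)\<^sup>2)" by (rule fibre_energy_le[OF F(1) \<kappa> C C0])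
  have c1: "corr F \<one> = (\<Sum>x\<in>carrier G. (F x)\<^sup>2)" by (simp add: corr_def power2_eq_square)
  have "(\<Sum>x\<in>carrier G. (F x)\<^sup>2) \<le> (\<Sum>x\<in>carrier G. 1)"
    by (intro sum_mono) (use F(2) in \<open>auto simp: abs_square_le_1\<close>)
  then have cN: "corr F \<one> \<le> ?N" by (simp add: c1)
  have c0: "0 \<le> corr F \<one>" unfolding c1 by (intro sum_nonneg) simp
  have "finite stab" using finite_subset[OF subgroup.subset[OF subgroup_stab] finite_carrier] .
  then have u: "?u > 0" using subgroup.one_closed[OF subgroup_stab] by (auto simp: card_gt_0_iff)
  have "carrier G \<noteq> {}" by auto
  then have N: "?N > 0" using finite_carrier by (simp add: card_gt_0_iff)
  have Wle: "?W \<le> C * ?N"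
    using order_trans[OF W mult_left_mono[OF cN[unfolded c1] C0]] .
  have "?u * ?E \<le> corr F \<one> * (2 * ?N * corr F \<one> + (\<Sum>w\<in>stab. class_corr F w))"
    using sum_corr_squared_one_class[OF subgroup_stab comm const] u W0
    by (simp add: sum_class_corr_stab)
  also have "\<dots> \<le> ?N * (2 * ?N * ?N + ?u * (C * ?N))"
    unfolding sum_class_corr_stab
    using cN c0 N u W0 Wle by (intro mult_mono add_mono) auto
  also have "\<dots> = ?u * ((2 / ?u + C / ?N) * ?N ^ 3)"
    using u N by (simp add: field_simps power3_eq_cube)
  finally have "?u * ?E \<le> ?u * ((2 / ?u + C / ?N) * ?N ^ 3)" .
  then have "?E \<le> (2 / ?u + C / ?N) * ?N ^ 3"
    using u by (rule mult_left_le_imp_le)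
  then show "?E \<le> (2 / card stab + C / card (carrier G)) * real (card (carrier G) ^ 3)" by simp
qed

end

section \<open>The special linear groups of degree two\<close>

type_synonym mat2 = "int \<times> int \<times> int \<times> int"

text \<open>Entries are represented by their least nonnegative residues, so that matrices are equal if and only if
  they are equal modulo \<open>p\<close>.\<close>

definition SL2 :: "int \<Rightarrow> mat2 monoid" where
  "SL2 p = \<lparr>carrier = {(a, b, c, d). {a, b, c, d} \<subseteq> {0..<p} \<and> (a * d - b * c) mod p = 1},
     monoid.mult = (\<lambda>(a, b, c, d) (a', b', c', d').
       ((a * a' + b * c') mod p, (a * b' + b * d') mod p, (c * a' + d * c') mod p, (c * b' + d * d') mod p)),
     one = (1, 0, 0, 1)\<rparr>"

definition nonzero_vectors :: "int \<Rightarrow> (int \<times> int) set" where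
  "nonzero_vectors p = {0..<p} \<times> {0..<p} - {(0, 0)}"

definition act2 :: "int \<Rightarrow> mat2 \<Rightarrow> int \<times> int \<Rightarrow> int \<times> int" where
  "act2 p = (\<lambda>(a, b, c, d) (x, y). ((a * x + b * y) mod p, (c * x + d * y) mod p))"

definition det2 :: "int \<Rightarrow> int \<times> int \<Rightarrow> int \<times> int \<Rightarrow> int" where
  "det2 p = (\<lambda>(x, y) (x', y'). (x * y' - y * x') mod p)"

lemma mod_mult_one:
  fixes p :: int
  assumes "u mod p = 1"
  shows "(x * u) mod p = x mod p" "(u * x) mod p = x mod p"
proof -
  have "(x * u) mod p = (x * (u mod p)) mod p" by (simp add: mod_mult_right_eq)
  then show "(x * u) mod p = x mod p" using assms by simp
  then show "(u * x) mod p = x mod p" by (simp add: mult.commute)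
qed

lemma mod_product_sums:
  fixes p :: int
  shows "((a mod p) * (b mod p) - (c mod p) * (d mod p)) mod p = (a * b - c * d) mod p"
    "(a * (b mod p) - c * (d mod p)) mod p = (a * b - c * d) mod p"
    "(a * (b mod p) + c * (d mod p)) mod p = (a * b + c * d) mod p"
    "((a mod p) * b + (c mod p) * d) mod p = (a * b + c * d) mod p"
    "(((a mod p) * b - (c mod p) * d) * e) mod p = ((a * b - c * d) * e) mod p"
    "(a * b - (c mod p) * (d mod p)) mod p = (a * b - c * d) mod p"
    "((a mod p) * (b mod p) - c * d) mod p = (a * b - c * d) mod p"
    "(- (a * (b mod p))) mod p = (- (a * b)) mod p"
  unfolding cong_def[symmetric]
  by (intro cong_diff cong_mult cong_add cong_minus_minus_iff[THEN iffD2]; simp add: cong_def)+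

lemma mod_minus_products:
  fixes p :: int
  shows "(u + ((- b) mod p) * c) mod p = (u - b * c) mod p" "(((- b) mod p) * c + u) mod p = (u - b * c) mod p"
proof -
  have "[u + ((- b) mod p) * c = u + (- b) * c] (mod p)"
    by (intro cong_add cong_mult) (simp_all add: cong_def)
  then show "(u + ((- b) mod p) * c) mod p = (u - b * c) mod p" by (simp add: cong_def)
  then show "(((- b) mod p) * c + u) mod p = (u - b * c) mod p" by (simp add: add.commute)
qed

locale prime_modulus =
  fixes p :: int
  assumes prime_p: "prime p"
begin

lemma p_gt_1: "p > 1"
  using prime_p by (rule prime_gt_1_int)

lemma one_mod [simp]: "1 mod p = 1"
  using p_gt_1 by simp

lemma mod_bounds [simp]: "0 \<le> x mod p" "x mod p < p"
  using p_gt_1 by auto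

lemma inverse_exists:
  assumes "x mod p \<noteq> 0"
  obtains e where "(x * e) mod p = 1" "e \<in> {0..<p}"
proof -
  have "coprime x p" using assms prime_p
    by (metis coprime_commute dvd_imp_mod_0 prime_imp_coprime)
  then obtain e where "[x * e = 1] (mod p)" using cong_solve_coprime_int by blast
  then have "(x * (e mod p)) mod p = 1" by (simp add: cong_def mod_mult_right_eq)
  then show ?thesis using that[of "e mod p"] by simp
qed

lemma mod_mult_eq_0: "(x * y) mod p = 0 \<Longrightarrow> x mod p = 0 \<or> y mod p = 0"
  using prime_p by (metis dvd_imp_mod_0 mod_0_imp_dvd prime_dvd_mult_iff)

lemma SL2_mem: "(a, b, c, d) \<in> carrier (SL2 p) \<longleftrightarrow>
   {a, b, c, d} \<subseteq> {0..<p} \<and> (a * d - b * c) mod p = 1"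
  by (simp add: SL2_def)

lemma SL2_mult: "(a, b, c, d) \<otimes>\<^bsub>SL2 p\<^esub> (a', b', c', d') =
  ((a * a' + b * c') mod p, (a * b' + b * d') mod p, (c * a' + d * c') mod p, (c * b' + d * d') mod p)"
  by (simp add: SL2_def)

lemma SL2_one: "\<one>\<^bsub>SL2 p\<^esub> = (1, 0, 0, 1)"
  by (simp add: SL2_def)

lemma finite_SL2: "finite (carrier (SL2 p))"
proof (rule finite_subset)
  show "carrier (SL2 p) \<subseteq> {0..<p} \<times> {0..<p} \<times> {0..<p} \<times> {0..<p}" by (auto simp: SL2_def)
qed simp

lemma group_SL2: "group (SL2 p)"
proof (rule groupI)
  fix x y assume xy: "x \<in> carrier (SL2 p)" "y \<in> carrier (SL2 p)"
  obtain a b c d a' b' c' d' where e: "x = (a, b, c, d)" "y = (a', b', c', d')" by (metis prod_cases4)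
  have "((a * d - b * c) * (a' * d' - b' * c')) mod p = 1"
    using xy by (metis SL2_mem e mod_mult_one(1) one_mod)
  moreover have "(a * d - b * c) * (a' * d' - b' * c') =
     (a * a' + b * c') * (c * b' + d * d') - (a * b' + b * d') * (c * a' + d * c')" by (simp add: algebra_simps)
  ultimately show "x \<otimes>\<^bsub>SL2 p\<^esub> y \<in> carrier (SL2 p)"
    unfolding e SL2_mult SL2_mem by (simp add: mod_product_sums)
next
  show "\<one>\<^bsub>SL2 p\<^esub> \<in> carrier (SL2 p)" using p_gt_1 by (simp add: SL2_one SL2_mem)
next
  fix x y z :: mat2
  obtain a b c d a' b' c' d' a'' b'' c'' d'' where e: "x = (a, b, c, d)" "y = (a', b', c', d')"
    "z = (a'', b'', c'', d'')" by (metis prod_cases4)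
  show "x \<otimes>\<^bsub>SL2 p\<^esub> y \<otimes>\<^bsub>SL2 p\<^esub> z = x \<otimes>\<^bsub>SL2 p\<^esub> (y \<otimes>\<^bsub>SL2 p\<^esub> z)"
    unfolding e SL2_mult by (simp add: mod_product_sums) (simp add: algebra_simps)
next
  fix x assume x: "x \<in> carrier (SL2 p)"
  obtain a b c d where e: "x = (a, b, c, d)" by (metis prod_cases4)
  show "\<one>\<^bsub>SL2 p\<^esub> \<otimes>\<^bsub>SL2 p\<^esub> x = x" using x unfolding e SL2_one SL2_mult SL2_mem by simp
  have m: "(d, (- b) mod p, (- c) mod p, a) \<in> carrier (SL2 p)"
    using x unfolding e SL2_mem by (simp add: mod_product_sums mult.commute)
  have "(d * a - b * c) mod p = 1" "(a * d - b * c) mod p = 1" "(a * d - c * b) mod p = 1"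
    using x unfolding e SL2_mem by (simp_all add: mult.commute)
  then have "(d, (- b) mod p, (- c) mod p, a) \<otimes>\<^bsub>SL2 p\<^esub> x = \<one>\<^bsub>SL2 p\<^esub>"
    unfolding e SL2_mult SL2_one mod_minus_products by (simp add: mult.commute)
  then show "\<exists>y\<in>carrier (SL2 p). y \<otimes>\<^bsub>SL2 p\<^esub> x = \<one>\<^bsub>SL2 p\<^esub>" using m by blast
qed

lemma det_act:
  assumes "x \<in> carrier (SL2 p)"
  shows "det2 p (act2 p x v) (act2 p x v') = det2 p v v'"
proof -
  obtain a b c d where e: "x = (a, b, c, d)" by (metis prod_cases4)
  obtain v1 v2 v1' v2' where v: "v = (v1, v2)" "v' = (v1', v2')" by (metis prod.exhaust)
  have "(a * d - b * c) mod p = 1" using assms e by (simp add: SL2_mem)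
  note mod_mult_one(2)[OF this, of "v1 * v2' - v2 * v1'"]
  moreover have "(a * d - b * c) * (v1 * v2' - v2 * v1') =
    (a * v1 + b * v2) * (c * v1' + d * v2') - (c * v1 + d * v2) * (a * v1' + b * v2')" by (simp add: algebra_simps)
  ultimately show ?thesis by (simp add: e v act2_def det2_def mod_product_sums)
qed

lemma det2_nonzero:
  assumes "det2 p v v' \<noteq> 0" "v \<in> {0..<p} \<times> {0..<p}" "v' \<in> {0..<p} \<times> {0..<p}"
  shows "v \<in> nonzero_vectors p" "v' \<in> nonzero_vectors p"
  using assms by (auto simp: nonzero_vectors_def det2_def)

lemma act2_range: "act2 p x v \<in> {0..<p} \<times> {0..<p}"
  by (cases x; cases v) (simp add: act2_def)

lemma act2_one: "v \<in> nonzero_vectors p \<Longrightarrow> act2 p (1, 0, 0, 1) v = v"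
  by (auto simp: act2_def nonzero_vectors_def)

lemma act2_mult: "act2 p (x \<otimes>\<^bsub>SL2 p\<^esub> y) v = act2 p x (act2 p y v)"
proof -
  obtain a b c d a' b' c' d' where e: "x = (a, b, c, d)" "y = (a', b', c', d')" by (metis prod_cases4)
  obtain v1 v2 where v: "v = (v1, v2)" by (metis prod.exhaust)
  show ?thesis unfolding e v SL2_mult act2_def by (simp add: mod_product_sums) (simp add: algebra_simps)
qed

lemma act2_nonzero:
  assumes x: "x \<in> carrier (SL2 p)" and v: "v \<in> nonzero_vectors p"
  shows "act2 p x v \<in> nonzero_vectors p"
proof (rule ccontr)
  assume "act2 p x v \<notin> nonzero_vectors p"
  then have z: "act2 p x v = (0, 0)" using act2_range[of x v] by (auto simp: nonzero_vectors_def)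
  interpret group "SL2 p" by (rule group_SL2)
  have "v = act2 p (inv\<^bsub>SL2 p\<^esub> x) (act2 p x v)"
    using x v by (simp add: act2_mult[symmetric] SL2_one act2_one)
  also have "\<dots> = (0, 0)" unfolding z by (cases "inv\<^bsub>SL2 p\<^esub> x") (simp add: act2_def)
  finally show False using v by (simp add: nonzero_vectors_def)
qed

lemma act2_transitive_base:
  assumes "v \<in> nonzero_vectors p"
  shows "\<exists>x\<in>carrier (SL2 p). act2 p x (1, 0) = v"
proof -
  obtain a c where ac: "v = (a, c)" by (cases v)
  then have v: "v = (a, c)" "{a, c} \<subseteq> {0..<p}" "a \<noteq> 0 \<or> c \<noteq> 0"
    using assms by (auto simp: nonzero_vectors_def)
  show ?thesis
  proof (cases "a = 0")
    case False
    then have "a mod p \<noteq> 0" using v by simp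
    then obtain e where e: "(a * e) mod p = 1" "e \<in> {0..<p}" by (rule inverse_exists)
    have "(a, 0, c, e) \<in> carrier (SL2 p)" using v e p_gt_1 by (simp add: SL2_mem)
    moreover have "act2 p (a, 0, c, e) (1, 0) = v" using v by (simp add: act2_def)
    ultimately show ?thesis by blast
  next
    case True
    then have "c mod p \<noteq> 0" using v by simp
    then obtain e where e: "(c * e) mod p = 1" "e \<in> {0..<p}" by (rule inverse_exists)
    have "(0, (- e) mod p, c, 0) \<in> carrier (SL2 p)"
      using v e p_gt_1 by (simp add: SL2_mem mod_product_sums mult.commute)
    moreover have "act2 p (0, (- e) mod p, c, 0) (1, 0) = v" using v True by (simp add: act2_def)
    ultimately show ?thesis by blast
  qed
qed

lemma transitive_action_SL2:
  "transitive_action (SL2 p) (act2 p) (nonzero_vectors p) (1, 0)"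
proof -
  interpret group "SL2 p" by (rule group_SL2)
  show ?thesis
  proof
    show "finite (carrier (SL2 p))" by (rule finite_SL2)
    show "finite (nonzero_vectors p)" by (simp add: nonzero_vectors_def)
    show "(1, 0) \<in> nonzero_vectors p" using p_gt_1 by (simp add: nonzero_vectors_def)
    fix z v assume z: "z \<in> nonzero_vectors p" and v: "v \<in> nonzero_vectors p"
    obtain x y where x: "x \<in> carrier (SL2 p)" "act2 p x (1, 0) = z"
      and y: "y \<in> carrier (SL2 p)" "act2 p y (1, 0) = v"
      using act2_transitive_base z v by meson
    have "act2 p (inv\<^bsub>SL2 p\<^esub> x) z = (1, 0)"
      using x p_gt_1 by (simp add: act2_mult[symmetric] SL2_one act2_one nonzero_vectors_def flip: x(2))
    then have "act2 p (y \<otimes>\<^bsub>SL2 p\<^esub> inv\<^bsub>SL2 p\<^esub> x) z = v" using y by (simp add: act2_mult)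
    then show "\<exists>x\<in>carrier (SL2 p). act2 p x z = v" using x y by blast
  qed (simp_all add: act2_nonzero act2_one act2_mult SL2_one)
qed

text \<open>A matrix of determinant 1 is determined by the images of two independent vectors, and these
  may be any two vectors with the same determinant.\<close>

lemma sum_pairs:
  fixes f h :: "int \<times> int \<Rightarrow> real"
  assumes z: "z \<in> nonzero_vectors p" "z' \<in> nonzero_vectors p" and \<delta>: "det2 p z z' \<noteq> 0"
  shows "(\<Sum>x\<in>carrier (SL2 p). f (act2 p x z) * h (act2 p x z')) =
    (\<Sum>(v', v)\<in>{(v', v). v' \<in> nonzero_vectors p \<and> v \<in> nonzero_vectors p \<and> det2 p v v' = det2 p z z'}. f v * h v')"
proof -
  obtain z1 z2 z1' z2' where zz: "z = (z1, z2)" "z' = (z1', z2')" by (metis prod.exhaust)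
  have "(z1 * z2' - z2 * z1') mod p \<noteq> 0" using \<delta> by (simp add: zz det2_def)
  then obtain e where e: "((z1 * z2' - z2 * z1') * e) mod p = 1" by (rule inverse_exists)
  define M where "M = (\<lambda>(v', v). case (v', v) of ((v1', v2'), (v1, v2)) \<Rightarrow>
     (((v1 * z2' - v1' * z2) * e) mod p, ((v1' * z1 - v1 * z1') * e) mod p,
      ((v2 * z2' - v2' * z2) * e) mod p, ((v2' * z1 - v2 * z1') * e) mod p))"
  let ?P = "{(v', v). v' \<in> nonzero_vectors p \<and> v \<in> nonzero_vectors p \<and> det2 p v v' = det2 p z z'}"
  have act: "act2 p (M (v', v)) z = v \<and> act2 p (M (v', v)) z' = v' \<and> M (v', v) \<in> carrier (SL2 p)"
    if "(v', v) \<in> ?P" for v v'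
  proof -
    obtain v1 v2 v1' v2' where vv: "v = (v1, v2)" "v' = (v1', v2')" by (metis prod.exhaust)
    have r: "{v1, v2, v1', v2'} \<subseteq> {0..<p}" using that by (auto simp: vv nonzero_vectors_def)
    have k: "(x * ((z1 * z2' - z2 * z1') * e)) mod p = x" if "x \<in> {0..<p}" for x
      using mod_mult_one(1)[OF e, of x] that by simp
    have eq: "(v1 * z2' - v1' * z2) * e * z1 + (v1' * z1 - v1 * z1') * e * z2 = v1 * ((z1 * z2' - z2 * z1') * e)"
      "(v2 * z2' - v2' * z2) * e * z1 + (v2' * z1 - v2 * z1') * e * z2 = v2 * ((z1 * z2' - z2 * z1') * e)"
      "(v1 * z2' - v1' * z2) * e * z1' + (v1' * z1 - v1 * z1') * e * z2' = v1' * ((z1 * z2' - z2 * z1') * e)"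
      "(v2 * z2' - v2' * z2) * e * z1' + (v2' * z1 - v2 * z1') * e * z2' = v2' * ((z1 * z2' - z2 * z1') * e)"
      by (simp_all add: algebra_simps)
    have d: "(v1 * v2' - v2 * v1') mod p = (z1 * z2' - z2 * z1') mod p"
      using that by (simp add: vv zz det2_def)
    have "((v1 * v2' - v2 * v1') * e) mod p = 1" using e d by (metis mod_mult_left_eq)
    then have "(((v1 * v2' - v2 * v1') * e) * ((z1 * z2' - z2 * z1') * e)) mod p = 1"
      using mod_mult_one(1)[OF e] by simp
    moreover have "((v1 * v2' - v2 * v1') * e) * ((z1 * z2' - z2 * z1') * e) =
       ((v1 * z2' - v1' * z2) * e) * ((v2' * z1 - v2 * z1') * e) - ((v1' * z1 - v1 * z1') * e) * ((v2 * z2' - v2' * z2) * e)"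
      by (simp add: algebra_simps)
    ultimately have m: "M (v', v) \<in> carrier (SL2 p)"
      unfolding M_def vv by (simp add: SL2_mem mod_product_sums)
    have "act2 p (M (v', v)) z = v" "act2 p (M (v', v)) z' = v'"
      unfolding M_def vv zz act2_def using r by (simp_all add: mod_product_sums eq k)
    then show ?thesis using m by blast
  qed
  have inv: "M (act2 p x z', act2 p x z) = x" if x: "x \<in> carrier (SL2 p)" for x
  proof -
    obtain a b c d where xe: "x = (a, b, c, d)" by (metis prod_cases4)
    have r: "{a, b, c, d} \<subseteq> {0..<p}" using x by (simp add: xe SL2_mem)
    have k: "(u * ((z1 * z2' - z2 * z1') * e)) mod p = u" if "u \<in> {0..<p}" for u
      using mod_mult_one(1)[OF e, of u] that by simp
    have eq: "((a * z1 + b * z2) * z2' - (a * z1' + b * z2') * z2) * e = a * ((z1 * z2' - z2 * z1') * e)"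
      "((a * z1' + b * z2') * z1 - (a * z1 + b * z2) * z1') * e = b * ((z1 * z2' - z2 * z1') * e)"
      "((c * z1 + d * z2) * z2' - (c * z1' + d * z2') * z2) * e = c * ((z1 * z2' - z2 * z1') * e)"
      "((c * z1' + d * z2') * z1 - (c * z1 + d * z2) * z1') * e = d * ((z1 * z2' - z2 * z1') * e)"
      by (simp_all add: algebra_simps)
    show ?thesis unfolding M_def xe zz act2_def using r by (simp add: mod_product_sums eq k)
  qed
  show ?thesis
  proof (rule sum.reindex_bij_witness[of _ M "\<lambda>x. (act2 p x z', act2 p x z)"])
    fix x assume x: "x \<in> carrier (SL2 p)"
    show "M (act2 p x z', act2 p x z) = x" by (rule inv[OF x])
    show "(act2 p x z', act2 p x z) \<in> ?P" using act2_nonzero[OF x] z det_act[OF x] by simp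
  next
    fix vv assume "vv \<in> ?P"
    then show "M vv \<in> carrier (SL2 p)" "(act2 p (M vv) z', act2 p (M vv) z) = vv"
      using act[of "fst vv" "snd vv"] by auto
  qed simp
qed

lemma card_det_eq_le:
  assumes v: "v \<in> nonzero_vectors p"
  shows "card {v' \<in> nonzero_vectors p. det2 p v v' = \<delta>} \<le> nat p"
proof -
  obtain x y where "v = (x, y)" by (cases v)
  then have xy: "v = (x, y)" "x \<in> {0..<p}" "y \<in> {0..<p}" "x \<noteq> 0 \<or> y \<noteq> 0"
    using v by (auto simp: nonzero_vectors_def)
  let ?S = "{v' \<in> nonzero_vectors p. det2 p v v' = \<delta>}"
  have cancel: "s = t" if "(u * s) mod p = (u * t) mod p" "u \<in> {0..<p}" "u \<noteq> 0" "s \<in> {0..<p}" "t \<in> {0..<p}" for u s t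
  proof -
    have "(u * (s - t)) mod p = 0" using that(1) by (simp add: mod_eq_dvd_iff right_diff_distrib)
    moreover have "u mod p \<noteq> 0" using that by simp
    ultimately have "(s - t) mod p = 0" using mod_mult_eq_0[of u "s - t"] by simp
    then have "s mod p = t mod p" by (simp add: mod_eq_dvd_iff dvd_eq_mod_eq_0)
    then show ?thesis using that by simp
  qed
  have "\<exists>g. inj_on g ?S \<and> g ` ?S \<subseteq> {0..<p}"
  proof (cases "x = 0")
    case False
    have "inj_on fst ?S"
    proof (rule inj_onI)
      fix a b assume ab: "a \<in> ?S" "b \<in> ?S" "fst a = fst b"
      obtain s t t' where e: "a = (s, t)" "b = (s, t')" using ab(3) by (metis prod.collapse)
      have "[x * t - y * s = x * t' - y * s] (mod p)"
        using ab(1,2) unfolding e xy(1) det2_def cong_def by auto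
      then have "(x * t) mod p = (x * t') mod p"
        using cong_add[of "x * t - y * s" "x * t' - y * s" p "y * s" "y * s"] by (simp add: cong_def)
      moreover have "t \<in> {0..<p}" "t' \<in> {0..<p}" using ab(1,2) by (simp_all add: e nonzero_vectors_def)
      ultimately have "t = t'" using cancel xy(2) False by metis
      then show "a = b" by (simp add: e)
    qed
    moreover have "fst ` ?S \<subseteq> {0..<p}" by (auto simp: nonzero_vectors_def)
    ultimately show ?thesis by blast
  next
    case True
    have "inj_on snd ?S"
    proof (rule inj_onI)
      fix a b assume ab: "a \<in> ?S" "b \<in> ?S" "snd a = snd b"
      obtain s s' t where e: "a = (s, t)" "b = (s', t)" using ab(3) by (metis prod.collapse)
      have "[x * t - y * s = x * t - y * s'] (mod p)"
        using ab(1,2) unfolding e xy(1) det2_def cong_def by auto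
      then have "(y * s) mod p = (y * s') mod p"
        using cong_diff[of "x * t" "x * t" p "x * t - y * s" "x * t - y * s'"] by (simp add: cong_def)
      moreover have "s \<in> {0..<p}" "s' \<in> {0..<p}" using ab(1,2) by (simp_all add: e nonzero_vectors_def)
      ultimately have "s = s'" using cancel xy(3,4) True by metis
      then show "a = b" by (simp add: e)
    qed
    moreover have "snd ` ?S \<subseteq> {0..<p}" by (auto simp: nonzero_vectors_def)
    ultimately show ?thesis by blast
  qed
  then obtain g where "inj_on g ?S" "g ` ?S \<subseteq> {0..<p}" by blast
  then have "card ?S \<le> card {0..<p}" by (intro card_inj_on_le[of g]) auto
  then show ?thesis by simp
qed

text \<open>Two linear equations \<open>det v u = \<delta>\<close> and \<open>det w u = \<delta>\<close> for \<open>u\<close> have one solution if \<open>v\<close> and \<open>w\<close> are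
  independent. If \<open>w\<close> is a multiple of \<open>v\<close>, then the equations contradict each other unless \<open>w = v\<close>, as
  \<open>\<delta>\<close> is not zero.\<close>

lemma common_det:
  assumes v: "v \<in> nonzero_vectors p" "w \<in> nonzero_vectors p" and \<delta>: "\<delta> \<in> {0..<p}" "\<delta> \<noteq> 0"
  defines "S \<equiv> {u \<in> nonzero_vectors p. det2 p v u = \<delta> \<and> det2 p w u = \<delta>}"
  shows "det2 p v w = 0 \<Longrightarrow> v \<noteq> w \<Longrightarrow> S = {}" and "det2 p v w \<noteq> 0 \<Longrightarrow> card S = 1"
proof -
  obtain v1 v2 w1 w2 where e: "v = (v1, v2)" "w = (w1, w2)" by (metis prod.exhaust)
  have r: "{v1, v2, w1, w2} \<subseteq> {0..<p}" using v by (auto simp: e nonzero_vectors_def)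
  have pl: "((w1 - v1) * \<delta> - (v1 * w2 - v2 * w1) * u1) mod p = 0 \<and> ((w2 - v2) * \<delta> - (v1 * w2 - v2 * w1) * u2) mod p = 0"
    if u: "(u1, u2) \<in> S" for u1 u2
  proof -
    have d: "(v1 * u2 - v2 * u1) mod p = \<delta> mod p" "(w1 * u2 - w2 * u1) mod p = \<delta> mod p"
      using u \<delta> by (simp_all add: S_def e det2_def)
    then obtain k l where kl: "v1 * u2 - v2 * u1 - \<delta> = p * k" "w1 * u2 - w2 * u1 - \<delta> = p * l"
      by (auto simp: mod_eq_dvd_iff dvd_def)
    have "(w1 - v1) * \<delta> - (v1 * w2 - v2 * w1) * u1 = p * (l * v1 - k * w1)"
      "(w2 - v2) * \<delta> - (v1 * w2 - v2 * w1) * u2 = p * (l * v2 - k * w2)"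
    proof -
      have "p * (l * x - k * y) = (w1 * u2 - w2 * u1 - \<delta>) * x - (v1 * u2 - v2 * u1 - \<delta>) * y" for x y
        unfolding kl by (simp add: algebra_simps)
      from this[of v1 w1] this[of v2 w2]
      show "(w1 - v1) * \<delta> - (v1 * w2 - v2 * w1) * u1 = p * (l * v1 - k * w1)"
        "(w2 - v2) * \<delta> - (v1 * w2 - v2 * w1) * u2 = p * (l * v2 - k * w2)"
        by (simp_all add: algebra_simps)
    qed
    then show ?thesis by simp
  qed
  show "S = {}" if d: "det2 p v w = 0" "v \<noteq> w"
  proof (rule ccontr)
    assume "S \<noteq> {}"
    then obtain u1 u2 where u: "(u1, u2) \<in> S" by (metis ex_in_conv surj_pair)
    have dv: "p dvd v1 * w2 - v2 * w1" using d by (simp add: e det2_def dvd_eq_mod_eq_0)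
    have "p dvd (w1 - v1) * \<delta>" "p dvd (w2 - v2) * \<delta>"
      using pl[OF u] dvd_mult2[OF dv, of u1] dvd_mult2[OF dv, of u2]
      by (metis dvd_eq_mod_eq_0 dvd_diff_right_iff dvd_diff_commute)+
    moreover have "\<not> p dvd \<delta>" using \<delta> by (auto dest: zdvd_imp_le)
    ultimately have "p dvd w1 - v1" "p dvd w2 - v2" using prime_p prime_dvd_mult_iff by blast+
    then have "w1 mod p = v1 mod p" "w2 mod p = v2 mod p" by (simp_all add: mod_eq_dvd_iff)
    then show False using r d by (simp add: e)
  qed
  show "card S = 1" if d: "det2 p v w \<noteq> 0"
  proof -
    have "(v1 * w2 - v2 * w1) mod p \<noteq> 0" using d by (simp add: e det2_def)
    then obtain i where i: "((v1 * w2 - v2 * w1) * i) mod p = 1" by (rule inverse_exists)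
    let ?u1 = "((w1 - v1) * \<delta> * i) mod p" and ?u2 = "((w2 - v2) * \<delta> * i) mod p"
    have "S \<subseteq> {(?u1, ?u2)}"
    proof
      fix u assume u: "u \<in> S"
      obtain u1 u2 where ue: "u = (u1, u2)" by (metis prod.exhaust)
      have ur: "u1 \<in> {0..<p}" "u2 \<in> {0..<p}" using u by (auto simp: ue S_def nonzero_vectors_def)
      have "((w1 - v1) * \<delta>) mod p = ((v1 * w2 - v2 * w1) * u1) mod p"
        "((w2 - v2) * \<delta>) mod p = ((v1 * w2 - v2 * w1) * u2) mod p"
        using pl[of u1 u2] u ue by (simp_all add: mod_eq_dvd_iff dvd_eq_mod_eq_0)
      then have "?u1 = (u1 * ((v1 * w2 - v2 * w1) * i)) mod p" "?u2 = (u2 * ((v1 * w2 - v2 * w1) * i)) mod p"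
        by (metis mod_mult_left_eq mult.assoc mult.commute)+
      then show "u \<in> {(?u1, ?u2)}" using mod_mult_one(1)[OF i] ur by (simp add: ue)
    qed
    moreover have "(?u1, ?u2) \<in> S"
    proof -
      have k: "(\<delta> * ((v1 * w2 - v2 * w1) * i)) mod p = \<delta>"
        using mod_mult_one(1)[OF i, of \<delta>] \<delta> by simp
      have eq: "v1 * ((w2 - v2) * \<delta> * i) - v2 * ((w1 - v1) * \<delta> * i) = \<delta> * ((v1 * w2 - v2 * w1) * i)"
        "w1 * ((w2 - v2) * \<delta> * i) - w2 * ((w1 - v1) * \<delta> * i) = \<delta> * ((v1 * w2 - v2 * w1) * i)"
        by (simp_all add: algebra_simps)
      have "det2 p v (?u1, ?u2) = \<delta>" "det2 p w (?u1, ?u2) = \<delta>"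
        by (simp_all add: e det2_def mod_product_sums eq k)
      then show ?thesis using det2_nonzero(2)[of v "(?u1, ?u2)"] \<delta> v
        by (simp add: S_def nonzero_vectors_def)
    qed
    ultimately have "S = {(?u1, ?u2)}" by blast
    then show ?thesis by simp
  qed
qed

text \<open>Expanding the square gives \<open>f v * f w\<close> times the number of common solutions \<open>u\<close>. This number is 1 for
  independent \<open>v\<close>, \<open>w\<close>, and replacing it by 1 everywhere would give the square of the sum of \<open>f\<close>, which is 0.
  What remains comes from the dependent pairs.\<close>

lemma line_sums_le:
  fixes f :: "int \<times> int \<Rightarrow> real"
  assumes f: "(\<Sum>v\<in>nonzero_vectors p. f v) = 0" and \<delta>: "\<delta> \<in> {0..<p}" "\<delta> \<noteq> 0"
  shows "(\<Sum>u\<in>nonzero_vectors p. (\<Sum>v\<in>{v \<in> nonzero_vectors p. det2 p v u = \<delta>}. f v)\<^sup>2)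
    \<le> 2 * p * (\<Sum>v\<in>nonzero_vectors p. (f v)\<^sup>2)"
proof -
  let ?V = "nonzero_vectors p"
  have fin [simp]: "finite ?V" by (simp add: nonzero_vectors_def)
  define I where "I v u = (if det2 p v u = \<delta> then 1 else 0 :: real)" for v u
  define N where "N v w = (\<Sum>u\<in>?V. I v u * I w u)" for v w
  have N: "N v w = card {u \<in> ?V. det2 p v u = \<delta> \<and> det2 p w u = \<delta>}" for v w
  proof -
    have "N v w = (\<Sum>u\<in>?V. if det2 p v u = \<delta> \<and> det2 p w u = \<delta> then 1 else 0)"
      unfolding N_def I_def by (intro sum.cong) auto
    then show ?thesis by (simp add: sum.If_cases Int_def)
  qed
  define dep where "dep v w = (if det2 p v w = 0 then 1 else 0 :: real)" for v w
  have depc: "(\<Sum>w\<in>?V. dep v w) \<le> p" if "v \<in> ?V" for v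
  proof -
    have "(\<Sum>w\<in>?V. dep v w) = card {w \<in> ?V. det2 p v w = 0}"
      unfolding dep_def by (simp add: sum.If_cases Int_def)
    also have "\<dots> \<le> nat p" using card_det_eq_le[OF that, of 0] by (simp only: of_nat_le_iff)
    finally show ?thesis using p_gt_1 by simp
  qed
  have dep_sym: "dep v w = dep w v" for v w
  proof -
    have "det2 p v w = 0 \<longleftrightarrow> det2 p w v = 0"
      by (cases v; cases w) (simp add: det2_def dvd_eq_mod_eq_0[symmetric] dvd_diff_commute mult.commute)
    then show ?thesis by (simp add: dep_def)
  qed
  have "(\<Sum>u\<in>?V. (\<Sum>v\<in>{v \<in> ?V. det2 p v u = \<delta>}. f v)\<^sup>2) = (\<Sum>u\<in>?V. (\<Sum>v\<in>?V. f v * I v u)\<^sup>2)"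
  proof (rule sum.cong[OF refl], rule arg_cong[where f = "\<lambda>x. x\<^sup>2"])
    fix u
    show "(\<Sum>v\<in>{v \<in> ?V. det2 p v u = \<delta>}. f v) = (\<Sum>v\<in>?V. f v * I v u)"
      unfolding I_def by (rule sum.mono_neutral_cong_left) auto
  qed
  also have "\<dots> = (\<Sum>u\<in>?V. \<Sum>v\<in>?V. \<Sum>w\<in>?V. f v * f w * (I v u * I w u))"
    by (simp add: power2_eq_square sum_product mult_ac)
  also have "\<dots> = (\<Sum>v\<in>?V. \<Sum>u\<in>?V. \<Sum>w\<in>?V. f v * f w * (I v u * I w u))" by (rule sum.swap)
  also have "\<dots> = (\<Sum>v\<in>?V. \<Sum>w\<in>?V. \<Sum>u\<in>?V. f v * f w * (I v u * I w u))"
    by (intro sum.cong refl sum.swap)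
  also have "\<dots> = (\<Sum>v\<in>?V. \<Sum>w\<in>?V. f v * f w * N v w)" by (simp add: N_def sum_distrib_left)
  also have "\<dots> \<le> (\<Sum>v\<in>?V. \<Sum>w\<in>?V. f v * f w + ((f v)\<^sup>2 + (f w)\<^sup>2) / 2 * (dep v w + (if v = w then real_of_int p - 1 else 0)))"
  proof (rule sum_mono, rule sum_mono)
    fix v w assume v: "v \<in> ?V" and w: "w \<in> ?V"
    have "\<bar>N v w - 1\<bar> \<le> dep v w + (if v = w then real_of_int p - 1 else 0)"
    proof (cases "det2 p v w = 0")
      case False
      then have "N v w = 1" using common_det(2)[OF v w \<delta>] N by simp
      then show ?thesis using p_gt_1 by (simp add: dep_def)
    next
      case True
      show ?thesis
      proof (cases "v = w")
        case True
        have "N v w \<le> p"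
          using card_det_eq_le[OF v, of \<delta>] p_gt_1 unfolding N using True by simp
        moreover have "N v w \<ge> 0" unfolding N by simp
        ultimately show ?thesis using True \<open>det2 p v w = 0\<close> p_gt_1 by (simp add: dep_def)
      next
        case False
        then have "N v w = 0" using common_det(1)[OF v w \<delta> True] N by simp
        then show ?thesis using False True by (simp add: dep_def)
      qed
    qed
    moreover have "\<bar>f v * f w\<bar> \<le> ((f v)\<^sup>2 + (f w)\<^sup>2) / 2"
    proof -
      have "0 \<le> (\<bar>f v\<bar> - \<bar>f w\<bar>)\<^sup>2" by simp
      then show ?thesis by (simp add: power2_diff abs_mult)
    qed
    ultimately have "\<bar>f v * f w\<bar> * \<bar>N v w - 1\<bar> \<le> ((f v)\<^sup>2 + (f w)\<^sup>2) / 2 * (dep v w + (if v = w then real_of_int p - 1 else 0))"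
      by (intro mult_mono) auto
    then have "f v * f w * (N v w - 1) \<le> ((f v)\<^sup>2 + (f w)\<^sup>2) / 2 * (dep v w + (if v = w then real_of_int p - 1 else 0))"
      by (simp add: abs_mult[symmetric])
    moreover have "f v * f w * (N v w - 1) = f v * f w * N v w - f v * f w" by (simp add: right_diff_distrib)
    ultimately show "f v * f w * N v w \<le> f v * f w + ((f v)\<^sup>2 + (f w)\<^sup>2) / 2 * (dep v w + (if v = w then real_of_int p - 1 else 0))"
      by linarith
  qed
  also have "\<dots> = (\<Sum>v\<in>?V. f v) * (\<Sum>w\<in>?V. f w) + (\<Sum>v\<in>?V. \<Sum>w\<in>?V. (f v)\<^sup>2 / 2 * dep v w)
      + (\<Sum>v\<in>?V. \<Sum>w\<in>?V. (f w)\<^sup>2 / 2 * dep v w) + (\<Sum>v\<in>?V. \<Sum>w\<in>?V. if v = w then (f v)\<^sup>2 * (p - 1) else 0)"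
    unfolding sum_product sum.distrib[symmetric]
    by (intro sum.cong refl) (simp add: algebra_simps add_divide_distrib)
  also have "(\<Sum>v\<in>?V. \<Sum>w\<in>?V. (f w)\<^sup>2 / 2 * dep v w) = (\<Sum>v\<in>?V. \<Sum>w\<in>?V. (f v)\<^sup>2 / 2 * dep v w)"
    by (subst sum.swap) (simp add: dep_sym)
  also have "(\<Sum>v\<in>?V. \<Sum>w\<in>?V. if v = w then (f v)\<^sup>2 * (p - 1) else 0) = (\<Sum>v\<in>?V. (f v)\<^sup>2) * (p - 1)"
    by (simp add: sum_distrib_right)
  also have "(\<Sum>v\<in>?V. \<Sum>w\<in>?V. (f v)\<^sup>2 / 2 * dep v w) \<le> (\<Sum>v\<in>?V. (f v)\<^sup>2 / 2 * p)"
    unfolding sum_distrib_left[symmetric] by (intro sum_mono mult_left_mono depc) auto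
  finally have "(\<Sum>u\<in>?V. (\<Sum>v\<in>{v \<in> ?V. det2 p v u = \<delta>}. f v)\<^sup>2) \<le>
     2 * (\<Sum>v\<in>?V. (f v)\<^sup>2 / 2 * p) + (\<Sum>v\<in>?V. (f v)\<^sup>2) * (p - 1)"
    using f by simp
  also have "2 * (\<Sum>v\<in>?V. (f v)\<^sup>2 / 2 * p) = p * (\<Sum>v\<in>?V. (f v)\<^sup>2)"
    by (simp add: sum_distrib_left sum_distrib_right mult.commute)
  also have "p * (\<Sum>v\<in>?V. (f v)\<^sup>2) + (\<Sum>v\<in>?V. (f v)\<^sup>2) * (p - 1) \<le> 2 * p * (\<Sum>v\<in>?V. (f v)\<^sup>2)"
    using sum_nonneg[of ?V "\<lambda>v. (f v)\<^sup>2"] by (simp add: algebra_simps)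
  finally show ?thesis .
qed

end

section \<open>Quasirandomness of the special linear groups\<close>

context prime_modulus
begin

interpretation act: transitive_action "SL2 p" "act2 p" "nonzero_vectors p" "(1, 0)"
  by (rule transitive_action_SL2)

lemma stab_eq: "act.stab = (\<lambda>t. (1, t, 0, 1)) ` {0..<p}"
proof
  show "act.stab \<subseteq> (\<lambda>t. (1, t, 0, 1)) ` {0..<p}"
  proof
    fix x assume x: "x \<in> act.stab"
    obtain a b c d where e: "x = (a, b, c, d)" by (metis prod_cases4)
    have r: "{a, b, c, d} \<subseteq> {0..<p}" "(a * d - b * c) mod p = 1" and "act2 p x (1, 0) = (1, 0)"
      using x by (simp_all add: act.stab_def e SL2_mem)
    then have "a = 1" "c = 0" by (simp_all add: e act2_def)
    then show "x \<in> (\<lambda>t. (1, t, 0, 1)) ` {0..<p}" using r by (simp add: e)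
  qed
  show "(\<lambda>t. (1, t, 0, 1)) ` {0..<p} \<subseteq> act.stab"
  proof (rule image_subsetI)
    fix t assume "t \<in> {0..<p}"
    then have "(1, t, 0, 1) \<in> carrier (SL2 p)" "act2 p (1, t, 0, 1) (1, 0) = (1, 0)"
      using p_gt_1 by (simp_all add: SL2_mem act2_def)
    then show "(1, t, 0, 1) \<in> act.stab" by (simp add: act.stab_def)
  qed
qed

lemma card_stab: "card act.stab = nat p"
  unfolding stab_eq by (subst card_image) (auto simp: inj_on_def)

lemma card_nonzero_vectors: "real (card (nonzero_vectors p)) = (real_of_int p)\<^sup>2 - 1"
proof -
  have "card (nonzero_vectors p) = nat p * nat p - 1"
    unfolding nonzero_vectors_def using p_gt_1 by (subst card_Diff_subset) (auto simp: card_cartesian_product)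
  moreover have "1 \<le> nat p * nat p" using p_gt_1 by (simp add: Suc_leI)
  ultimately show ?thesis using p_gt_1 by (simp add: of_nat_diff power2_eq_square)
qed

lemma card_SL2: "real (card (carrier (SL2 p))) = p * ((real_of_int p)\<^sup>2 - 1)"
proof -
  have "(1, 0) \<in> nonzero_vectors p" by (rule act.base_point)
  from act.sum_act[OF this, of "\<lambda>_. 1"] show ?thesis
    using p_gt_1 by (simp add: card_stab card_nonzero_vectors)
qed

lemma stab_commutes:
  assumes "u \<in> act.stab" "v \<in> act.stab"
  shows "u \<otimes>\<^bsub>SL2 p\<^esub> v = v \<otimes>\<^bsub>SL2 p\<^esub> u"
  using assms unfolding stab_eq by (auto simp: SL2_mult add.commute)

text \<open>For \<open>p = 4 m + 3\<close> and \<open>s = t ^ (m + 1)\<close> we have \<open>s\<^sup>2 = t t ^ ((p - 1) / 2)\<close>, and the last factor is 1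
  or \<open>-1\<close> by Fermat's theorem.\<close>

lemma square_or_minus_square:
  assumes p3: "p mod 4 = 3" and t: "t mod p \<noteq> 0"
  shows "\<exists>s. (s * s) mod p = t mod p \<or> (s * s) mod p = (- t) mod p"
proof -
  define m where "m = nat (p div 4)"
  have pm: "p = 4 * int m + 3" using p3 p_gt_1 mult_div_mod_eq[of 4 p] by (simp add: m_def pos_imp_zdiv_nonneg_iff)
  define u where "u = nat (t mod p)"
  have tu: "int u = t mod p" by (simp add: u_def)
  have pn: "prime (nat p)" using prime_p by (metis p_gt_1 int_nat_eq less_imp_le nat_0_le
      not_one_less_zero order.strict_trans prime_int_nat_transfer prime_nat_int_transfer prime_elem_nat_iff zero_less_one)
  have "\<not> nat p dvd u"
  proof
    assume "nat p dvd u"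
    then have "int (nat p) dvd int u" by (simp only: int_dvd_int_iff)
    then show False using t p_gt_1 tu by (simp add: dvd_eq_mod_eq_0)
  qed
  then have "[u ^ (nat p - 1) = 1] (mod nat p)" using fermat_theorem pn by blast
  then have "[int (u ^ (nat p - 1)) = int 1] (mod int (nat p))" by (simp only: cong_int_iff)
  moreover have "nat p - 1 = 2 * (2 * m + 1)" using pm by simp
  ultimately have "[int u ^ (2 * (2 * m + 1)) = 1] (mod p)" using p_gt_1 by simp
  moreover have "int u ^ (2 * (2 * m + 1)) = (int u ^ (2 * m + 1))\<^sup>2"
    by (simp only: power_mult[symmetric] mult.commute)
  ultimately have "p dvd (int u ^ (2 * m + 1))\<^sup>2 - 1"
    by (simp only: cong_iff_dvd_diff)
  moreover have "(int u ^ (2 * m + 1))\<^sup>2 - 1 = (int u ^ (2 * m + 1) - 1) * (int u ^ (2 * m + 1) + 1)"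
    by (simp add: power2_eq_square algebra_simps)
  ultimately have "p dvd int u ^ (2 * m + 1) - 1 \<or> p dvd int u ^ (2 * m + 1) + 1"
    using prime_p prime_dvd_mult_iff by metis
  then have "p dvd int u * (int u ^ (2 * m + 1) - 1) \<or> p dvd int u * (int u ^ (2 * m + 1) + 1)"
    using dvd_mult by blast
  moreover have "int u * int u ^ (2 * m + 1) = int u ^ (m + 1) * int u ^ (m + 1)"
    by (simp add: power_add[symmetric] mult_2 flip: power_Suc)
  ultimately have "p dvd int u ^ (m + 1) * int u ^ (m + 1) - int u \<or> p dvd int u ^ (m + 1) * int u ^ (m + 1) - (- int u)"
    by (simp only: right_diff_distrib distrib_left mult_1_right diff_minus_eq_add)
  then have "(int u ^ (m + 1) * int u ^ (m + 1)) mod p = int u mod p \<or>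
      (int u ^ (m + 1) * int u ^ (m + 1)) mod p = (- int u) mod p"
    by (simp only: mod_eq_dvd_iff)
  moreover have "int u mod p = t mod p" "(- int u) mod p = (- t) mod p"
    unfolding tu by (simp_all add: mod_minus_eq)
  ultimately show ?thesis by metis
qed

text \<open>Conjugation by a diagonal matrix multiplies the upper right entry by a square.\<close>

lemma unipotents_conjugate:
  assumes p3: "p mod 4 = 3" and w: "w \<in> act.stab" "w \<noteq> \<one>\<^bsub>SL2 p\<^esub>"
  shows "\<exists>h\<in>carrier (SL2 p). w = inv\<^bsub>SL2 p\<^esub> h \<otimes>\<^bsub>SL2 p\<^esub> (1, 1, 0, 1) \<otimes>\<^bsub>SL2 p\<^esub> h
     \<or> inv\<^bsub>SL2 p\<^esub> w = inv\<^bsub>SL2 p\<^esub> h \<otimes>\<^bsub>SL2 p\<^esub> (1, 1, 0, 1) \<otimes>\<^bsub>SL2 p\<^esub> h"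
proof -
  obtain t where t: "w = (1, t, 0, 1)" "t \<in> {0..<p}" using w(1) unfolding stab_eq by blast
  have t0: "t \<noteq> 0" using w(2) t by (auto simp: SL2_one)
  then have "t mod p \<noteq> 0" using t by simp
  from square_or_minus_square[OF p3 this]
  obtain s where s: "(s * s) mod p = t mod p \<or> (s * s) mod p = (- t) mod p" by blast
  have "s mod p \<noteq> 0"
  proof
    assume "s mod p = 0"
    then have "(s * s) mod p = 0" by (metis mod_mult_left_eq mult_zero_left mod_0)
    then have "t mod p = 0 \<or> (- t) mod p = 0" using s by auto
    then have "p dvd t" by (auto simp: dvd_eq_mod_eq_0[symmetric])
    then show False using t t0 by (auto dest: zdvd_imp_le)
  qed
  then obtain e where e: "(s * e) mod p = 1" "e \<in> {0..<p}" by (rule inverse_exists)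
  define l where "l = s mod p"
  have l: "l \<in> {0..<p}" "(l * e) mod p = 1" "(l * l) mod p = (s * s) mod p"
  proof -
    show "l \<in> {0..<p}" by (simp add: l_def)
    show "(l * e) mod p = 1" unfolding l_def mod_mult_left_eq by (rule e(1))
    show "(l * l) mod p = (s * s) mod p" unfolding l_def mod_mult_eq ..
  qed
  let ?h = "(e, 0, 0, l)" and ?h' = "(l, 0, 0, e)"
  have h: "?h \<in> carrier (SL2 p)" "?h' \<in> carrier (SL2 p)" using l e p_gt_1 by (simp_all add: SL2_mem mult.commute)
  have "?h' \<otimes>\<^bsub>SL2 p\<^esub> ?h = \<one>\<^bsub>SL2 p\<^esub>" using l by (simp add: SL2_mult SL2_one mult.commute)
  then have inv: "inv\<^bsub>SL2 p\<^esub> ?h = ?h'" using act.inv_equality[OF _ h] by simp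
  have "?h' \<otimes>\<^bsub>SL2 p\<^esub> (1, 1, 0, 1) \<otimes>\<^bsub>SL2 p\<^esub> ?h = (1, (s * s) mod p, 0, 1)"
    using l e by (simp add: SL2_mult mult.commute)
  then have c: "inv\<^bsub>SL2 p\<^esub> ?h \<otimes>\<^bsub>SL2 p\<^esub> (1, 1, 0, 1) \<otimes>\<^bsub>SL2 p\<^esub> ?h = (1, (s * s) mod p, 0, 1)"
    by (simp add: inv)
  have wm: "w \<in> carrier (SL2 p)" "(1, (- t) mod p, 0, 1) \<in> carrier (SL2 p)"
    using w p_gt_1 by (auto simp: act.stab_def SL2_mem)
  have "(1, (- t) mod p, 0, 1) \<otimes>\<^bsub>SL2 p\<^esub> w = \<one>\<^bsub>SL2 p\<^esub>"
    by (simp add: t SL2_mult SL2_one mod_add_right_eq)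
  then have "inv\<^bsub>SL2 p\<^esub> w = (1, (- t) mod p, 0, 1)" using act.inv_equality[OF _ wm] by simp
  moreover have "w = (1, t mod p, 0, 1)" using t by simp
  ultimately show ?thesis using c s h(1) by metis
qed

text \<open>If \<open>z\<close> and \<open>z'\<close> are independent, then a random matrix maps them to a random pair of vectors with the same
  determinant. For dependent \<open>z\<close> and \<open>z'\<close> only the trivial bound holds, but there are few such pairs.\<close>

lemma pair_correlation_le:
  fixes f h :: "int \<times> int \<Rightarrow> real"
  assumes z: "z \<in> nonzero_vectors p" "z' \<in> nonzero_vectors p" and f: "(\<Sum>v\<in>nonzero_vectors p. f v) = 0"
  shows "(\<Sum>x\<in>carrier (SL2 p). f (act2 p x z) * h (act2 p x z')) \<le>
    (if det2 p z z' = 0 then real_of_int p else sqrt (2 * p)) / 2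
      * ((\<Sum>v\<in>nonzero_vectors p. (f v)\<^sup>2) + (\<Sum>v\<in>nonzero_vectors p. (h v)\<^sup>2))"
proof (cases "det2 p z z' = 0")
  case True
  have "(\<Sum>x\<in>carrier (SL2 p). f (act2 p x z) * h (act2 p x z')) \<le>
      (\<Sum>x\<in>carrier (SL2 p). ((f (act2 p x z))\<^sup>2 + (h (act2 p x z'))\<^sup>2) / 2)"
  proof (intro sum_mono)
    fix x
    have "0 \<le> (f (act2 p x z) - h (act2 p x z'))\<^sup>2" by simp
    then show "f (act2 p x z) * h (act2 p x z') \<le> ((f (act2 p x z))\<^sup>2 + (h (act2 p x z'))\<^sup>2) / 2"
      by (simp add: power2_diff)
  qed
  also have "\<dots> = ((\<Sum>x\<in>carrier (SL2 p). (f (act2 p x z))\<^sup>2) + (\<Sum>x\<in>carrier (SL2 p). (h (act2 p x z'))\<^sup>2)) / 2"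
    by (simp add: sum_divide_distrib sum.distrib[symmetric])
  also have "\<dots> = p / 2 * ((\<Sum>v\<in>nonzero_vectors p. (f v)\<^sup>2) + (\<Sum>v\<in>nonzero_vectors p. (h v)\<^sup>2))"
    using act.sum_act[OF z(1), of "\<lambda>v. (f v)\<^sup>2"] act.sum_act[OF z(2), of "\<lambda>v. (h v)\<^sup>2"] p_gt_1
    by (simp add: card_stab algebra_simps)
  finally show ?thesis using True by simp
next
  case False
  let ?V = "nonzero_vectors p"
  let ?\<delta> = "det2 p z z'"
  define s where "s = sqrt (2 * real_of_int p)"
  have s: "s > 0" "s\<^sup>2 = 2 * p" using p_gt_1 by (simp_all add: s_def)
  have fin: "finite ?V" by (simp add: nonzero_vectors_def)
  have \<delta>: "?\<delta> \<in> {0..<p}" by (cases z; cases z') (simp add: det2_def)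
  define g where "g u = (\<Sum>v\<in>{v \<in> ?V. det2 p v u = ?\<delta>}. f v)" for u
  have "(\<Sum>x\<in>carrier (SL2 p). f (act2 p x z) * h (act2 p x z')) =
      (\<Sum>(v', v)\<in>{(v', v). v' \<in> ?V \<and> v \<in> ?V \<and> det2 p v v' = ?\<delta>}. f v * h v')"
    by (rule sum_pairs[OF z False])
  also have "{(v', v). v' \<in> ?V \<and> v \<in> ?V \<and> det2 p v v' = ?\<delta>} = Sigma ?V (\<lambda>v'. {v \<in> ?V. det2 p v v' = ?\<delta>})"
    by auto
  also have "(\<Sum>(v', v)\<in>Sigma ?V (\<lambda>v'. {v \<in> ?V. det2 p v v' = ?\<delta>}). f v * h v') = (\<Sum>u\<in>?V. g u * h u)"
    using fin by (subst sum.Sigma[symmetric]) (auto simp: g_def sum_distrib_right)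
  also have "\<dots> \<le> (\<Sum>u\<in>?V. (g u)\<^sup>2 / (2 * s) + s / 2 * (h u)\<^sup>2)"
  proof (intro sum_mono)
    fix u
    have "0 \<le> (g u - s * h u)\<^sup>2" by simp
    then have "2 * s * (g u * h u) \<le> (g u)\<^sup>2 + s * s * (h u)\<^sup>2"
      by (simp add: power2_eq_square algebra_simps)
    then have "g u * h u \<le> ((g u)\<^sup>2 + s * s * (h u)\<^sup>2) / (2 * s)"
      using s(1) by (simp add: pos_le_divide_eq mult.commute)
    then show "g u * h u \<le> (g u)\<^sup>2 / (2 * s) + s / 2 * (h u)\<^sup>2"
      using s(1) by (simp add: add_divide_distrib)
  qed
  also have "\<dots> = (\<Sum>u\<in>?V. (g u)\<^sup>2) / (2 * s) + s / 2 * (\<Sum>u\<in>?V. (h u)\<^sup>2)"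
    by (simp add: sum.distrib sum_divide_distrib sum_distrib_left)
  also have "\<dots> \<le> (s\<^sup>2 * (\<Sum>v\<in>?V. (f v)\<^sup>2)) / (2 * s) + s / 2 * (\<Sum>u\<in>?V. (h u)\<^sup>2)"
    using line_sums_le[OF f \<delta> False] s by (intro add_right_mono divide_right_mono) (auto simp: g_def)
  also have "\<dots> = s / 2 * ((\<Sum>v\<in>?V. (f v)\<^sup>2) + (\<Sum>v\<in>?V. (h v)\<^sup>2))"
    using s(1) by (simp add: power2_eq_square algebra_simps)
  finally show ?thesis using False by (simp add: s_def)
qed

lemma quasirandom_SL2:
  assumes p3: "p mod 4 = 3"
  shows "act.quasirandom (2 / p + (p * p + sqrt (2 * p) * p\<^sup>2) / (p * ((real_of_int p)\<^sup>2 - 1)))"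
proof -
  let ?V = "nonzero_vectors p"
  let ?\<kappa> = "\<lambda>z z'. if det2 p z z' = 0 then real_of_int p else sqrt (2 * p)"
  let ?C = "p * p + sqrt (2 * p) * (real_of_int p)\<^sup>2"
  have p0: "real_of_int p > 0" using p_gt_1 by simp
  have fin: "finite ?V" by (simp add: nonzero_vectors_def)
  have C: "(\<Sum>z'\<in>?V. ?\<kappa> z z') \<le> ?C" if z: "z \<in> ?V" for z
  proof -
    have "(\<Sum>z'\<in>?V. ?\<kappa> z z') \<le> (\<Sum>z'\<in>?V. (if det2 p z z' = 0 then real_of_int p else 0) + sqrt (2 * p))"
      by (intro sum_mono) (use p0 in auto)
    also have "\<dots> = card {z' \<in> ?V. det2 p z z' = 0} * p + sqrt (2 * p) * card ?V"
      using fin by (simp add: sum.distrib sum.If_cases Int_def)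
    also have "\<dots> \<le> nat p * p + sqrt (2 * p) * (real_of_int p)\<^sup>2"
      using card_det_eq_le[OF z, of 0] p0
      by (intro add_mono mult_mono mult_left_mono) (auto simp: card_nonzero_vectors simp flip: of_int_mult)
    finally show ?thesis using p0 by simp
  qed
  have sym: "?\<kappa> z' z = ?\<kappa> z z'" for z z'
  proof -
    have "det2 p z z' = 0 \<longleftrightarrow> det2 p z' z = 0"
      by (cases z; cases z') (simp add: det2_def dvd_eq_mod_eq_0[symmetric] dvd_diff_commute mult.commute)
    then show ?thesis by simp
  qed
  have "act.quasirandom (2 / card act.stab + ?C / card (carrier (SL2 p)))"
  proof (rule act.action_quasirandom)
    show "(1, 1, 0, 1) \<in> carrier (SL2 p)" using p_gt_1 by (simp add: SL2_mem)
    show "(\<Sum>z'\<in>?V. ?\<kappa> z z') \<le> ?C" if "z \<in> ?V" for z by (rule C[OF that])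
    show "(\<Sum>z'\<in>?V. ?\<kappa> z' z) \<le> ?C" if "z \<in> ?V" for z unfolding sym[of _ z] by (rule C[OF that])
    show "0 \<le> ?C" using p0 by simp
  qed (use stab_commutes unipotents_conjugate[OF p3] pair_correlation_le in auto)
  then show ?thesis using p_gt_1 by (simp add: card_stab card_SL2)
qed

end

text \<open>A product of numbers that are 1 modulo 4 is 1 modulo 4.\<close>

lemma prime_divisor_3_mod_4:
  fixes n :: nat
  assumes "n mod 4 = 3"
  shows "\<exists>q. prime q \<and> q dvd n \<and> q mod 4 = 3"
  using assms
proof (induction n rule: less_induct)
  case (less n)
  then have "n \<noteq> 1" by auto
  then obtain q where q: "prime q" "q dvd n" using prime_factor_nat by blast
  then obtain k where k: "n = q * k" by (auto simp: dvd_def)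
  show ?case
  proof (cases "q mod 4 = 3")
    case True
    then show ?thesis using q by blast
  next
    case False
    have "odd n" using less.prems by presburger
    then have "odd q" using k by simp
    then have q1: "q mod 4 = 1" using False by presburger
    have "k mod 4 = 3"
      using less.prems q1 unfolding k by (metis mod_mult_left_eq mult_1)
    moreover have "k < n"
      using q(1) k less.prems prime_gt_1_nat[OF q(1)] by (cases "k = 0") auto
    ultimately obtain r where "prime r" "r dvd k" "r mod 4 = 3" using less.IH by blast
    then show ?thesis using k by (metis dvd_mult)
  qed
qed

text \<open>Euclid's argument for the number \<open>4 m! - 1\<close>.\<close>

lemma large_prime_3_mod_4: "\<exists>p::int. prime p \<and> p mod 4 = 3 \<and> p > int m"
proof -
  let ?n = "4 * fact m - 1 :: nat"
  have f: "(fact m :: nat) \<ge> 1" by (rule fact_ge_1)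
  then obtain j :: nat where "fact m = Suc j" by (metis Suc_le_D One_nat_def)
  then have n: "?n = 3 + 4 * j" by simp
  have "?n mod 4 = 3" unfolding n by simp
  then obtain q where q: "prime q" "q dvd ?n" "q mod 4 = 3" using prime_divisor_3_mod_4 by blast
  have "q > m"
  proof (rule ccontr)
    assume "\<not> q > m"
    then have "q dvd fact m" using q(1) prime_dvd_fact_iff by simp
    then have "q dvd 4 * fact m" by simp
    then have "q dvd 4 * fact m - ?n" using q(2) dvd_diff_nat by blast
    then have "q dvd 1" using f by simp
    then show False using q(1) by simp
  qed
  moreover have "int q mod 4 = 3" using q(3) by presburger
  ultimately show ?thesis using q(1) by (intro exI[of _ "int q"]) simp
qed

text \<open>The bound above is of the order of \<open>1 / sqrt p\<close>; the constant 8 is generous.\<close>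

lemma quasirandom_SL2_exists:
  fixes \<epsilon> :: real
  assumes "\<epsilon> > 0"
  shows "\<exists>p. finite_group (SL2 p) \<and> finite_group.quasirandom (SL2 p) \<epsilon> \<and> m < card (carrier (SL2 p))"
proof -
  define M where "M = max (nat \<lceil>(8 / \<epsilon>)\<^sup>2\<rceil>) (m + 2)"
  obtain p :: int where p: "prime p" "p mod 4 = 3" "p > int M" using large_prime_3_mod_4 by blast
  interpret prime_modulus p using p by unfold_locales
  interpret transitive_action "SL2 p" "act2 p" "nonzero_vectors p" "(1, 0)"
    by (rule transitive_action_SL2)
  have pM: "real_of_int p > (8 / \<epsilon>)\<^sup>2" "p > int m + 2" using p(3) unfolding M_def by linarith+
  define r where "r = real_of_int p"
  have r: "r \<ge> 2" using p_gt_1 by (simp add: r_def)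
  have "(8 / \<epsilon>)\<^sup>2 < (sqrt r)\<^sup>2" using pM r by (simp add: r_def)
  then have "8 / \<epsilon> < sqrt r" by (rule power2_less_imp_less) (use r in simp)
  then have \<epsilon>: "8 / sqrt r < \<epsilon>" using assms r by (simp add: field_simps)
  have sr: "sqrt r \<ge> 1" "sqrt r * sqrt r = r" using r by simp_all
  have s2: "sqrt 2 \<le> 3 / 2" by (rule real_le_lsqrt) (auto simp: power2_eq_square)
  have "r * (r\<^sup>2 - 1) \<ge> r * (r\<^sup>2 / 2)"
  proof (intro mult_left_mono)
    have "2 * 2 \<le> r * r" using r by (intro mult_mono) auto
    then show "r\<^sup>2 / 2 \<le> r\<^sup>2 - 1" by (simp add: power2_eq_square)
  qed (use r in simp)
  then have "(r * r + sqrt (2 * r) * r\<^sup>2) / (r * (r\<^sup>2 - 1)) \<le> (r * r + sqrt (2 * r) * r\<^sup>2) / (r * (r\<^sup>2 / 2))"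
    using r by (intro divide_left_mono) (auto intro!: mult_pos_pos simp: power2_eq_square less_1_mult')
  also have "\<dots> = (2 + 2 * sqrt 2 * sqrt r) / r"
    using r by (simp add: real_sqrt_mult field_simps power2_eq_square)
  finally have "2 / r + (r * r + sqrt (2 * r) * r\<^sup>2) / (r * (r\<^sup>2 - 1)) \<le> 2 / r + (2 + 2 * sqrt 2 * sqrt r) / r"
    by simp
  also have "\<dots> = (4 + 2 * sqrt 2 * sqrt r) / r" by (simp add: add_divide_distrib)
  finally have "2 / r + (r * r + sqrt (2 * r) * r\<^sup>2) / (r * (r\<^sup>2 - 1)) \<le> (4 + 2 * sqrt 2 * sqrt r) / r" .
  also have "\<dots> \<le> (8 * sqrt r) / (sqrt r * sqrt r)"
  proof -
    have "2 * sqrt 2 * sqrt r \<le> 3 * sqrt r" using s2 sr by (intro mult_right_mono) auto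
    then have "4 + 2 * sqrt 2 * sqrt r \<le> 8 * sqrt r" using sr(1) by linarith
    then show ?thesis unfolding sr(2) using r by (intro divide_right_mono) auto
  qed
  also have "\<dots> = 8 / sqrt r" using r by (intro nonzero_mult_divide_mult_cancel_right) simp
  finally have le: "2 / r + (r * r + sqrt (2 * r) * r\<^sup>2) / (r * (r\<^sup>2 - 1)) \<le> \<epsilon>" using \<epsilon> by simp
  have "quasirandom \<epsilon>"
    unfolding quasirandom_def
  proof (intro allI impI)
    fix F assume F: "(\<Sum>x\<in>carrier (SL2 p). F x) = 0" "\<forall>x\<in>carrier (SL2 p). \<bar>F x\<bar> \<le> (1::real)"
    have "(\<Sum>k\<in>carrier (SL2 p). (corr F k)\<^sup>2) \<le> (2 / r + (r * r + sqrt (2 * r) * r\<^sup>2) / (r * (r\<^sup>2 - 1))) * card (carrier (SL2 p)) ^ 3"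
      using quasirandom_SL2[OF p(2)] F unfolding quasirandom_def r_def by simp
    also have "\<dots> \<le> \<epsilon> * card (carrier (SL2 p)) ^ 3" by (intro mult_right_mono le) simp
    finally show "(\<Sum>k\<in>carrier (SL2 p). (corr F k)\<^sup>2) \<le> \<epsilon> * card (carrier (SL2 p)) ^ 3" .
  qed
  moreover have "m < card (carrier (SL2 p))"
  proof -
    have "r * 1 \<le> r * (r\<^sup>2 - 1)"
    proof (intro mult_left_mono)
      have "2 * 2 \<le> r * r" using r by (intro mult_mono) auto
      then show "1 \<le> r\<^sup>2 - 1" by (simp add: power2_eq_square)
    qed (use r in simp)
    then have "real m < real (card (carrier (SL2 p)))"
      using card_SL2 pM(2) unfolding r_def by linarith
    then show ?thesis by simp
  qed
  ultimately show ?thesis using finite_group_axioms by blast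
qed

section \<open>Groups containing quasirandom finite groups\<close>

lemma grid_from_incidences:
  assumes lin: "linear_order_on X r" and A: "A \<subseteq> X" "finite A"
    and M01: "\<And>x y. M x y \<le> 1"
    and q: "2 \<le> q" "L * q \<le> card A"
    and inc: "\<And>i j. i < L \<Longrightarrow> j < L \<Longrightarrow> \<exists>a\<in>{i * q..<i * q + q}. \<exists>b\<in>{j * q..<j * q + q}.
        M (increasing_enum r A ! a) (increasing_enum r A ! b) = 1"
    and L: "L > 0"
  shows "L \<le> 2 * stww_fin (finite_submatrix r r M A A)"
proof -
  let ?l = "\<lambda>i. i * q" and ?u = "\<lambda>i. i * q + q - 1"
  let ?Q = "finite_submatrix r r M A A"
  have dims: "dim_row ?Q = card A" "dim_col ?Q = card A" by (simp_all add: finite_submatrix_def)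
  have block: "i * q + q \<le> card A" if "i < L" for i
  proof -
    have "Suc i * q \<le> L * q" using that by (intro mult_right_mono) auto
    then show ?thesis using q(2) by simp
  qed
  have entry: "\<exists>x\<in>{?l i..?u i}. \<exists>y\<in>{?l j..?u j}. ?Q $$ (x, y) = 1" if ij: "i < L" "j < L" for i j
  proof -
    obtain a b where ab: "a \<in> {i * q..<i * q + q}" "b \<in> {j * q..<j * q + q}"
      "M (increasing_enum r A ! a) (increasing_enum r A ! b) = 1"
      using inc[OF ij] by blast
    then have "a < card A" "b < card A" using block ij by fastforce+
    then have "?Q $$ (a, b) = 1" using ab(3) by (simp add: finite_submatrix_def)
    moreover have "a \<in> {?l i..?u i}" "b \<in> {?l j..?u j}" using ab by auto
    ultimately show ?thesis by blast
  qed
  have le1: "?Q $$ (x, y) \<le> 1" if "x < card A" "y < card A" for x y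
    using that M01 by (simp add: finite_submatrix_def)
  have "has_grid ?Q L ?l ?u ?l ?u"
    unfolding has_grid_def dims
  proof (intro conjI allI impI)
    fix i assume "i < L"
    then show "?u i < card A" "?u i < card A" using block[of i] q(1) by linarith+
  qed (use entry le1 q(1) in auto)
  moreover have "strict_parts L ?l ?u"
    unfolding strict_parts_def using q(1) by (intro allI impI) linarith
  ultimately show ?thesis using grid_stww_fin L by blast
qed

text \<open>The copy of \<open>K\<close> is cut into \<open>L\<close> blocks of size \<open>q = |K| div L\<close> which are consecutive in the given order;
  up to \<open>L - 1\<close> elements at the end are ignored. Each block has density at least \<open>1 / (2 * L)\<close>.\<close>

lemma quasirandom_right_mult_stww:
  fixes L :: nat and \<epsilon> :: real
  assumes lin: "linear_order_on (carrier G) r" and inf: "infinite (carrier G)"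
    and K: "finite_group K" "finite_group.quasirandom K \<epsilon>" "2 * L \<le> card (carrier K)"
    and \<epsilon>: "L\<^sup>2 * \<epsilon> < (1 / (2 * real L)) ^ 4" and L: "L > 0"
    and h: "h \<in> hom K G" "inj_on h (carrier K)"
  shows "\<exists>g\<in>carrier G. enat L \<le> 2 * right_mult_stww G r g"
proof -
  interpret K: finite_group K by (rule K(1))
  let ?K = "carrier K"
  define A where "A = h ` ?K"
  define xs where "xs = increasing_enum r A"
  define q where "q = card ?K div L"
  have A: "A \<subseteq> carrier G" "finite A" "A \<noteq> {}" "card A = card ?K"
    using h K.finite_carrier K.one_closed by (auto simp: A_def hom_def card_image)
  have xs: "set xs = A" "length xs = card A"
    using increasing_enum[OF lin A(1,2)] by (simp_all add: xs_def)
  then have dist: "distinct xs" by (simp add: card_distinct)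
  have "2 * L div L \<le> card ?K div L" using K(3) by (rule div_le_mono)
  then have q2: "2 \<le> q" using L by (simp add: q_def)
  have Lq: "L * q \<le> card ?K" by (simp add: q_def)
  define X where "X i = {k \<in> ?K. \<exists>a\<in>{i * q..<i * q + q}. h k = xs ! a}" for i
  have block: "i * q + q \<le> card A" if "i < L" for i
  proof -
    have "Suc i * q \<le> L * q" using that by (intro mult_right_mono) auto
    then show ?thesis using Lq A(4) by simp
  qed
  have cardX: "card (X i) = q" if "i < L" for i
  proof -
    have "h ` X i = (\<lambda>a. xs ! a) ` {i * q..<i * q + q}"
    proof
      show "h ` X i \<subseteq> (\<lambda>a. xs ! a) ` {i * q..<i * q + q}" by (auto simp: X_def)
      show "(\<lambda>a. xs ! a) ` {i * q..<i * q + q} \<subseteq> h ` X i"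
      proof (rule image_subsetI)
        fix a assume a: "a \<in> {i * q..<i * q + q}"
        then have "a < length xs" using block[OF that] xs(2) by auto
        then have "xs ! a \<in> A" using xs(1) nth_mem by blast
        then obtain k where "k \<in> ?K" "h k = xs ! a" by (auto simp: A_def)
        then show "xs ! a \<in> h ` X i" using a by (auto simp: X_def intro!: image_eqI[of _ _ k])
      qed
    qed
    moreover have "inj_on (\<lambda>a. xs ! a) {i * q..<i * q + q}"
      using dist block[OF that] xs(2) by (intro inj_on_nth) auto
    moreover have "inj_on h (X i)" using h(2) by (rule inj_on_subset) (auto simp: X_def)
    ultimately show ?thesis by (metis card_image card_atLeastLessThan add_diff_cancel_left')
  qed
  have dens: "1 / (2 * real L) * card ?K \<le> card (X i)" if "i < L" for i
  proof -
    have "card ?K < L * (q + 1)"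
      using L by (simp add: q_def mult.commute dividend_less_times_div)
    also have "\<dots> \<le> L * (2 * q)" using q2 by (intro mult_left_mono) auto
    finally have "card ?K \<le> L * (2 * q)" by (rule less_imp_le)
    then have "real (card ?K) \<le> real (L * (2 * q))" by (simp only: of_nat_le_iff)
    then show ?thesis using L by (simp add: cardX[OF that] field_simps)
  qed
  obtain g where g: "g \<in> ?K" "\<forall>i<L. \<forall>j<L. \<exists>x\<in>X i. x \<otimes>\<^bsub>K\<^esub> g \<in> X j"
    using K.simultaneous_incidence[OF K(2) _ \<epsilon>, of X] L dens by (auto simp: X_def)
  let ?M = "perm_matrix (\<lambda>x. x \<otimes>\<^bsub>G\<^esub> h g)"
  have "L \<le> 2 * stww_fin (finite_submatrix r r ?M A A)"
  proof (rule grid_from_incidences[OF lin A(1,2) _ q2 _ _ L])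
    show "L * q \<le> card A" using Lq A(4) by simp
    fix i j assume "i < L" "j < L"
    then obtain x where x: "x \<in> X i" "x \<otimes>\<^bsub>K\<^esub> g \<in> X j" using g by blast
    then obtain a b where ab: "a \<in> {i * q..<i * q + q}" "h x = xs ! a"
      "b \<in> {j * q..<j * q + q}" "h (x \<otimes>\<^bsub>K\<^esub> g) = xs ! b" by (auto simp: X_def)
    have "h (x \<otimes>\<^bsub>K\<^esub> g) = h x \<otimes>\<^bsub>G\<^esub> h g" using h(1) x(1) g(1) by (simp add: X_def hom_def)
    then have "?M (xs ! a) (xs ! b) = 1" using ab by (simp add: perm_matrix_def)
    then show "\<exists>a\<in>{i * q..<i * q + q}. \<exists>b\<in>{j * q..<j * q + q}.
        ?M (increasing_enum r A ! a) (increasing_enum r A ! b) = 1"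
      using ab unfolding xs_def by blast
  qed (simp add: perm_matrix_def)
  then have "enat L \<le> 2 * enat (stww_fin (finite_submatrix r r ?M A A))"
    by (simp add: numeral_eq_enat)
  also have "\<dots> \<le> 2 * right_mult_stww G r (h g)"
  proof (rule mult_left_mono)
    have "enat (stww_fin (finite_submatrix r r ?M A A)) \<le>
      (SUP (A, B) \<in> {(A, B). A \<subseteq> carrier G \<and> finite A \<and> A \<noteq> {} \<and> B \<subseteq> carrier G \<and> finite B \<and> B \<noteq> {}}.
              enat (stww_fin (finite_submatrix r r ?M A B)))"
      by (rule SUP_upper2[of "(A, A)"]) (use A in auto)
    then show "enat (stww_fin (finite_submatrix r r ?M A A)) \<le> right_mult_stww G r (h g)"
      using inf by (simp add: right_mult_stww_def stww_def)
  qed simp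
  finally show ?thesis using g(1) h(1) by (auto simp: hom_def)
qed

text \<open>The strict twin-width of an infinite matrix is a supremum over finite submatrices, so it suffices to look at
  the rows and columns in the copy of one large quasirandom group at a time.\<close>

theorem utww_infinite:
  assumes emb: "\<And>p. finite_group (SL2 p) \<Longrightarrow> \<exists>h\<in>hom (SL2 p) G. inj_on h (carrier (SL2 p))"
  shows "utww G = \<infinity>"
proof -
  have "infinite (carrier G)"
  proof
    assume fin: "finite (carrier G)"
    obtain p where p: "finite_group (SL2 p)" "card (carrier G) < card (carrier (SL2 p))"
      using quasirandom_SL2_exists[of 1 "card (carrier G)"] by auto
    then obtain h where "h \<in> hom (SL2 p) G" "inj_on h (carrier (SL2 p))" using emb by blast
    then have "card (carrier (SL2 p)) \<le> card (carrier G)"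
      using fin by (intro card_inj_on_le[of h]) (auto simp: hom_def)
    then show False using p(2) by simp
  qed
  have big: "\<exists>g\<in>carrier G. enat w \<le> right_mult_stww G r g" if lin: "linear_order_on (carrier G) r" for r w
  proof -
    define L where "L = 2 * w + 2"
    define \<epsilon> where "\<epsilon> = (1 / (2 * real L)) ^ 4 / (2 * (real L)\<^sup>2)"
    have L: "L > 0" by (simp add: L_def)
    then have \<epsilon>: "\<epsilon> > 0" by (simp add: \<epsilon>_def)
    obtain p where p: "finite_group (SL2 p)" "finite_group.quasirandom (SL2 p) \<epsilon>" "2 * L < card (carrier (SL2 p))"
      using quasirandom_SL2_exists[OF \<epsilon>] by blast
    obtain h where h: "h \<in> hom (SL2 p) G" "inj_on h (carrier (SL2 p))" using emb[OF p(1)] by blast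
    have "real (L\<^sup>2) * \<epsilon> < (1 / (2 * real L)) ^ 4" using L by (simp add: \<epsilon>_def)
    then obtain g where g: "g \<in> carrier G" "enat L \<le> 2 * right_mult_stww G r g"
      using quasirandom_right_mult_stww[OF lin \<open>infinite (carrier G)\<close> p(1,2) _ _ L h] p(3) by auto
    have "enat w \<le> right_mult_stww G r g"
      using g(2) by (cases "right_mult_stww G r g") (auto simp: L_def numeral_eq_enat)
    then show ?thesis using g(1) by blast
  qed
  have "(SUP g\<in>carrier G. right_mult_stww G r g) = \<infinity>" if lin: "linear_order_on (carrier G) r" for r
  proof (rule ccontr)
    assume "(SUP g\<in>carrier G. right_mult_stww G r g) \<noteq> \<infinity>"
    then obtain w where w: "(SUP g\<in>carrier G. right_mult_stww G r g) = enat w" by auto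
    obtain g where "g \<in> carrier G" "enat (Suc w) \<le> right_mult_stww G r g" using big[OF lin] by blast
    then have "enat (Suc w) \<le> enat w" unfolding w[symmetric] by (rule SUP_upper2)
    then show False by simp
  qed
  then have "\<infinity> \<le> utww G" unfolding utww_def by (intro INF_greatest) auto
  then show ?thesis by simp
qed

section \<open>Cayley embeddings into finitary symmetric groups\<close>

text \<open>Cayley's theorem: the left regular representation, transported to a subset of \<open>X\<close>.\<close>

lemma finite_group_embeds_in_FSym:
  assumes K: "finite_group K" and X: "infinite X"
  shows "\<exists>h\<in>hom K (FSym X). inj_on h (carrier K)"
proof -
  interpret K: finite_group K by (rule K)
  let ?K = "carrier K"
  obtain B where B: "finite B" "card B = card ?K" "B \<subseteq> X" using infinite_arbitrarily_large[OF X] by blast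
  then obtain e where e: "bij_betw e ?K B" using K.finite_carrier finite_same_card_bij by metis
  define d where "d = the_inv_into ?K e"
  have d: "d (e k) = k" if "k \<in> ?K" for k
    using e that by (simp add: d_def bij_betw_def the_inv_into_f_f)
  have eB: "e k \<in> B" if "k \<in> ?K" for k using e that by (auto simp: bij_betw_def)
  have ed: "e (d x) = x" "d x \<in> ?K" if "x \<in> B" for x
    using e that by (auto simp: d_def bij_betw_def f_the_inv_into_f the_inv_into_into)
  define h where "h k = (\<lambda>x\<in>X. if x \<in> B then e (k \<otimes>\<^bsub>K\<^esub> d x) else x)" for k
  have comp: "h k (h l x) = h (k \<otimes>\<^bsub>K\<^esub> l) x" if "k \<in> ?K" "l \<in> ?K" "x \<in> X" for k l x
    using that B(3) by (auto simp: h_def d eB ed K.m_assoc subset_iff)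
  have h1: "h \<one>\<^bsub>K\<^esub> x = x" if "x \<in> X" for x using that by (simp add: h_def ed)
  have hX: "h k x \<in> X" if "k \<in> ?K" "x \<in> X" for k x using that B(3) eB ed by (auto simp: h_def)
  have bij: "h k \<in> Bij X" if k: "k \<in> ?K" for k
  proof -
    have "bij_betw (h k) X X"
      by (rule bij_betw_byWitness[where f' = "h (inv\<^bsub>K\<^esub> k)"]) (use k comp h1 hX in auto)
    then show ?thesis by (simp add: Bij_def h_def)
  qed
  have fin: "h k \<in> finitary_perms X" if "k \<in> ?K" for k
  proof -
    have "{x \<in> X. h k x \<noteq> x} \<subseteq> B" by (auto simp: h_def)
    then show ?thesis using bij[OF that] B(1) finite_subset by (auto simp: finitary_perms_def)
  qed
  have "h \<in> hom K (FSym X)"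
  proof (rule homI)
    fix k l assume kl: "k \<in> ?K" "l \<in> ?K"
    have "h (k \<otimes>\<^bsub>K\<^esub> l) = compose X (h k) (h l)"
    proof
      fix x
      show "h (k \<otimes>\<^bsub>K\<^esub> l) x = compose X (h k) (h l) x"
      proof (cases "x \<in> X")
        case True
        then show ?thesis using comp[OF kl True] by (simp add: compose_def)
      next
        case False
        then show ?thesis by (simp add: h_def compose_def)
      qed
    qed
    then show "h (k \<otimes>\<^bsub>K\<^esub> l) = h k \<otimes>\<^bsub>FSym X\<^esub> h l" using bij kl by (simp add: FSym_def BijGroup_def)
  qed (simp add: FSym_def fin)
  moreover have "inj_on h ?K"
  proof (rule inj_onI)
    fix k l assume kl: "k \<in> ?K" "l \<in> ?K" "h k = h l"
    have "h m (e \<one>\<^bsub>K\<^esub>) = e m" if "m \<in> ?K" for m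
      using that B(3) eB[OF K.one_closed] by (auto simp: h_def d)
    then have "e k = e l" using kl by metis
    then show "k = l" using e kl by (auto simp: bij_betw_def inj_on_def)
  qed
  ultimately show ?thesis by blast
qed

theorem utww_perm_group_infinite:
  assumes X: "infinite X" and fin: "finitary_perms X \<subseteq> C"
  shows "utww ((BijGroup X)\<lparr>carrier := C\<rparr>) = \<infinity>"
proof (rule utww_infinite)
  fix p assume "finite_group (SL2 p)"
  then obtain h where "h \<in> hom (SL2 p) (FSym X)" "inj_on h (carrier (SL2 p))"
    using finite_group_embeds_in_FSym X by blast
  moreover have "hom (SL2 p) (FSym X) \<subseteq> hom (SL2 p) ((BijGroup X)\<lparr>carrier := C\<rparr>)"
    using fin by (auto simp: hom_def FSym_def)
  ultimately show "\<exists>h\<in>hom (SL2 p) ((BijGroup X)\<lparr>carrier := C\<rparr>). inj_on h (carrier (SL2 p))" by blast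
qed

section \<open>Groups of permutations of bounded displacement\<close>

text \<open>The second inequality does not follow from the first one for infinite \<open>X\<close>: a permutation may move single
  points far to the left.\<close>

definition bounded_displacement :: "'a set \<Rightarrow> ('a \<Rightarrow> nat) \<Rightarrow> ('a \<Rightarrow> 'a) \<Rightarrow> bool" where
  "bounded_displacement X idx \<sigma> \<longleftrightarrow> (\<exists>k. \<forall>x\<in>X. idx (\<sigma> x) \<le> idx x + k \<and> idx x \<le> idx (\<sigma> x) + k)"

text \<open>The group is ordered by comparing the inverses of its elements lexicographically along the
  enumeration of \<open>X\<close>: right multiplication by \<open>g\<close> then changes each value by \<open>g\<inverse>\<close>.\<close>

theorem finite_twin_width_bounded_displacement:
  assumes idx: "bij_betw idx X UNIV" and C: "C \<subseteq> Bij X" "C \<noteq> {}"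
    and bd: "\<And>g. g \<in> C \<Longrightarrow> bounded_displacement X idx g"
  shows "finite_twin_width ((BijGroup X)\<lparr>carrier := C\<rparr>)"
proof -
  define v where "v = inv_into X idx"
  have v: "v i \<in> X" "idx (v i) = i" for i
    using idx by (auto simp: v_def bij_betw_def inv_into_into f_inv_into_f)
  have vi: "v (idx x) = x" if "x \<in> X" for x
    using idx that by (simp add: v_def bij_betw_def)
  define c where "c \<sigma> i = idx (inv_into X \<sigma> (v i))" for \<sigma> i
  have bij: "bij_betw \<sigma> X X" "\<sigma> \<in> extensional X" if "\<sigma> \<in> C" for \<sigma>
    using C(1) that by (auto simp: Bij_def)
  have inv_mem: "inv_into X \<sigma> x \<in> X" if "\<sigma> \<in> C" "x \<in> X" for \<sigma> x
    using bij(1)[OF that(1)] that(2) by (simp add: bij_betw_def inv_into_into)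
  have inj: "inj_on c C"
  proof (rule inj_onI)
    fix \<sigma> \<tau> assume st: "\<sigma> \<in> C" "\<tau> \<in> C" "c \<sigma> = c \<tau>"
    have e: "inv_into X \<sigma> x = inv_into X \<tau> x" if x: "x \<in> X" for x
    proof -
      have "idx (inv_into X \<sigma> x) = idx (inv_into X \<tau> x)"
        using fun_cong[OF st(3), of "idx x"] vi[OF x] by (simp add: c_def)
      then show ?thesis using vi inv_mem st x by metis
    qed
    have "\<sigma> y = \<tau> y" if y: "y \<in> X" for y
    proof -
      have "\<sigma> y \<in> X" using bij(1)[OF st(1)] y by (auto simp: bij_betw_def)
      then have "inv_into X \<tau> (\<sigma> y) = y"
        using e[of "\<sigma> y"] bij(1)[OF st(1)] y by (simp add: bij_betw_def)
      then show ?thesis using bij(1)[OF st(2)] \<open>\<sigma> y \<in> X\<close> by (metis bij_betw_inv_into_right)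
    qed
    then show "\<sigma> = \<tau>" using bij(2) st by (intro extensionalityI[of _ X]) auto
  qed
  let ?G = "(BijGroup X)\<lparr>carrier := C\<rparr>"
  have "right_mult_stww ?G (lex_rel C c) g < \<infinity>" if g: "g \<in> C" for g
  proof -
    obtain k where k: "\<And>x. x \<in> X \<Longrightarrow> idx (g x) \<le> idx x + k \<and> idx x \<le> idx (g x) + k"
      using bd[OF g] by (auto simp: bounded_displacement_def)
    define \<phi> where "\<phi> j = idx (inv_into X g (v j))" for j
    have ginv: "g (inv_into X g x) = x" if "x \<in> X" for x
      using bij(1)[OF g] that by (metis bij_betw_inv_into_right)
    have \<phi>: "\<phi> j \<le> j + k" "j \<le> \<phi> j + k" for j
      using k[OF inv_mem[OF g v(1)], of j] ginv[OF v(1)] v(2) by (auto simp: \<phi>_def)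
    have \<phi>_inj: "\<phi> i = \<phi> j \<longleftrightarrow> i = j" for i j
    proof
      assume "\<phi> i = \<phi> j"
      then have "inv_into X g (v i) = inv_into X g (v j)" unfolding \<phi>_def using vi inv_mem[OF g v(1)] by metis
      then have "v i = v j" using ginv v(1) by metis
      then show "i = j" using v(2) by metis
    qed simp
    \<comment> \<open>the code of \<open>x \<otimes> g\<close> arises from that of \<open>x\<close> by applying the injective map \<open>\<phi>\<close> to each entry\<close>
    define R where "R a b \<longleftrightarrow> (\<forall>i. b i = \<phi> (a i))" for a b :: "nat \<Rightarrow> nat"
    have "near_matching R k"
      unfolding near_matching_def R_def using \<phi> \<phi>_inj by simp
    moreover have "R (c x) (c y)" if xy: "x \<in> C" "y \<in> C" and e: "perm_matrix (\<lambda>x. x \<otimes>\<^bsub>?G\<^esub> g) x y = 1" for x y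
    proof -
      have "y = x \<otimes>\<^bsub>?G\<^esub> g" using e by (simp add: perm_matrix_def split: if_splits)
      then have y: "y = compose X x g" using C(1) xy g by (auto simp: BijGroup_def)
      have "inv_into X y (v i) = inv_into X g (inv_into X x (v i))" for i
      proof -
        have m: "inv_into X g (inv_into X x (v i)) \<in> X" using inv_mem g xy v(1) by simp
        have "y (inv_into X g (inv_into X x (v i))) = v i"
          using m ginv[OF inv_mem[OF xy(1) v(1)]] bij_betw_inv_into_right[OF bij(1)[OF xy(1)] v(1)]
          by (simp add: y compose_def)
        then show ?thesis using bij(1)[OF xy(2)] m by (metis bij_betw_inv_into_left)
      qed
      then show ?thesis using vi inv_mem[OF xy(1) v(1)] by (simp add: R_def c_def \<phi>_def)
    qed
    ultimately have "stww C (lex_rel C c) C (lex_rel C c) (perm_matrix (\<lambda>x. x \<otimes>\<^bsub>?G\<^esub> g)) \<le> enat (2 * k + 2)"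
      by (intro stww_lex_le[OF inj C(2), where R = R]) (auto simp: perm_matrix_def)
    then have "right_mult_stww ?G (lex_rel C c) g \<le> enat (2 * k + 2)"
      by (simp add: right_mult_stww_def)
    then show ?thesis by (rule le_less_trans) simp
  qed
  then show ?thesis unfolding finite_twin_width_def
    using linear_order_lex_rel[OF inj] by (intro exI[of _ "lex_rel C c"]) simp
qed

section \<open>Free groups and finite presentations\<close>

definition reduced :: "('x \<times> bool) list \<Rightarrow> bool" where
  "reduced w \<longleftrightarrow> successively (\<lambda>a b. b \<noteq> inv_letter a) w"

lemma inv_letter_inv_letter [simp]: "inv_letter (inv_letter a) = a"
  by (simp add: inv_letter_def)

lemma fst_inv_letter [simp]: "fst (inv_letter a) = fst a"
  by (simp add: inv_letter_def)

lemma reduced_Nil [simp]: "reduced []"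
  by (simp add: reduced_def)

lemma reduced_Cons: "reduced (a # w) \<longleftrightarrow> reduced w \<and> (w = [] \<or> hd w \<noteq> inv_letter a)"
  by (cases w) (auto simp: reduced_def)

lemma reduced_cons_letter: "reduced w \<Longrightarrow> reduced (cons_letter a w)"
  by (cases w) (auto simp: reduced_Cons)

lemma cons_letter_cancel: "reduced w \<Longrightarrow> cons_letter a (cons_letter (inv_letter a) w) = w"
proof (cases w)
  case (Cons b v)
  assume w: "reduced w"
  show ?thesis
  proof (cases "b = a")
    case True
    then have "cons_letter a v = a # v" using w Cons by (cases v) (auto simp: reduced_Cons)
    then show ?thesis using True Cons by simp
  qed (use Cons in simp)
qed simp

lemma set_cons_letter: "fst ` set (cons_letter a w) \<subseteq> insert (fst a) (fst ` set w)"
  by (cases w) auto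

lemma reduced_foldr: "reduced v \<Longrightarrow> reduced (foldr cons_letter u v)"
  by (induction u) (auto simp: reduced_cons_letter)

lemma set_foldr_cons_letter: "fst ` set (foldr cons_letter u v) \<subseteq> fst ` set u \<union> fst ` set v"
proof (induction u)
  case (Cons a u)
  have "fst ` set (cons_letter a (foldr cons_letter u v)) \<subseteq> insert (fst a) (fst ` set (foldr cons_letter u v))"
    by (rule set_cons_letter)
  then show ?case using Cons by auto
qed simp

text \<open>Cancelling before or after the multiplication makes no difference; this is associativity for one letter.\<close>

lemma foldr_cons_letter_cons:
  assumes "reduced w"
  shows "foldr cons_letter (cons_letter a v) w = cons_letter a (foldr cons_letter v w)"
proof (cases v)
  case (Cons b v')
  then show ?thesis
    using cons_letter_cancel[OF reduced_foldr[OF assms], of a v'] by simp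
qed simp

lemma foldr_cons_letter_assoc:
  assumes "reduced w"
  shows "foldr cons_letter (foldr cons_letter u v) w = foldr cons_letter u (foldr cons_letter v w)"
  by (induction u) (simp_all add: foldr_cons_letter_cons[OF assms])

lemma foldr_cons_letter_Nil: "reduced w \<Longrightarrow> foldr cons_letter w [] = w"
proof (induction w)
  case (Cons a w)
  then show ?case by (cases w) (auto simp: reduced_Cons)
qed simp

lemma foldr_cons_letter_inverse: "reduced w \<Longrightarrow> foldr cons_letter (rev (map inv_letter u)) (foldr cons_letter u w) = w"
proof (induction u arbitrary: w)
  case (Cons a u)
  have "cons_letter (inv_letter a) (cons_letter a (foldr cons_letter u w)) = foldr cons_letter u w"
    using cons_letter_cancel[of "foldr cons_letter u w" "inv_letter a"] reduced_foldr[OF Cons.prems] by simp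
  then show ?case using Cons by simp
qed simp

lemma carrier_free_group: "carrier (free_group X) = {w. fst ` set w \<subseteq> X \<and> reduced w}"
  by (simp add: free_group_def reduced_def)

lemma mult_free_group: "u \<otimes>\<^bsub>free_group X\<^esub> v = foldr cons_letter u v"
  by (simp add: free_group_def)

lemma one_free_group: "\<one>\<^bsub>free_group X\<^esub> = []"
  by (simp add: free_group_def)

lemma group_free_group: "group (free_group X)"
proof (rule groupI)
  fix u v assume "u \<in> carrier (free_group X)" "v \<in> carrier (free_group X)"
  then show "u \<otimes>\<^bsub>free_group X\<^esub> v \<in> carrier (free_group X)"
    using order_trans[OF set_foldr_cons_letter[of u v], of X]
    by (simp add: carrier_free_group mult_free_group reduced_foldr)
next
  fix u v w
  assume "u \<in> carrier (free_group X)" "v \<in> carrier (free_group X)" "w \<in> carrier (free_group X)"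
  then show "u \<otimes>\<^bsub>free_group X\<^esub> v \<otimes>\<^bsub>free_group X\<^esub> w = u \<otimes>\<^bsub>free_group X\<^esub> (v \<otimes>\<^bsub>free_group X\<^esub> w)"
    by (simp add: carrier_free_group mult_free_group foldr_cons_letter_assoc)
next
  fix u assume u: "u \<in> carrier (free_group X)"
  let ?v = "foldr cons_letter (rev (map inv_letter u)) []"
  have "fst ` set ?v \<subseteq> fst ` set (rev (map inv_letter u)) \<union> fst ` set ([] :: ('a \<times> bool) list)"
    by (rule set_foldr_cons_letter)
  then have "?v \<in> carrier (free_group X)"
    using u by (auto simp: carrier_free_group reduced_foldr image_image)
  moreover have "?v \<otimes>\<^bsub>free_group X\<^esub> u = \<one>\<^bsub>free_group X\<^esub>"
  proof -
    have "?v \<otimes>\<^bsub>free_group X\<^esub> u = foldr cons_letter (rev (map inv_letter u)) (foldr cons_letter [] u)"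
      using u by (simp add: mult_free_group foldr_cons_letter_assoc carrier_free_group)
    also have "\<dots> = foldr cons_letter (rev (map inv_letter u)) (foldr cons_letter u [])"
      using u by (simp add: foldr_cons_letter_Nil carrier_free_group)
    finally show ?thesis by (simp add: foldr_cons_letter_inverse one_free_group)
  qed
  ultimately show "\<exists>v\<in>carrier (free_group X). v \<otimes>\<^bsub>free_group X\<^esub> u = \<one>\<^bsub>free_group X\<^esub>" by blast
qed (auto simp: carrier_free_group mult_free_group one_free_group)

context group
begin

definition letter_value :: "('x \<Rightarrow> 'a) \<Rightarrow> 'x \<times> bool \<Rightarrow> 'a" where
  "letter_value g a = (if snd a then g (fst a) else inv (g (fst a)))"

definition word_value :: "('x \<Rightarrow> 'a) \<Rightarrow> ('x \<times> bool) list \<Rightarrow> 'a" where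
  "word_value g w = foldr (\<lambda>a y. letter_value g a \<otimes> y) w \<one>"

lemma word_value_simps [simp]:
  "word_value g [] = \<one>" "word_value g (a # w) = letter_value g a \<otimes> word_value g w"
  by (simp_all add: word_value_def)

lemma word_value_hom:
  assumes g: "\<And>x. x \<in> X \<Longrightarrow> g x \<in> carrier G"
  shows "word_value g \<in> hom (free_group X) G"
proof -
  have lv [simp]: "letter_value g a \<in> carrier G" if "fst a \<in> X" for a
    using g that by (simp add: letter_value_def)
  have wv [simp]: "word_value g w \<in> carrier G" if "fst ` set w \<subseteq> X" for w
    using that by (induction w) auto
  have inv_lv: "letter_value g (inv_letter a) = inv (letter_value g a)" if "fst a \<in> X" for a
    using g that by (auto simp: letter_value_def inv_letter_def)
  have cons: "word_value g (cons_letter a w) = letter_value g a \<otimes> word_value g w"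
    if "fst a \<in> X" "fst ` set w \<subseteq> X" for a w
  proof (cases w)
    case (Cons b v)
    show ?thesis
    proof (cases "b = inv_letter a")
      case True
      have "letter_value g a \<otimes> (inv (letter_value g a) \<otimes> word_value g v) = word_value g v"
        using that Cons by (simp add: m_assoc[symmetric])
      then show ?thesis using True Cons that by (simp add: inv_lv)
    qed (use Cons in simp)
  qed simp
  have mult: "word_value g (foldr cons_letter u v) = word_value g u \<otimes> word_value g v"
    if "fst ` set u \<subseteq> X" "fst ` set v \<subseteq> X" for u v
    using that(1)
  proof (induction u)
    case Nil
    then show ?case using that by simp
  next
    case (Cons a u)
    have "fst ` set (foldr cons_letter u v) \<subseteq> X"
      by (rule order_trans[OF set_foldr_cons_letter[of u v]]) (use Cons.prems that(2) in simp)
    then show ?case using Cons that(2) by (simp add: cons m_assoc)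
  qed
  show ?thesis by (rule homI) (auto simp: carrier_free_group mult_free_group mult)
qed

lemma normal_normal_closure:
  assumes "R \<subseteq> carrier G"
  shows "normal_closure G R \<lhd> G" "R \<subseteq> normal_closure G R"
proof -
  have ne: "{N. N \<lhd> G \<and> R \<subseteq> N} \<noteq> {}" using normal_self assms by blast
  have "subgroup (\<Inter>{N. N \<lhd> G \<and> R \<subseteq> N}) G"
    by (rule subgroups_Inter) (use ne normal_imp_subgroup in blast)+
  moreover have "x \<otimes> h \<otimes> inv x \<in> \<Inter>{N. N \<lhd> G \<and> R \<subseteq> N}"
    if "x \<in> carrier G" "h \<in> \<Inter>{N. N \<lhd> G \<and> R \<subseteq> N}" for x h
    using that normal_inv_iff by blast
  ultimately show "normal_closure G R \<lhd> G" unfolding normal_closure_def by (rule normal_invI)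
  show "R \<subseteq> normal_closure G R" unfolding normal_closure_def by blast
qed

lemma normal_closure_minimal: "N \<lhd> G \<Longrightarrow> R \<subseteq> N \<Longrightarrow> normal_closure G R \<subseteq> N"
  unfolding normal_closure_def by blast

end

abbreviation free_gen :: "'x \<Rightarrow> ('x \<times> bool) list" where
  "free_gen x \<equiv> [(x, True)]"

lemma generate_free_gens: "generate (free_group X) (free_gen ` X) = carrier (free_group X)"
proof
  interpret F: group "free_group X" by (rule group_free_group)
  have gens: "free_gen ` X \<subseteq> carrier (free_group X)" by (auto simp: carrier_free_group reduced_Cons)
  then show "generate (free_group X) (free_gen ` X) \<subseteq> carrier (free_group X)" by (rule F.generate_incl)
  show "carrier (free_group X) \<subseteq> generate (free_group X) (free_gen ` X)"
  proof
    fix w assume "w \<in> carrier (free_group X)"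
    then show "w \<in> generate (free_group X) (free_gen ` X)"
    proof (induction w)
      case Nil
      then show ?case using generate.one[of "free_group X"] by (simp add: one_free_group)
    next
      case (Cons a w)
      have w: "w \<in> carrier (free_group X)" "fst a \<in> X" using Cons.prems by (auto simp: carrier_free_group reduced_Cons)
      have "[a] \<in> generate (free_group X) (free_gen ` X)"
      proof (cases "snd a")
        case True
        then have "[a] = free_gen (fst a)" by (cases a) simp
        then show ?thesis using w(2) by (metis generate.incl imageI)
      next
        case False
        then have a: "a = (fst a, False)" by (cases a) simp
        have "[a] \<otimes>\<^bsub>free_group X\<^esub> free_gen (fst a) = \<one>\<^bsub>free_group X\<^esub>"
          by (subst a) (simp add: mult_free_group one_free_group inv_letter_def)
        moreover have "[a] \<in> carrier (free_group X)" using w by (simp add: carrier_free_group reduced_Cons)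
        ultimately have "inv\<^bsub>free_group X\<^esub> free_gen (fst a) = [a]"
          using F.inv_equality gens w(2) by blast
        then show ?thesis using w(2) by (metis generate.inv imageI)
      qed
      moreover have "a # w = [a] \<otimes>\<^bsub>free_group X\<^esub> w"
        using Cons.prems by (cases w) (auto simp: mult_free_group carrier_free_group reduced_Cons)
      ultimately show ?case using Cons.IH[OF w(1)] generate.eng by metis
    qed
  qed
qed

text \<open>By the first isomorphism theorem it is enough that the kernel is the normal closure of the relators.\<close>

lemma finitely_presentedI:
  fixes X :: "nat set"
  assumes G: "group G" and X: "finite X" and g: "\<And>x. x \<in> X \<Longrightarrow> g x \<in> carrier G"
    and gen: "carrier G = generate G (g ` X)"
    and R: "finite R" "R \<subseteq> carrier (free_group X)"
    and triv: "\<And>r. r \<in> R \<Longrightarrow> group.word_value G g r = \<one>\<^bsub>G\<^esub>"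
    and ker: "\<And>w. w \<in> carrier (free_group X) \<Longrightarrow> group.word_value G g w = \<one>\<^bsub>G\<^esub> \<Longrightarrow>
       w \<in> normal_closure (free_group X) R"
  shows "finitely_presented G"
proof -
  interpret G: group G by (rule G)
  interpret F: group "free_group X" by (rule group_free_group)
  let ?v = "G.word_value g"
  interpret h: group_hom "free_group X" G ?v
    by unfold_locales (rule G.word_value_hom[OF g])
  have "kernel (free_group X) G ?v = normal_closure (free_group X) R"
  proof
    show "kernel (free_group X) G ?v \<subseteq> normal_closure (free_group X) R"
      using ker by (auto simp: kernel_def)
    show "normal_closure (free_group X) R \<subseteq> kernel (free_group X) G ?v"
      by (rule F.normal_closure_minimal[OF h.normal_kernel]) (use triv R in \<open>auto simp: kernel_def\<close>)
  qed
  moreover have "?v ` carrier (free_group X) = carrier G"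
  proof -
    have "?v ` generate (free_group X) (free_gen ` X) = generate G (?v ` free_gen ` X)"
      by (rule h.generate_img[symmetric]) (auto simp: carrier_free_group reduced_Cons)
    also have "?v ` free_gen ` X = g ` X"
      unfolding image_image by (rule image_cong) (auto simp: G.letter_value_def g)
    finally show ?thesis by (simp add: generate_free_gens gen)
  qed
  ultimately have "free_group X Mod normal_closure (free_group X) R \<cong> G"
    using h.FactGroup_iso by metis
  then have "G \<cong> free_group X Mod normal_closure (free_group X) R"
    by (rule group.iso_sym[rotated]) (rule normal.factorgroup_is_group[OF F.normal_normal_closure(1)[OF R(2)]])
  then show ?thesis unfolding finitely_presented_def using X R by blast
qed

section \<open>A finite presentation of the Houghton groups\<close>

context group
begin

definition conj_by :: "'a \<Rightarrow> 'a \<Rightarrow> 'a" where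
  "conj_by x y = x \<otimes> y \<otimes> inv x"

lemma conj_by_closed [simp]: "x \<in> carrier G \<Longrightarrow> y \<in> carrier G \<Longrightarrow> conj_by x y \<in> carrier G"
  by (simp add: conj_by_def)

lemma conj_by_one [simp]: "y \<in> carrier G \<Longrightarrow> conj_by \<one> y = y"
  by (simp add: conj_by_def)

lemma conj_by_comp:
  "x \<in> carrier G \<Longrightarrow> y \<in> carrier G \<Longrightarrow> z \<in> carrier G \<Longrightarrow> conj_by x (conj_by y z) = conj_by (x \<otimes> y) z"
  by (simp add: conj_by_def m_assoc inv_mult_group)

lemma conj_by_mult:
  assumes "x \<in> carrier G" "y \<in> carrier G" "z \<in> carrier G"
  shows "conj_by x (y \<otimes> z) = conj_by x y \<otimes> conj_by x z"
proof -
  have "conj_by x y \<otimes> conj_by x z = x \<otimes> y \<otimes> (inv x \<otimes> x) \<otimes> z \<otimes> inv x"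
    using assms unfolding conj_by_def by (simp only: m_assoc m_closed inv_closed)
  then show ?thesis using assms by (simp add: conj_by_def m_assoc)
qed

lemma conj_by_eq_iff:
  assumes "x \<in> carrier G" "y \<in> carrier G"
  shows "conj_by x y = y \<longleftrightarrow> x \<otimes> y = y \<otimes> x"
  using assms unfolding conj_by_def by (metis inv_solve_right m_closed)

lemma conj_by_inv_cancel [simp]:
  "x \<in> carrier G \<Longrightarrow> y \<in> carrier G \<Longrightarrow> conj_by (inv x) (conj_by x y) = y"
  "x \<in> carrier G \<Longrightarrow> y \<in> carrier G \<Longrightarrow> conj_by x (conj_by (inv x) y) = y"
  by (simp_all add: conj_by_comp)

lemma conj_by_move:
  assumes "x \<in> carrier G" "y \<in> carrier G"
  shows "x \<otimes> y = conj_by x y \<otimes> x"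
  using assms by (simp add: conj_by_def m_assoc)

lemma centraliser_subgroup:
  assumes "y \<in> carrier G"
  shows "subgroup {x \<in> carrier G. x \<otimes> y = y \<otimes> x} G"
proof (rule subgroupI)
  fix x assume x: "x \<in> {x \<in> carrier G. x \<otimes> y = y \<otimes> x}"
  then have "conj_by x y = y" using assms by (simp add: conj_by_eq_iff)
  then have "conj_by (inv x) y = y" using x assms by (metis (lifting) conj_by_inv_cancel(1) mem_Collect_eq)
  then show "inv x \<in> {x \<in> carrier G. x \<otimes> y = y \<otimes> x}" using x assms by (simp add: conj_by_eq_iff)
next
  fix x z assume "x \<in> {x \<in> carrier G. x \<otimes> y = y \<otimes> x}" "z \<in> {x \<in> carrier G. x \<otimes> y = y \<otimes> x}"
  then have xz: "x \<in> carrier G" "z \<in> carrier G" "x \<otimes> y = y \<otimes> x" "z \<otimes> y = y \<otimes> z" by auto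
  have "x \<otimes> z \<otimes> y = x \<otimes> (y \<otimes> z)" using xz assms by (simp add: m_assoc)
  also have "\<dots> = y \<otimes> x \<otimes> z" using xz assms by (simp add: m_assoc[symmetric])
  finally show "x \<otimes> z \<in> {x \<in> carrier G. x \<otimes> y = y \<otimes> x}" using xz assms by (simp add: m_assoc)
qed (use assms in auto)

lemma commuting_generators:
  assumes S: "S \<subseteq> carrier G" and comm: "\<And>x y. x \<in> S \<Longrightarrow> y \<in> S \<Longrightarrow> x \<otimes> y = y \<otimes> x"
    and gen: "carrier G = generate G S"
  shows "comm_group G"
proof (rule group_comm_groupI)
  have 1: "x \<otimes> y = y \<otimes> x" if x: "x \<in> carrier G" and y: "y \<in> S" for x y
  proof -
    have "generate G S \<subseteq> {x \<in> carrier G. x \<otimes> y = y \<otimes> x}"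
      by (rule generate_subgroup_incl[OF _ centraliser_subgroup]) (use S comm y in auto)
    then show ?thesis using x gen by blast
  qed
  fix x y assume x: "x \<in> carrier G" and y: "y \<in> carrier G"
  have "generate G S \<subseteq> {y \<in> carrier G. y \<otimes> x = x \<otimes> y}"
    by (rule generate_subgroup_incl[OF _ centraliser_subgroup[OF x]]) (use S 1[OF x] in auto)
  then show "x \<otimes> y = y \<otimes> x" using y gen by auto
qed

end

text \<open>In the Houghton group this commutator is the transposition of the centre and its neighbour on the first
  ray.\<close>

definition houghton_swap :: "('a, 'b) monoid_scheme \<Rightarrow> (nat \<Rightarrow> 'a) \<Rightarrow> 'a" where
  "houghton_swap G g = g 2 \<otimes>\<^bsub>G\<^esub> g 3 \<otimes>\<^bsub>G\<^esub> inv\<^bsub>G\<^esub> (g 2) \<otimes>\<^bsub>G\<^esub> inv\<^bsub>G\<^esub> (g 3)"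

text \<open>Besides \<open>a\<close>, the transposition of the first two points on the first ray is \<open>b\<close>, and that of the first
  two points on the second ray is \<open>f\<close>. The first four relations say that \<open>a\<close> and \<open>b\<close> are
  braided involutions and that \<open>f\<close> commutes with \<open>a\<close> and \<open>g 3\<close>, which do not touch the second ray; the
  remaining ones say that the generators shift \<open>a\<close> in the same way and commute up to \<open>a\<close>. The pairs are
  the two sides of each relation, so that the same list makes sense in every group.\<close>

definition houghton_relations :: "('a, 'b) monoid_scheme \<Rightarrow> (nat \<Rightarrow> 'a) \<Rightarrow> nat \<Rightarrow> ('a \<times> 'a) set" where
  "houghton_relations G g n =
     (let a = houghton_swap G g;
          b = g 2 \<otimes>\<^bsub>G\<^esub> a \<otimes>\<^bsub>G\<^esub> inv\<^bsub>G\<^esub> (g 2);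
          f = inv\<^bsub>G\<^esub> (g 2) \<otimes>\<^bsub>G\<^esub> (inv\<^bsub>G\<^esub> (g 2) \<otimes>\<^bsub>G\<^esub> a \<otimes>\<^bsub>G\<^esub> g 2) \<otimes>\<^bsub>G\<^esub> g 2
      in {(a \<otimes>\<^bsub>G\<^esub> a, \<one>\<^bsub>G\<^esub>), (a \<otimes>\<^bsub>G\<^esub> b \<otimes>\<^bsub>G\<^esub> a, b \<otimes>\<^bsub>G\<^esub> a \<otimes>\<^bsub>G\<^esub> b),
          (f \<otimes>\<^bsub>G\<^esub> a, a \<otimes>\<^bsub>G\<^esub> f), (f \<otimes>\<^bsub>G\<^esub> g 3, g 3 \<otimes>\<^bsub>G\<^esub> f)}
         \<union> (\<lambda>k. (g k \<otimes>\<^bsub>G\<^esub> a, b \<otimes>\<^bsub>G\<^esub> g k)) ` {2..n}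
         \<union> (\<lambda>(i, j). (g i \<otimes>\<^bsub>G\<^esub> g j, a \<otimes>\<^bsub>G\<^esub> (g j \<otimes>\<^bsub>G\<^esub> g i))) ` {(i, j). i \<in> {2..n} \<and> j \<in> {2..n} \<and> i \<noteq> j})"

lemma finite_houghton_relations: "finite (houghton_relations G g n)"
proof -
  have "finite {(i, j). i \<in> {2..n} \<and> j \<in> {2..n} \<and> i \<noteq> j}"
    by (rule finite_subset[of _ "{2..n} \<times> {2..n}"]) auto
  then show ?thesis by (simp add: houghton_relations_def Let_def)
qed

lemma (in group) houghton_swap_closed:
  "3 \<le> n \<Longrightarrow> (\<And>k. k \<in> {2..n} \<Longrightarrow> g k \<in> carrier G) \<Longrightarrow> houghton_swap G g \<in> carrier G"
  by (simp add: houghton_swap_def)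

lemma (in group) houghton_relations_closed:
  assumes n: "3 \<le> n" and g: "\<And>k. k \<in> {2..n} \<Longrightarrow> g k \<in> carrier G" and r: "(l, r) \<in> houghton_relations G g n"
  shows "l \<in> carrier G \<and> r \<in> carrier G"
proof -
  have "houghton_swap G g \<in> carrier G" "g 2 \<in> carrier G" "g 3 \<in> carrier G"
    using houghton_swap_closed[OF n g] g n by auto
  then show ?thesis using g r by (auto simp: houghton_relations_def Let_def)
qed

lemma (in group_hom) houghton_relations_image:
  assumes n: "3 \<le> n" and g: "\<And>k. k \<in> {2..n} \<Longrightarrow> g k \<in> carrier G"
  shows "houghton_relations H (\<lambda>k. h (g k)) n = (\<lambda>(l, r). (h l, h r)) ` houghton_relations G g n"
proof -
  have a: "houghton_swap G g \<in> carrier G" "g 2 \<in> carrier G" "g 3 \<in> carrier G"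
    using G.houghton_swap_closed[OF n g] g n by auto
  have ha: "houghton_swap H (\<lambda>k. h (g k)) = h (houghton_swap G g)"
    using a by (simp add: houghton_swap_def hom_mult)
  have 1: "(\<lambda>k. (h (g k) \<otimes>\<^bsub>H\<^esub> h (houghton_swap G g), h (g 2 \<otimes> houghton_swap G g \<otimes> inv g 2) \<otimes>\<^bsub>H\<^esub> h (g k))) ` {2..n} =
     (\<lambda>k. (h (g k \<otimes> houghton_swap G g), h (g 2 \<otimes> houghton_swap G g \<otimes> inv g 2 \<otimes> g k))) ` {2..n}"
    using a g by (intro image_cong) (auto simp: hom_mult)
  have 2: "(\<lambda>(i, j). (h (g i) \<otimes>\<^bsub>H\<^esub> h (g j), h (houghton_swap G g) \<otimes>\<^bsub>H\<^esub> (h (g j) \<otimes>\<^bsub>H\<^esub> h (g i)))) `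
       {(i, j). i \<in> {2..n} \<and> j \<in> {2..n} \<and> i \<noteq> j} =
     (\<lambda>(i, j). (h (g i \<otimes> g j), h (houghton_swap G g \<otimes> (g j \<otimes> g i)))) ` {(i, j). i \<in> {2..n} \<and> j \<in> {2..n} \<and> i \<noteq> j}"
    using a g by (intro image_cong) (auto simp: hom_mult)
  have h2: "h (g 2) \<otimes>\<^bsub>H\<^esub> h (houghton_swap G g) \<otimes>\<^bsub>H\<^esub> inv\<^bsub>H\<^esub> h (g 2) = h (g 2 \<otimes> houghton_swap G g \<otimes> inv g 2)"
    "inv\<^bsub>H\<^esub> h (g 2) \<otimes>\<^bsub>H\<^esub> (inv\<^bsub>H\<^esub> h (g 2) \<otimes>\<^bsub>H\<^esub> h (houghton_swap G g) \<otimes>\<^bsub>H\<^esub> h (g 2)) \<otimes>\<^bsub>H\<^esub> h (g 2) =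
       h (inv g 2 \<otimes> (inv g 2 \<otimes> houghton_swap G g \<otimes> g 2) \<otimes> g 2)"
    using a by (simp_all add: hom_mult)
  show ?thesis
    unfolding houghton_relations_def Let_def ha h2 1 2 image_Un image_insert image_empty image_image case_prod_beta
    using a by (simp add: hom_mult image_image case_prod_beta)
qed

text \<open>After the removal of the centre, its neighbour on the first ray takes its place in the star formed by the remaining
  vertices. This self-similarity lets the same argument compute the stabilisers of one and of two points.\<close>

definition shift_star :: "star_vertex \<Rightarrow> star_vertex" where
  "shift_star v = (case v of Centre \<Rightarrow> Ray 1 1 | Ray i m \<Rightarrow> if i = 1 then Ray 1 (m + 1) else Ray i m)"

lemma star_vertices_cases [consumes 1, case_names Centre First Other]:
  assumes "v \<in> star_vertices n"
  obtains "v = Centre" | m where "v = Ray 1 m" "1 \<le> m" | i m where "v = Ray i m" "2 \<le> i" "i \<le> n" "1 \<le> m"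
proof -
  from assms consider "v = Centre" | i m where "v = Ray i m" "1 \<le> i" "i \<le> n" "1 \<le> m"
    by (auto simp: star_vertices_def)
  then show thesis
  proof cases
    case (2 i m)
    then show thesis using that by (cases "i = 1") auto
  qed (use that in simp)
qed

lemma Centre_in [simp]: "Centre \<in> star_vertices n"
  by (simp add: star_vertices_def)

lemma Ray_in [simp]: "Ray i m \<in> star_vertices n \<longleftrightarrow> 1 \<le> i \<and> i \<le> n \<and> 1 \<le> m"
  by (simp add: star_vertices_def)

lemma houghton_gen_simps [simp]:
  "houghton_gen n k Centre = Ray 1 1"
  "1 \<le> n \<Longrightarrow> 1 \<le> m \<Longrightarrow> houghton_gen n k (Ray 1 m) = Ray 1 (m + 1)"
  "2 \<le> k \<Longrightarrow> k \<le> n \<Longrightarrow> houghton_gen n k (Ray k 1) = Centre"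
  "2 \<le> k \<Longrightarrow> k \<le> n \<Longrightarrow> 1 \<le> m \<Longrightarrow> houghton_gen n k (Ray k (Suc m)) = Ray k m"
  "2 \<le> i \<Longrightarrow> i \<le> n \<Longrightarrow> 1 \<le> m \<Longrightarrow> i \<noteq> k \<Longrightarrow> houghton_gen n k (Ray i m) = Ray i m"
  by (auto simp: houghton_gen_def)

lemma houghton_gen_Ray_Suc_0 [simp]:
  "2 \<le> k \<Longrightarrow> k \<le> n \<Longrightarrow> houghton_gen n k (Ray k (Suc 0)) = Centre"
  "1 \<le> n \<Longrightarrow> 1 \<le> m \<Longrightarrow> houghton_gen n k (Ray (Suc 0) m) = Ray 1 (m + 1)"
  using houghton_gen_simps(2,3)[unfolded One_nat_def] by (simp_all add: houghton_gen_def)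

lemma houghton_gen_closed:
  assumes "k \<in> {2..n}" "v \<in> star_vertices n"
  shows "houghton_gen n k v \<in> star_vertices n"
  using assms(2)
proof (cases rule: star_vertices_cases)
  case (Other i m)
  then show ?thesis using assms(1) by (cases "i = k"; cases m) (auto simp: houghton_gen_def)
qed (use assms(1) in auto)

lemma houghton_gen_Bij:
  assumes k: "k \<in> {2..n}"
  shows "houghton_gen n k \<in> Bij (star_vertices n)"
proof -
  let ?V = "star_vertices n"
  define h where "h v = (case v of Centre \<Rightarrow> Ray k 1
     | Ray i m \<Rightarrow> if i = 1 then (if m = 1 then Centre else Ray 1 (m - 1)) else if i = k then Ray k (m + 1) else Ray i m)" for v
  have "bij_betw (houghton_gen n k) ?V ?V"
  proof (rule bij_betw_byWitness[where f' = h])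
    show "\<forall>v\<in>?V. h (houghton_gen n k v) = v"
    proof
      fix v assume "v \<in> ?V"
      then show "h (houghton_gen n k v) = v"
      proof (cases rule: star_vertices_cases)
        case (Other i m)
        then obtain m' where "m = Suc m'" by (cases m) auto
        then show ?thesis using Other k by (cases "i = k"; cases "m' = 0") (simp_all add: h_def)
      qed (use k in \<open>simp_all add: h_def\<close>)
    qed
    show "\<forall>v\<in>?V. houghton_gen n k (h v) = v"
    proof
      fix v assume "v \<in> ?V"
      then show "houghton_gen n k (h v) = v"
      proof (cases rule: star_vertices_cases)
        case (First m)
        then show ?thesis using k by (cases "m = 1") (simp_all add: h_def)
      next
        case (Other i m)
        then show ?thesis using k by (cases "i = k") (simp_all add: h_def)
      qed (use k in \<open>simp add: h_def\<close>)
    qed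
    show "houghton_gen n k ` ?V \<subseteq> ?V" using houghton_gen_closed[OF k] by blast
    show "h ` ?V \<subseteq> ?V"
    proof (rule image_subsetI)
      fix v assume "v \<in> ?V"
      then show "h v \<in> ?V" using k by (cases rule: star_vertices_cases) (auto simp: h_def)
    qed
  qed
  moreover have "houghton_gen n k \<in> extensional ?V" by (simp add: houghton_gen_def)
  ultimately show ?thesis by (simp add: Bij_def)
qed

lemma houghton_gens_commute_up_to_swap:
  assumes ij: "i \<in> {2..n}" "j \<in> {2..n}" "i \<noteq> j" and v: "v \<in> star_vertices n"
  shows "houghton_gen n i (houghton_gen n j v) =
    transpose Centre (Ray 1 1) (houghton_gen n j (houghton_gen n i v))"
  using v
proof (cases rule: star_vertices_cases)
  case Centre
  then show ?thesis using ij by (simp add: transpose_def)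
next
  case (First m)
  then show ?thesis using ij by (simp add: transpose_def)
next
  case (Other l m)
  then obtain m' where m: "m = Suc m'" by (cases m) auto
  have k: "2 \<le> i" "i \<le> n" "2 \<le> j" "j \<le> n" using ij by auto
  show ?thesis
  proof (cases "l = i \<or> l = j")
    case True
    then show ?thesis using Other(1) m k ij(3) by (cases m') (auto simp: transpose_def)
  next
    case False
    then show ?thesis using Other by (simp add: transpose_def)
  qed
qed

lemma shift_star_closed: "2 \<le> n \<Longrightarrow> v \<in> star_vertices n \<Longrightarrow> shift_star v \<in> star_vertices n"
  by (auto simp: shift_star_def split: star_vertex.splits)

lemma shift_star_inj: "v \<in> star_vertices n \<Longrightarrow> w \<in> star_vertices n \<Longrightarrow> shift_star v = shift_star w \<Longrightarrow> v = w"
  by (auto simp: shift_star_def split: star_vertex.splits if_splits)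

lemma shift_star_surj:
  assumes "v \<in> star_vertices n" "v \<noteq> Centre"
  shows "\<exists>w\<in>star_vertices n. v = shift_star w"
  using assms(1)
proof (cases rule: star_vertices_cases)
  case (First m)
  show ?thesis
  proof (cases "m = 1")
    case True
    then show ?thesis using First by (intro bexI[of _ Centre]) (simp_all add: shift_star_def)
  next
    case False
    then show ?thesis using First assms(1) by (intro bexI[of _ "Ray 1 (m - 1)"]) (auto simp: shift_star_def)
  qed
next
  case (Other i m)
  then show ?thesis by (intro bexI[of _ v]) (auto simp: shift_star_def)
qed (use assms in simp)

lemma swap_houghton_gen_shift:
  assumes "k \<in> {2..n}" "v \<in> star_vertices n"
  shows "transpose Centre (Ray 1 1) (houghton_gen n k (shift_star v)) = shift_star (houghton_gen n k v)"
  using assms(2)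
proof (cases rule: star_vertices_cases)
  case (Other i m)
  then obtain m' where m: "m = Suc m'" by (cases m) auto
  then show ?thesis using Other assms(1)
    by (cases "i = k"; cases m') (auto simp: transpose_def shift_star_def)
qed (use assms(1) in \<open>auto simp: transpose_def shift_star_def\<close>)

section \<open>Schreier generators for groups acting on the star\<close>

text \<open>The group acts on the star through \<open>\<rho>\<close>, but it need not be a permutation group: it will be the
  quotient of the free group by the relators.\<close>

locale group_acting_on_star = group G for G (structure) +
  fixes n :: nat and \<rho> :: "'a \<Rightarrow> star_vertex \<Rightarrow> star_vertex"
  assumes n3: "3 \<le> n"
    and \<rho>_hom: "\<rho> \<in> hom G (BijGroup (star_vertices n))"
begin

abbreviation "V \<equiv> star_vertices n"

lemma \<rho>_Bij: "x \<in> carrier G \<Longrightarrow> \<rho> x \<in> Bij V"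
  using \<rho>_hom by (auto simp: hom_def BijGroup_def)

lemma \<rho>_mult: "x \<in> carrier G \<Longrightarrow> y \<in> carrier G \<Longrightarrow> v \<in> V \<Longrightarrow> \<rho> (x \<otimes> y) v = \<rho> x (\<rho> y v)"
  using \<rho>_hom \<rho>_Bij by (simp add: hom_def BijGroup_def compose_def)

lemma \<rho>_closed: "x \<in> carrier G \<Longrightarrow> v \<in> V \<Longrightarrow> \<rho> x v \<in> V"
  using \<rho>_Bij Bij_imp_funcset by blast

lemma \<rho>_one: "v \<in> V \<Longrightarrow> \<rho> \<one> v = v"
proof -
  assume v: "v \<in> V"
  have "inj_on (\<rho> \<one>) V" using \<rho>_Bij[of \<one>] by (simp add: Bij_def bij_betw_def)
  moreover have "\<rho> \<one> (\<rho> \<one> v) = \<rho> \<one> v" using \<rho>_mult[of \<one> \<one> v] v by simp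
  ultimately show ?thesis using v \<rho>_closed by (simp add: inj_on_def)
qed

lemma \<rho>_inv: "x \<in> carrier G \<Longrightarrow> v \<in> V \<Longrightarrow> \<rho> (inv x) (\<rho> x v) = v"
  using \<rho>_mult[of "inv x" x v] \<rho>_one by simp

lemma \<rho>_inv': "x \<in> carrier G \<Longrightarrow> v \<in> V \<Longrightarrow> \<rho> x (\<rho> (inv x) v) = v"
  using \<rho>_mult[of x "inv x" v] \<rho>_one by simp

lemma \<rho>_inj: "x \<in> carrier G \<Longrightarrow> v \<in> V \<Longrightarrow> w \<in> V \<Longrightarrow> \<rho> x v = \<rho> x w \<Longrightarrow> v = w"
  using \<rho>_inv by metis

lemma \<rho>_transpose:
  assumes "x \<in> carrier G" "u \<in> V" "v \<in> V" "w \<in> V"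
  shows "\<rho> x (transpose u v w) = transpose (\<rho> x u) (\<rho> x v) (\<rho> x w)"
proof -
  have "\<rho> x w = \<rho> x u \<longleftrightarrow> w = u" "\<rho> x w = \<rho> x v \<longleftrightarrow> w = v"
    using \<rho>_inj[OF assms(1)] assms(2-) by blast+
  then show ?thesis unfolding transpose_def by auto
qed

lemma conjugate_transposition_act:
  assumes x: "x \<in> carrier G" and t: "t \<in> carrier G" and uv: "u \<in> V" "v \<in> V"
    and act: "\<And>w. w \<in> V \<Longrightarrow> \<rho> t w = transpose u v w" and w: "w \<in> V"
  shows "\<rho> (x \<otimes> t \<otimes> inv x) w = transpose (\<rho> x u) (\<rho> x v) w"
proof -
  let ?w = "\<rho> (inv x) w"
  have w': "?w \<in> V" using x w by (simp add: \<rho>_closed)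
  have "\<rho> (x \<otimes> t \<otimes> inv x) w = \<rho> x (transpose u v ?w)"
    using x t w w' by (simp add: \<rho>_mult act \<rho>_closed)
  also have "\<dots> = transpose (\<rho> x u) (\<rho> x v) (\<rho> x ?w)" by (rule \<rho>_transpose[OF x uv w'])
  finally show ?thesis using \<rho>_inv'[OF x w] by simp
qed

lemma swap_act:
  assumes g: "\<And>k. k \<in> {2..n} \<Longrightarrow> g k \<in> carrier G"
    and act: "\<And>k. k \<in> {2..n} \<Longrightarrow> \<rho> (g k) = houghton_gen n k" and v: "v \<in> V"
  shows "\<rho> (houghton_swap G g) v = transpose Centre (Ray 1 1) v"
proof -
  have k: "2 \<in> {2..n}" "3 \<in> {2..n}" using n3 by auto
  note gc = g[OF k(1)] g[OF k(2)]
  define w where "w = \<rho> (inv (g 2)) (\<rho> (inv (g 3)) v)"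
  have w: "w \<in> V" using v gc by (simp add: w_def \<rho>_closed)
  have "houghton_gen n 3 (houghton_gen n 2 w) = v"
    using v gc by (simp add: w_def act[OF k(1), symmetric] act[OF k(2), symmetric] \<rho>_closed \<rho>_inv')
  moreover have "\<rho> (houghton_swap G g) v = houghton_gen n 2 (houghton_gen n 3 w)"
    using v gc by (simp add: houghton_swap_def \<rho>_mult \<rho>_closed w_def act[OF k(1), symmetric] act[OF k(2), symmetric])
  moreover have "houghton_gen n 2 (houghton_gen n 3 w) =
      transpose Centre (Ray 1 1) (houghton_gen n 3 (houghton_gen n 2 w))"
    by (rule houghton_gens_commute_up_to_swap) (use k w in auto)
  ultimately show ?thesis by simp
qed

text \<open>Conjugation turns a transposition of two points into the transposition of their images, which identifies
  \<open>b\<close> and \<open>f\<close>; after that each relation is checked pointwise.\<close>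

lemma houghton_relations_act:
  assumes g: "\<And>k. k \<in> {2..n} \<Longrightarrow> g k \<in> carrier G"
    and act: "\<And>k. k \<in> {2..n} \<Longrightarrow> \<rho> (g k) = houghton_gen n k"
    and lr: "(l, r) \<in> houghton_relations G g n" and v: "v \<in> V"
  shows "\<rho> l v = \<rho> r v"
proof -
  have k: "2 \<in> {2..n}" "3 \<in> {2..n}" using n3 by auto
  note gc = g[OF k(1)] g[OF k(2)] and ga = act[OF k(1)] act[OF k(2)]
  have R: "Ray 1 1 \<in> V" "Ray 1 2 \<in> V" "Ray 2 1 \<in> V" "Ray 2 2 \<in> V" using n3 by auto
  define a where "a = houghton_swap G g"
  define b where "b = g 2 \<otimes> a \<otimes> inv (g 2)"
  define d where "d = inv (g 2) \<otimes> a \<otimes> g 2"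
  define f where "f = inv (g 2) \<otimes> d \<otimes> g 2"
  have cl: "a \<in> carrier G" "b \<in> carrier G" "d \<in> carrier G" "f \<in> carrier G"
    using houghton_swap_closed[OF n3 g] gc by (simp_all add: a_def b_def d_def f_def)
  have gv: "houghton_gen n 2 (Ray 2 1) = Centre" "houghton_gen n 2 Centre = Ray 1 1" "houghton_gen n 2 (Ray 2 2) = Ray 2 1"
    "\<And>i. houghton_gen n i (Ray 1 1) = Ray 1 2"
    using n3 by (simp_all add: houghton_gen_def)
  have pre: "\<rho> (inv (g 2)) Centre = Ray 2 1" "\<rho> (inv (g 2)) (Ray 1 1) = Centre" "\<rho> (inv (g 2)) (Ray 2 1) = Ray 2 2"
    using \<rho>_inv[OF gc(1) R(3)] \<rho>_inv[OF gc(1) Centre_in] \<rho>_inv[OF gc(1) R(4)] by (simp_all only: ga gv)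
  have aa: "\<rho> a w = transpose Centre (Ray 1 1) w" if "w \<in> V" for w
    unfolding a_def by (rule swap_act[OF g act that])
  have ba: "\<rho> b w = transpose (Ray 1 1) (Ray 1 2) w" if w: "w \<in> V" for w
    using conjugate_transposition_act[OF gc(1) cl(1) Centre_in R(1) aa w] by (simp only: b_def ga gv)
  have da: "\<rho> d w = transpose (Ray 2 1) Centre w" if w: "w \<in> V" for w
    using conjugate_transposition_act[OF inv_closed[OF gc(1)] cl(1) Centre_in R(1) aa w] by (simp only: d_def pre inv_inv[OF gc(1)])
  have fa: "\<rho> f w = transpose (Ray 2 2) (Ray 2 1) w" if w: "w \<in> V" for w
    using conjugate_transposition_act[OF inv_closed[OF gc(1)] cl(3) R(3) Centre_in da w] by (simp only: f_def pre inv_inv[OF gc(1)])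
  have tc: "transpose u u' w \<in> V" if "u \<in> V" "u' \<in> V" "w \<in> V" for u u' w
    using that by (simp add: transpose_def)
  from lr[unfolded houghton_relations_def Let_def a_def[symmetric] b_def[symmetric] d_def[symmetric] f_def[symmetric]
      Un_iff insert_iff empty_iff image_iff Bex_def split_paired_Ex prod.case prod.inject mem_Collect_eq]
  show ?thesis
  proof (elim disjE conjE exE)
    assume "l = a \<otimes> a" "r = \<one>"
    then show ?thesis using v cl R tc \<rho>_one by (simp add: \<rho>_mult aa)
  next
    assume False
    then show ?thesis ..
  next
    assume e: "l = a \<otimes> b \<otimes> a" "r = b \<otimes> a \<otimes> b"
    have "\<rho> l v = transpose Centre (Ray 1 1) (transpose (Ray 1 1) (Ray 1 2) (transpose Centre (Ray 1 1) v))"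
      using v cl R tc e(1) by (simp add: \<rho>_mult aa ba)
    moreover have "\<rho> r v = transpose (Ray 1 1) (Ray 1 2) (transpose Centre (Ray 1 1) (transpose (Ray 1 1) (Ray 1 2) v))"
      using v cl R tc e(2) by (simp add: \<rho>_mult aa ba)
    ultimately show ?thesis by (simp add: transpose_def)
  next
    assume e: "l = f \<otimes> a" "r = a \<otimes> f"
    have "\<rho> l v = transpose (Ray 2 2) (Ray 2 1) (transpose Centre (Ray 1 1) v)"
      using v cl R tc e(1) by (simp add: \<rho>_mult aa fa)
    moreover have "\<rho> r v = transpose Centre (Ray 1 1) (transpose (Ray 2 2) (Ray 2 1) v)"
      using v cl R tc e(2) by (simp add: \<rho>_mult aa fa)
    ultimately show ?thesis by (simp add: transpose_def)
  next
    assume e: "l = f \<otimes> g 3" "r = g 3 \<otimes> f"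
    have "\<rho> (g 3) (transpose (Ray 2 2) (Ray 2 1) v) = transpose (Ray 2 2) (Ray 2 1) (\<rho> (g 3) v)"
      using \<rho>_transpose[OF gc(2) R(4) R(3) v] n3 by (simp add: ga)
    then show ?thesis using v cl gc e by (simp add: \<rho>_mult \<rho>_closed fa)
  next
    fix i assume i: "i \<in> {2..n}" and e: "l = g i \<otimes> a" "r = b \<otimes> g i"
    have "\<rho> (g i) (transpose Centre (Ray 1 1) v) = transpose (Ray 1 1) (Ray 1 2) (\<rho> (g i) v)"
      using \<rho>_transpose[OF g[OF i] Centre_in R(1) v] by (simp only: act[OF i] gv houghton_gen_simps(1))
    then show ?thesis using v cl g[OF i] e by (simp add: \<rho>_mult \<rho>_closed aa ba)
  next
    fix i j assume ij: "i \<in> {2..n}" "j \<in> {2..n}" "i \<noteq> j" and e: "l = g i \<otimes> g j" "r = a \<otimes> (g j \<otimes> g i)"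
    note gij = g[OF ij(1)] g[OF ij(2)]
    have "\<rho> l v = houghton_gen n i (houghton_gen n j v)"
      using v gij e by (simp add: \<rho>_mult act[OF ij(1)] act[OF ij(2)])
    moreover have "\<rho> r v = transpose Centre (Ray 1 1) (\<rho> (g j) (\<rho> (g i) v))"
      using v gij e cl by (simp add: \<rho>_mult aa \<rho>_closed)
    ultimately show ?thesis
      using houghton_gens_commute_up_to_swap[OF ij v] by (simp only: act[OF ij(1)] act[OF ij(2)])
  qed
qed

text \<open>An element that moves the centre of a (possibly shifted) star to \<open>v\<close>: go outwards along the first ray
  by \<open>q 2\<close>, and along the other rays by the inverses of their own generators.\<close>

definition transversal :: "(nat \<Rightarrow> 'a) \<Rightarrow> star_vertex \<Rightarrow> 'a" where
  "transversal q v = (case v of Centre \<Rightarrow> \<one>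
     | Ray i m \<Rightarrow> if i = 1 then q 2 [^] m else inv (q i [^] m))"

lemma transversal_act:
  assumes q: "\<And>k. k \<in> {2..n} \<Longrightarrow> q k \<in> carrier G"
    and \<tau>: "\<And>v. v \<in> V \<Longrightarrow> \<tau> v \<in> V"
    and act: "\<And>k v. k \<in> {2..n} \<Longrightarrow> v \<in> V \<Longrightarrow> \<rho> (q k) (\<tau> v) = \<tau> (houghton_gen n k v)"
    and v: "v \<in> V"
  shows "transversal q v \<in> carrier G" "\<rho> (transversal q v) (\<tau> Centre) = \<tau> v"
proof -
  have n2: "2 \<in> {2..n}" using n3 by simp
  have c: "transversal q v \<in> carrier G \<and> \<rho> (transversal q v) (\<tau> Centre) = \<tau> v"
    using v
  proof (cases rule: star_vertices_cases)
    case Centre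
    then show ?thesis using \<rho>_one[OF \<tau>] by (simp add: transversal_def)
  next
    case (First m)
    have "\<rho> (q 2 [^] Suc l) (\<tau> Centre) = \<tau> (Ray 1 (Suc l))" for l
    proof (induction l)
      case 0
      then show ?case using act[OF n2, of Centre] q[OF n2] by simp
    next
      case (Suc l)
      have "\<rho> (q 2 [^] Suc (Suc l)) (\<tau> Centre) = \<rho> (q 2 \<otimes> q 2 [^] Suc l) (\<tau> Centre)"
        using q[OF n2] by (simp only: nat_pow_Suc2)
      also have "\<dots> = \<tau> (Ray 1 (Suc (Suc l)))"
        using Suc q[OF n2] n3 \<tau> act[OF n2, of "Ray 1 (Suc l)"] by (simp add: \<rho>_mult del: nat_pow_Suc)
      finally show ?case .
    qed
    from this[of "m - 1"] show ?thesis using First q[OF n2] by (simp add: transversal_def)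
  next
    case (Other i m)
    have i: "i \<in> {2..n}" using Other by simp
    have "\<rho> (q i [^] Suc l) (\<tau> (Ray i (Suc l))) = \<tau> Centre" for l
    proof (induction l)
      case 0
      then show ?case using act[OF i, of "Ray i 1"] q[OF i] Other by simp
    next
      case (Suc l)
      have "\<rho> (q i [^] Suc (Suc l)) (\<tau> (Ray i (Suc (Suc l)))) = \<rho> (q i [^] Suc l) (\<rho> (q i) (\<tau> (Ray i (Suc (Suc l)))))"
        using q[OF i] \<tau> Other by (subst nat_pow_Suc, subst \<rho>_mult) auto
      also have "\<dots> = \<tau> Centre"
        using Suc act[OF i, of "Ray i (Suc (Suc l))"] Other by simp
      finally show ?case .
    qed
    from this[of "m - 1"] have "\<rho> (q i [^] m) (\<tau> v) = \<tau> Centre" using Other by simp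
    then have "\<rho> (inv (q i [^] m)) (\<tau> Centre) = \<tau> v"
      using \<rho>_inv[of "q i [^] m" "\<tau> v"] q[OF i] \<tau>[OF v] by simp
    then show ?thesis using Other q[OF i] by (simp add: transversal_def)
  qed
  then show "transversal q v \<in> carrier G" "\<rho> (transversal q v) (\<tau> Centre) = \<tau> v" by auto
qed

text \<open>Schreier's method for the point stabiliser: if the subgroup \<open>S\<close> contains all elements
  \<open>\<gamma> (q v)\<inverse> q \<gamma> v\<close> for generators \<open>q\<close> and the transversal \<open>\<gamma>\<close> above, then it contains the
  stabiliser. The relation \<open>q i q j = z q j q i\<close> expresses these infinitely many elements by conjugates of
  \<open>z\<close>. The map \<open>\<tau>\<close> embeds the star; it is the identity for the stabiliser of the centre
  and \<open>shift_star\<close> for the stabiliser of two points.\<close>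

lemma star_schreier:
  assumes q: "\<And>k. k \<in> {2..n} \<Longrightarrow> q k \<in> carrier G" and z: "z \<in> carrier G"
    and \<tau>: "\<And>v. v \<in> V \<Longrightarrow> \<tau> v \<in> V" "\<And>v w. v \<in> V \<Longrightarrow> w \<in> V \<Longrightarrow> \<tau> v = \<tau> w \<Longrightarrow> v = w"
    and act: "\<And>k v. k \<in> {2..n} \<Longrightarrow> v \<in> V \<Longrightarrow> \<rho> (q k) (\<tau> v) = \<tau> (houghton_gen n k v)"
    and comm: "\<And>i j. i \<in> {2..n} \<Longrightarrow> j \<in> {2..n} \<Longrightarrow> i \<noteq> j \<Longrightarrow> q i \<otimes> q j = z \<otimes> (q j \<otimes> q i)"
    and S: "subgroup S G"
    and S1: "\<And>k. k \<in> {2..n} \<Longrightarrow> inv (q 2) \<otimes> q k \<in> S"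
    and S2: "\<And>k. k \<in> {2..n} \<Longrightarrow> z \<otimes> q k \<in> S"
    and S3: "\<And>m. 2 \<le> m \<Longrightarrow> conj_by (inv (q 2 [^] (m::nat))) z \<in> S"
    and S4: "\<And>i m. i \<in> {2..n} \<Longrightarrow> 1 \<le> m \<Longrightarrow> conj_by (q i [^] (m::nat)) z \<in> S"
    and x: "x \<in> generate G (q ` {2..n})" "\<rho> x (\<tau> Centre) = \<tau> Centre"
  shows "x \<in> S"
proof -
  let ?\<gamma> = "transversal q"
  have n2: "2 \<in> {2..n}" using n3 by simp
  note Sone = subgroup.one_closed[OF S] and Smult = subgroup.m_closed[OF S] and Sinv = subgroup.m_inv_closed[OF S]
  have \<gamma>c: "?\<gamma> v \<in> carrier G" if "v \<in> V" for v
    by (rule transversal_act(1)[OF q \<tau>(1) act that])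
  have up: "inv (q 2 [^] Suc m) \<otimes> q k \<otimes> q 2 [^] m \<in> S" if k: "k \<in> {2..n}" for k m
  proof (induction m)
    case 0
    then show ?case using S1[OF k] q[OF k] q[OF n2] by simp
  next
    case (Suc m)
    show ?case
    proof (cases "k = 2")
      case True
      have "inv (q 2 [^] Suc (Suc m)) \<otimes> (q 2 \<otimes> q 2 [^] Suc m) = \<one>"
        unfolding nat_pow_Suc2[OF q[OF n2], of "Suc m", symmetric] using q[OF n2] by (simp del: nat_pow_Suc)
      then show ?thesis using True q[OF n2] Sone by (simp add: m_assoc del: nat_pow_Suc)
    next
      case False
      define A where "A = q 2 [^] m"
      define B where "B = q 2 [^] Suc (Suc m)"
      have cl: "A \<in> carrier G" "B \<in> carrier G" "q 2 \<in> carrier G" "q k \<in> carrier G" "z \<in> carrier G"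
        using q[OF n2] q[OF k] z by (simp_all add: A_def B_def)
      have "inv B \<otimes> q k \<otimes> q 2 [^] Suc m = inv B \<otimes> (q k \<otimes> q 2) \<otimes> A"
        unfolding nat_pow_Suc2[OF q[OF n2]] using cl by (simp add: A_def m_assoc)
      also have "\<dots> = inv B \<otimes> (z \<otimes> (q 2 \<otimes> q k)) \<otimes> A" using comm[OF k n2 False] by simp
      also have "\<dots> = (inv B \<otimes> z \<otimes> B) \<otimes> (inv B \<otimes> (q 2 \<otimes> (q k \<otimes> A)))"
        using cl by (simp add: m_assoc) (simp add: m_assoc[symmetric])
      also have "inv B \<otimes> (q 2 \<otimes> (q k \<otimes> A)) = inv (q 2 [^] Suc m) \<otimes> q k \<otimes> A"
      proof -
        have "inv B = inv (q 2 [^] Suc m) \<otimes> inv (q 2)"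
          unfolding B_def nat_pow_Suc2[OF q[OF n2], of "Suc m"] using q[OF n2] by (simp add: inv_mult_group)
        then show ?thesis using cl q[OF n2] by (simp add: m_assoc inv_solve_left' del: nat_pow_Suc)
      qed
      also have "inv B \<otimes> z \<otimes> B = conj_by (inv B) z" using cl by (simp add: conj_by_def)
      finally have "inv B \<otimes> q k \<otimes> q 2 [^] Suc m = conj_by (inv B) z \<otimes> (inv (q 2 [^] Suc m) \<otimes> q k \<otimes> A)" .
      then show ?thesis using Suc.IH S3[of "Suc (Suc m)"] Smult unfolding A_def B_def by simp
    qed
  qed
  have side: "q i [^] m \<otimes> q k \<otimes> inv (q i [^] m) \<in> S" if i: "i \<in> {2..n}" and k: "k \<in> {2..n}" and ik: "i \<noteq> k" and m: "1 \<le> m" for i k and m :: nat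
    using m
  proof (induction m rule: dec_induct)
    case base
    have "q i \<otimes> q k \<otimes> inv (q i) = z \<otimes> q k"
      using comm[OF i k ik] q[OF i] q[OF k] z by (simp add: m_assoc inv_solve_right')
    then show ?case using S2[OF k] q[OF i] by simp
  next
    case (step m)
    define A where "A = q i [^] m"
    have cl: "A \<in> carrier G" "q i \<in> carrier G" "q k \<in> carrier G" "z \<in> carrier G"
      using q[OF i] q[OF k] z by (simp_all add: A_def)
    have "q i [^] Suc m \<otimes> q k \<otimes> inv (q i [^] Suc m) = A \<otimes> (q i \<otimes> q k) \<otimes> inv (q i) \<otimes> inv A"
      using cl by (simp add: A_def[symmetric] inv_mult_group m_assoc)
    also have "\<dots> = A \<otimes> (z \<otimes> (q k \<otimes> q i)) \<otimes> inv (q i) \<otimes> inv A" using comm[OF i k ik] by simp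
    also have "\<dots> = A \<otimes> z \<otimes> q k \<otimes> inv A" using cl by (simp add: m_assoc)
    also have "\<dots> = conj_by A z \<otimes> (A \<otimes> q k \<otimes> inv A)"
      using cl by (simp add: conj_by_def m_assoc) (simp add: m_assoc[symmetric])
    finally show ?case using step.IH S4[OF i step.hyps(1)] Smult unfolding A_def by simp
  qed
  have gen: "inv (?\<gamma> (houghton_gen n k v)) \<otimes> q k \<otimes> ?\<gamma> v \<in> S" if k: "k \<in> {2..n}" and v: "v \<in> V" for k v
    using v
  proof (cases rule: star_vertices_cases)
    case Centre
    then show ?thesis using up[OF k, of 0] q[OF k] q[OF n2] by (simp add: transversal_def)
  next
    case (First m)
    then show ?thesis using up[OF k, of m] n3 by (simp add: transversal_def)
  next
    case (Other i m)
    then obtain m' where m: "m = Suc m'" by (cases m) auto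
    show ?thesis
    proof (cases "i = k")
      case True
      show ?thesis
      proof (cases m')
        case 0
        then show ?thesis using True Other m q[OF k] Sone by (simp add: transversal_def)
      next
        case (Suc m'')
        have "q k [^] m' \<otimes> q k \<otimes> inv (q k [^] Suc m') = \<one>" using q[OF k] by simp
        then show ?thesis using True Other m Suc q[OF k] Sone by (simp add: transversal_def del: nat_pow_Suc)
      qed
    next
      case False
      have i: "i \<in> {2..n}" using Other by simp
      then show ?thesis using side[OF i k False Other(4)] False Other q[OF i] by (simp add: transversal_def)
    qed
  qed
  have "x \<in> carrier G \<and> (\<forall>v\<in>V. \<exists>v'\<in>V. \<rho> x (\<tau> v) = \<tau> v' \<and> inv (?\<gamma> v') \<otimes> x \<otimes> ?\<gamma> v \<in> S)"
    if "x \<in> generate G (q ` {2..n})" for x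
    using that
  proof (induction x rule: generate.induct)
    case one
    then show ?case using \<rho>_one \<tau>(1) \<gamma>c Sone by (auto intro!: bexI)
  next
    case (incl h)
    then obtain k where "k \<in> {2..n}" "h = q k" by blast
    then show ?case using q act gen houghton_gen_closed by blast
  next
    case (inv h)
    then obtain k where k: "k \<in> {2..n}" and h: "h = q k" by blast
    have qk: "q k \<in> carrier G" by (rule q[OF k])
    have "\<exists>v'\<in>V. \<rho> (inv (q k)) (\<tau> v) = \<tau> v' \<and> inv (?\<gamma> v') \<otimes> inv (q k) \<otimes> ?\<gamma> v \<in> S" if v: "v \<in> V" for v
    proof -
      have "v \<in> houghton_gen n k ` V"
        using houghton_gen_Bij[OF k] v by (simp add: Bij_def bij_betw_def)
      then obtain w where w: "w \<in> V" "houghton_gen n k w = v" by blast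
      have "\<rho> (inv (q k)) (\<tau> v) = \<tau> w" using act[OF k w(1)] w(2) \<rho>_inv[OF qk \<tau>(1)[OF w(1)]] by simp
      moreover have "inv (?\<gamma> w) \<otimes> inv (q k) \<otimes> ?\<gamma> v = inv (inv (?\<gamma> v) \<otimes> q k \<otimes> ?\<gamma> w)"
        using \<gamma>c[OF w(1)] \<gamma>c[OF v] qk by (simp add: inv_mult_group m_assoc)
      moreover have "inv (inv (?\<gamma> v) \<otimes> q k \<otimes> ?\<gamma> w) \<in> S" using gen[OF k w(1)] w(2) Sinv by simp
      ultimately show ?thesis using w(1) by metis
    qed
    then show ?case using qk h by blast
  next
    case (eng h1 h2)
    have "\<exists>v'\<in>V. \<rho> (h1 \<otimes> h2) (\<tau> v) = \<tau> v' \<and> inv (?\<gamma> v') \<otimes> (h1 \<otimes> h2) \<otimes> ?\<gamma> v \<in> S" if v: "v \<in> V" for v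
    proof -
      obtain v2 where v2: "v2 \<in> V" "\<rho> h2 (\<tau> v) = \<tau> v2" "inv (?\<gamma> v2) \<otimes> h2 \<otimes> ?\<gamma> v \<in> S" using eng.IH(2) v by blast
      obtain v1 where v1: "v1 \<in> V" "\<rho> h1 (\<tau> v2) = \<tau> v1" "inv (?\<gamma> v1) \<otimes> h1 \<otimes> ?\<gamma> v2 \<in> S" using eng.IH(1) v2(1) by blast
      have h: "h1 \<in> carrier G" "h2 \<in> carrier G" using eng.IH by auto
      have "inv (?\<gamma> v1) \<otimes> (h1 \<otimes> h2) \<otimes> ?\<gamma> v = (inv (?\<gamma> v1) \<otimes> h1) \<otimes> (?\<gamma> v2 \<otimes> inv (?\<gamma> v2)) \<otimes> (h2 \<otimes> ?\<gamma> v)"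
        using h \<gamma>c[OF v] \<gamma>c[OF v1(1)] \<gamma>c[OF v2(1)] by (simp add: m_assoc)
      also have "\<dots> = (inv (?\<gamma> v1) \<otimes> h1 \<otimes> ?\<gamma> v2) \<otimes> (inv (?\<gamma> v2) \<otimes> h2 \<otimes> ?\<gamma> v)"
        using h \<gamma>c[OF v] \<gamma>c[OF v1(1)] \<gamma>c[OF v2(1)] by (simp only: m_assoc m_closed inv_closed)
      finally have "inv (?\<gamma> v1) \<otimes> (h1 \<otimes> h2) \<otimes> ?\<gamma> v \<in> S" using Smult[OF v1(3) v2(3)] by simp
      moreover have "\<rho> (h1 \<otimes> h2) (\<tau> v) = \<tau> v1" using h v1 v2 \<tau>(1)[OF v] by (simp add: \<rho>_mult)
      ultimately show ?thesis using v1(1) by blast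
    qed
    then show ?case using eng.IH by blast
  qed
  from this[OF x(1)] obtain v' where v': "x \<in> carrier G" "v' \<in> V" "\<rho> x (\<tau> Centre) = \<tau> v'" "inv (?\<gamma> v') \<otimes> x \<otimes> ?\<gamma> Centre \<in> S"
    using Centre_in by blast
  then have "v' = Centre" using x(2) \<tau>(2)[of v' Centre] by simp
  then show ?thesis using v'(1,4) by (simp add: transversal_def)
qed

end

section \<open>Stabilisers in groups with the Houghton relations\<close>

text \<open>A group that satisfies the relations of the Houghton group and acts on the star like it. The aim is that
  this action is faithful.\<close>

locale houghton_presented = group_acting_on_star +
  fixes g :: "nat \<Rightarrow> 'a"
  assumes g_closed: "\<And>k. k \<in> {2..n} \<Longrightarrow> g k \<in> carrier G"
    and generated: "carrier G = generate G (g ` {2..n})"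
    and \<rho>_g: "\<And>k. k \<in> {2..n} \<Longrightarrow> \<rho> (g k) = houghton_gen n k"
    and relations: "\<And>l r. (l, r) \<in> houghton_relations G g n \<Longrightarrow> l = r"
begin

abbreviation "a \<equiv> houghton_swap G g"

text \<open>\<open>s m\<close> and \<open>e m\<close> act as the transpositions of neighbours on the first and on the second ray, and \<open>h k\<close> acts
  like the \<open>k\<close>-th generator on the star without its centre.\<close>

definition "s m = conj_by (g 2 [^] (m::nat)) a"
definition "e m = conj_by (inv (g 2 [^] (m::nat))) a"
definition "h k = a \<otimes> g k"

lemma g23 [simp]: "g 2 \<in> carrier G" "g 3 \<in> carrier G"
  using g_closed n3 by auto

lemma a_closed [simp]: "a \<in> carrier G"
  using houghton_swap_closed n3 g_closed by blast

lemma s_closed [simp]: "s m \<in> carrier G" and e_closed [simp]: "e m \<in> carrier G"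
  by (simp_all add: s_def e_def)

lemma s_0: "s 0 = a"
  by (simp add: s_def)

lemma s_Suc: "s (Suc m) = conj_by (g 2) (s m)"
  unfolding s_def nat_pow_Suc2[OF g23(1)] by (simp add: conj_by_comp)

lemma e_0: "e 0 = a"
  by (simp add: e_def)

lemma e_Suc: "e (Suc m) = conj_by (inv (g 2)) (e m)"
proof -
  have "inv (g 2 [^] Suc m) = inv (g 2) \<otimes> inv (g 2 [^] m)" by (simp add: inv_mult_group)
  then show ?thesis unfolding e_def by (simp add: conj_by_comp del: nat_pow_Suc)
qed

lemma rel_a: "a \<otimes> a = \<one>"
  by (rule relations) (simp add: houghton_relations_def Let_def)

lemma rel_braid: "a \<otimes> s 1 \<otimes> a = s 1 \<otimes> a \<otimes> s 1"
  by (rule relations) (simp add: houghton_relations_def Let_def s_def conj_by_def)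

lemma e_2: "e 2 = conj_by (inv (g 2)) (conj_by (inv (g 2)) a)"
  using e_Suc[of "Suc 0"] e_Suc[of 0] by (simp only: numeral_2_eq_2[symmetric] e_0)

lemma e2_eq: "e 2 = inv (g 2) \<otimes> (inv (g 2) \<otimes> a \<otimes> g 2) \<otimes> g 2"
  unfolding e_2 by (simp add: conj_by_def)

lemma rel_e2_a: "e 2 \<otimes> a = a \<otimes> e 2"
  unfolding e2_eq by (rule relations) (simp add: houghton_relations_def Let_def)

lemma rel_e2_g3: "e 2 \<otimes> g 3 = g 3 \<otimes> e 2"
  unfolding e2_eq by (rule relations) (simp add: houghton_relations_def Let_def)

lemma rel_g_a: "k \<in> {2..n} \<Longrightarrow> conj_by (g k) a = s 1"
proof -
  assume k: "k \<in> {2..n}"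
  have "g k \<otimes> a = s 1 \<otimes> g k"
    using k by (intro relations) (auto simp: houghton_relations_def Let_def s_def conj_by_def)
  then show ?thesis using k g_closed by (simp add: conj_by_def inv_solve_right')
qed

lemma rel_g_g: "i \<in> {2..n} \<Longrightarrow> j \<in> {2..n} \<Longrightarrow> i \<noteq> j \<Longrightarrow> g i \<otimes> g j = a \<otimes> (g j \<otimes> g i)"
  by (rule relations) (auto simp: houghton_relations_def Let_def)

lemma inv_a: "inv a = a"
  using rel_a by (simp add: inv_equality)

lemma a_cancel [simp]: "x \<in> carrier G \<Longrightarrow> a \<otimes> (a \<otimes> x) = x"
  by (simp add: m_assoc[symmetric] rel_a)

lemma h_closed: "k \<in> {2..n} \<Longrightarrow> h k \<in> carrier G"
  by (simp add: h_def g_closed)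

lemma conj_fix: "x \<in> carrier G \<Longrightarrow> y \<in> carrier G \<Longrightarrow> x \<otimes> y = y \<otimes> x \<Longrightarrow> conj_by x y = y"
  by (simp add: conj_by_eq_iff)

text \<open>The generators move the transpositions \<open>s m\<close> of neighbours on the first ray uniformly, and
  distant ones commute. The two statements are proved together: \<open>e 2\<close>, supported on the second ray,
  commutes with \<open>g 3\<close> and hence with all \<open>s m\<close>, and conjugation by \<open>g 2\<close> turns this into
  commutation of \<open>a\<close> with \<open>s (m + 2)\<close>.\<close>

lemma s_shift_and_commute: "(\<forall>k\<in>{2..n}. conj_by (g k) (s m) = s (Suc m)) \<and> e 2 \<otimes> s m = s m \<otimes> e 2"
proof (induction m)
  case 0
  show ?case using rel_g_a rel_e2_a by (simp add: s_0)
next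
  case (Suc m)
  have k3: "3 \<in> {2..n}" using n3 by simp
  have "conj_by (e 2) (s (Suc m)) = conj_by (e 2 \<otimes> g 3) (s m)"
    using Suc k3 by (simp add: conj_by_comp[symmetric])
  also have "\<dots> = conj_by (g 3) (conj_by (e 2) (s m))" by (simp add: rel_e2_g3 conj_by_comp)
  also have "\<dots> = s (Suc m)" using Suc k3 by (simp add: conj_fix)
  finally have e2: "e 2 \<otimes> s (Suc m) = s (Suc m) \<otimes> e 2" by (simp add: conj_by_eq_iff)
  have as: "conj_by a (s (Suc (Suc m))) = s (Suc (Suc m))"
  proof -
    have "conj_by (g 2) (conj_by (g 2) (conj_by (e 2) (s m))) = s (Suc (Suc m))"
      using Suc by (simp add: conj_fix s_Suc)
    moreover have "conj_by (g 2) (conj_by (g 2) (conj_by (e 2) (s m))) = conj_by (g 2 \<otimes> g 2 \<otimes> e 2) (s m)"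
      by (simp add: conj_by_comp m_assoc)
    moreover have "g 2 \<otimes> g 2 \<otimes> e 2 = a \<otimes> (g 2 \<otimes> g 2)"
      unfolding e2_eq by (simp add: m_assoc) (simp add: m_assoc[symmetric])
    moreover have "conj_by (a \<otimes> (g 2 \<otimes> g 2)) (s m) = conj_by a (s (Suc (Suc m)))"
      by (simp add: s_Suc conj_by_comp m_assoc)
    ultimately show ?thesis by simp
  qed
  have "conj_by (g k) (s (Suc m)) = s (Suc (Suc m))" if k: "k \<in> {2..n}" for k
  proof (cases "k = 2")
    case True
    then show ?thesis by (simp add: s_Suc)
  next
    case False
    have k2: "2 \<in> {2..n}" using n3 by simp
    have "conj_by (g k) (s (Suc m)) = conj_by (g k \<otimes> g 2) (s m)"
      using g_closed[OF k] by (simp add: s_Suc conj_by_comp)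
    also have "\<dots> = conj_by (a \<otimes> (g 2 \<otimes> g k)) (s m)" using rel_g_g[OF k k2 False] by simp
    also have "\<dots> = conj_by a (conj_by (g 2) (conj_by (g k) (s m)))"
      using g_closed[OF k] by (simp add: conj_by_comp m_assoc)
    also have "\<dots> = s (Suc (Suc m))" using Suc k as by (simp add: s_Suc[symmetric])
    finally show ?thesis .
  qed
  then show ?case using e2 by blast
qed

lemma s_shift: "k \<in> {2..n} \<Longrightarrow> conj_by (g k) (s m) = s (Suc m)"
  using s_shift_and_commute by blast

lemma a_commutes_s:
  assumes "2 \<le> m"
  shows "a \<otimes> s m = s m \<otimes> a"
proof -
  obtain l where m: "m = Suc (Suc l)" using assms by (metis Suc_le_D numeral_2_eq_2 Suc_le_mono)
  have "conj_by (g 2 \<otimes> g 2) (e 2 \<otimes> s l) = conj_by (g 2 \<otimes> g 2) (s l \<otimes> e 2)"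
    using s_shift_and_commute by simp
  moreover have "conj_by (g 2 \<otimes> g 2) (e 2) = a"
    by (subst conj_by_comp[symmetric]) (simp_all add: e_2)
  moreover have "conj_by (g 2 \<otimes> g 2) (s l) = s m" by (simp add: m s_Suc conj_by_comp)
  ultimately show ?thesis by (simp add: conj_by_mult)
qed

lemma a_commutes_e:
  assumes "2 \<le> m"
  shows "a \<otimes> e m = e m \<otimes> a"
proof -
  let ?x = "inv (g 2 [^] m)"
  have "conj_by ?x (a \<otimes> s m) = conj_by ?x (s m \<otimes> a)" using a_commutes_s[OF assms] by simp
  moreover have "conj_by ?x (s m) = a" by (simp add: s_def)
  ultimately show ?thesis by (simp add: conj_by_mult e_def[symmetric])
qed

lemma h_swap_shift:
  assumes k: "k \<in> {2..n}" and m: "1 \<le> m"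
  shows "conj_by (h k) (s m) = s (Suc m)"
proof -
  have "conj_by (h k) (s m) = conj_by a (s (Suc m))"
    using k by (simp add: h_def conj_by_comp[symmetric] g_closed s_shift)
  then show ?thesis using a_commutes_s[of "Suc m"] m by (simp add: conj_fix)
qed

lemma conj_h_power_s:
  assumes k: "k \<in> {2..n}"
  shows "conj_by (h k [^] m) (s 1) = s (Suc m)"
proof (induction m)
  case (Suc m)
  have "conj_by (h k [^] Suc m) (s 1) = conj_by (h k) (conj_by (h k [^] m) (s 1))"
    unfolding nat_pow_Suc2[OF h_closed[OF k]] using h_closed[OF k] by (simp add: conj_by_comp)
  then show ?case using Suc h_swap_shift[OF k] by simp
qed simp

lemma conj_h_inv:
  "x \<in> carrier G \<Longrightarrow> conj_by (inv (h 2)) x = conj_by (inv (g 2)) (conj_by a x)"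
  by (simp add: h_def inv_mult_group inv_a conj_by_comp)

text \<open>The braid relation makes the first two steps of this conjugation end in \<open>e 2\<close>; from then on \<open>a\<close> commutes
  with everything involved.\<close>

lemma conj_h_inv_power_s:
  assumes "2 \<le> m"
  shows "conj_by (inv (h 2 [^] m)) (s 1) = e m"
  using assms
proof (induction m rule: dec_induct)
  case base
  have h2: "h 2 \<in> carrier G" using h_closed n3 by simp
  have "conj_by (inv (h 2 [^] (2::nat))) (s 1) = conj_by (inv (h 2)) (conj_by (inv (h 2)) (s 1))"
    using h2 by (simp add: conj_by_comp numeral_2_eq_2 inv_mult_group)
  also have "conj_by (inv (h 2)) (s 1) = conj_by (inv (g 2)) (conj_by a (s 1))" by (simp add: conj_h_inv)
  also have "conj_by a (s 1) = s 1 \<otimes> a \<otimes> s 1" unfolding conj_by_def inv_a by (rule rel_braid)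
  also have "conj_by (inv (g 2)) (s 1 \<otimes> a \<otimes> s 1) = a \<otimes> e 1 \<otimes> a"
  proof -
    have "conj_by (inv (g 2)) (s 1) = a" using s_Suc[of 0] by (simp add: s_0)
    moreover have "conj_by (inv (g 2)) a = e 1" using e_Suc[of 0] by (simp add: e_0)
    ultimately show ?thesis by (simp add: conj_by_mult)
  qed
  also have "conj_by (inv (h 2)) (a \<otimes> e 1 \<otimes> a) = conj_by (inv (g 2)) (e 1)"
  proof -
    have "conj_by a (a \<otimes> e 1 \<otimes> a) = e 1"
      unfolding conj_by_def inv_a by (simp add: m_assoc rel_a)
    then show ?thesis by (simp add: conj_h_inv)
  qed
  also have "\<dots> = e 2" using e_Suc[of 1] by (simp add: numeral_2_eq_2)
  finally show ?case .
next
  case (step m)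
  have h2: "h 2 \<in> carrier G" using h_closed n3 by simp
  have "conj_by (inv (h 2 [^] Suc m)) (s 1) = conj_by (inv (h 2)) (conj_by (inv (h 2 [^] m)) (s 1))"
    using h2 by (simp add: conj_by_comp inv_mult_group)
  also have "\<dots> = conj_by (inv (g 2)) (conj_by a (e m))" using step by (simp add: conj_h_inv)
  also have "\<dots> = e (Suc m)" using a_commutes_e step by (simp add: conj_fix e_Suc)
  finally show ?case .
qed

text \<open>The elements \<open>h k\<close> satisfy the same commutation rule as the generators, with \<open>s 1\<close> in the place of \<open>a\<close>.\<close>

lemma h_commutator:
  assumes "i \<in> {2..n}" "j \<in> {2..n}" "i \<noteq> j"
  shows "h i \<otimes> h j = s 1 \<otimes> (h j \<otimes> h i)"
proof -
  have gi: "g i \<in> carrier G" "g j \<in> carrier G" using assms g_closed by auto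
  have c: "g i \<otimes> a = s 1 \<otimes> g i" "g j \<otimes> a = s 1 \<otimes> g j"
    using rel_g_a[OF assms(1)] rel_g_a[OF assms(2)] conj_by_move[OF gi(1) a_closed] conj_by_move[OF gi(2) a_closed] by simp_all
  have "h i \<otimes> h j = a \<otimes> (g i \<otimes> a) \<otimes> g j" unfolding h_def using gi by (simp add: m_assoc)
  also have "\<dots> = a \<otimes> s 1 \<otimes> (g i \<otimes> g j)" unfolding c using gi by (simp add: m_assoc)
  also have "\<dots> = (a \<otimes> s 1 \<otimes> a) \<otimes> (g j \<otimes> g i)" unfolding rel_g_g[OF assms] using gi by (simp add: m_assoc)
  also have "\<dots> = s 1 \<otimes> (a \<otimes> (s 1 \<otimes> g j) \<otimes> g i)" unfolding rel_braid using gi by (simp add: m_assoc)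
  also have "\<dots> = s 1 \<otimes> (h j \<otimes> h i)" unfolding c(2)[symmetric] h_def using gi by (simp add: m_assoc)
  finally show ?thesis .
qed

lemma h_inv_h:
  assumes "k \<in> {2..n}"
  shows "inv (h 2) \<otimes> h k = inv (g 2) \<otimes> g k"
  using assms g_closed by (simp add: h_def inv_mult_group inv_a m_assoc)

lemma \<rho>_a: "v \<in> V \<Longrightarrow> \<rho> a v = transpose Centre (Ray 1 1) v"
  by (rule swap_act[OF g_closed \<rho>_g])

lemma \<rho>_h_shift:
  assumes "k \<in> {2..n}" "v \<in> V"
  shows "\<rho> (h k) (shift_star v) = shift_star (houghton_gen n k v)"
proof -
  have v: "shift_star v \<in> V" using shift_star_closed assms n3 by simp
  have "\<rho> (h k) (shift_star v) = transpose Centre (Ray 1 1) (houghton_gen n k (shift_star v))"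
    using v assms by (simp add: h_def \<rho>_mult g_closed \<rho>_g \<rho>_a houghton_gen_closed)
  then show ?thesis using swap_houghton_gen_shift[OF assms] by simp
qed

lemma h_generate_subgroup: "subgroup (generate G (h ` {2..n})) G"
  by (rule generate_is_subgroup) (use h_closed in auto)

lemma h_in: "k \<in> {2..n} \<Longrightarrow> h k \<in> generate G (h ` {2..n})"
  by (intro generate.incl) simp

text \<open>The elements \<open>h k = a g k\<close> fix the centre, and they generate its stabiliser.\<close>

lemma stabiliser_of_centre:
  assumes "x \<in> carrier G" "\<rho> x Centre = Centre"
  shows "x \<in> generate G (h ` {2..n})"
proof (rule star_schreier[where q = g and z = a and \<tau> = "\<lambda>v. v"])
  let ?S = "generate G (h ` {2..n})"
  note Sm = subgroup.m_closed[OF h_generate_subgroup] and Si = subgroup.m_inv_closed[OF h_generate_subgroup]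
  have k23: "2 \<in> {2..n}" "3 \<in> {2..n}" using n3 by auto
  have h_inv_pow: "conj_by (h 2) y \<in> ?S" "conj_by (inv (h 2)) y \<in> ?S" if "y \<in> ?S" for y
  proof -
    have "inv (inv (h 2)) \<in> ?S" using Si[OF Si[OF h_in[OF k23(1)]]] .
    then show "conj_by (h 2) y \<in> ?S" "conj_by (inv (h 2)) y \<in> ?S"
      unfolding conj_by_def using that Sm Si h_in[OF k23(1)] by blast+
  qed
  have s1: "s 1 \<in> ?S"
  proof -
    have "s 1 = h 2 \<otimes> h 3 \<otimes> inv (h 3 \<otimes> h 2)"
      using h_commutator[OF k23] h_closed k23 by (simp add: inv_solve_right)
    then show ?thesis using h_in k23 Sm Si by metis
  qed
  have sS: "s m \<in> ?S" if "1 \<le> m" for m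
    using that
  proof (induction m rule: dec_induct)
    case (step m)
    then show ?case using h_inv_pow(1)[OF step.IH] h_swap_shift[OF k23(1)] by simp
  qed (rule s1)
  have eS: "e m \<in> ?S" if "2 \<le> m" for m
    using that
  proof (induction m rule: dec_induct)
    case base
    have "e 2 = conj_by (inv (h 2)) (conj_by (inv (h 2)) (s 1))"
      using conj_h_inv_power_s[of 2] h_closed[OF k23(1)]
      by (simp add: conj_by_comp numeral_2_eq_2 inv_mult_group)
    then show ?case using h_inv_pow(2) s1 by simp
  next
    case (step m)
    have "e (Suc m) = conj_by (inv (h 2)) (e m)"
      using a_commutes_e[OF step.hyps(1)] by (simp add: conj_h_inv conj_fix e_Suc)
    then show ?case using h_inv_pow(2)[OF step.IH] by simp
  qed
  show "conj_by (inv (g 2 [^] m)) a \<in> ?S" if "2 \<le> m" for m :: nat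
    using eS[OF that] by (simp add: e_def)
  show "conj_by (g i [^] m) a \<in> ?S" if i: "i \<in> {2..n}" and m: "1 \<le> (m::nat)" for i m
  proof -
    have "conj_by (g i [^] m) a = s m" for m :: nat
    proof (induction m)
      case 0
      then show ?case by (simp add: s_0)
    next
      case (Suc m)
      have "conj_by (g i [^] Suc m) a = conj_by (g i) (conj_by (g i [^] m) a)"
        unfolding nat_pow_Suc2[OF g_closed[OF i]] using g_closed[OF i] by (simp add: conj_by_comp)
      then show ?case using Suc s_shift[OF i] by simp
    qed
    then show ?thesis using sS[OF m] by simp
  qed
  show "inv (g 2) \<otimes> g k \<in> ?S" if "k \<in> {2..n}" for k
    unfolding h_inv_h[OF that, symmetric] using Sm Si h_in that k23 by blast
  show "a \<otimes> g k \<in> ?S" if "k \<in> {2..n}" for k using h_in[OF that] by (simp add: h_def)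
  show "x \<in> generate G (g ` {2..n})" using assms(1) generated by simp
  show "\<rho> x Centre = Centre" by (rule assms(2))
  show "g i \<otimes> g j = a \<otimes> (g j \<otimes> g i)" if "i \<in> {2..n}" "j \<in> {2..n}" "i \<noteq> j" for i j
    by (rule rel_g_g[OF that])
  show "subgroup ?S G" by (rule h_generate_subgroup)
  show "\<rho> (g k) v = houghton_gen n k v" if "k \<in> {2..n}" for k v using \<rho>_g[OF that] by simp
qed (simp_all add: g_closed)

lemma h_fixes_Centre:
  assumes "x \<in> generate G (h ` {2..n})"
  shows "x \<in> carrier G \<and> \<rho> x Centre = Centre"
  using assms
proof (induction x rule: generate.induct)
  case (incl x)
  then obtain k where "k \<in> {2..n}" "x = h k" by blast
  then show ?case using h_closed n3 by (simp add: h_def \<rho>_mult g_closed \<rho>_g \<rho>_a)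
next
  case (inv x)
  then obtain k where k: "k \<in> {2..n}" "x = h k" by blast
  then have "\<rho> (h k) Centre = Centre" using n3 by (simp add: h_def \<rho>_mult g_closed \<rho>_g \<rho>_a)
  then show ?case using k h_closed \<rho>_inv[of "h k" Centre] by simp
qed (auto simp: \<rho>_one \<rho>_mult)

text \<open>This is what makes the conjugates of \<open>a\<close> depend only on the images of the centre and its neighbour. The
  generators \<open>h k\<close> of the stabiliser of the centre act like a Houghton group on the rest of the star, so
  the method for one point applies a second time.\<close>

lemma stabiliser_of_pair_centralises:
  assumes "x \<in> carrier G" "\<rho> x Centre = Centre" "\<rho> x (Ray 1 1) = Ray 1 1"
  shows "x \<otimes> a = a \<otimes> x"
proof -
  have "x \<in> {x \<in> carrier G. x \<otimes> a = a \<otimes> x}"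
  proof (rule star_schreier[where q = h and z = "s 1" and \<tau> = shift_star])
    show "x \<in> generate G (h ` {2..n})" by (rule stabiliser_of_centre[OF assms(1,2)])
    show "\<rho> x (shift_star Centre) = shift_star Centre" using assms(3) by (simp add: shift_star_def)
    show "subgroup {x \<in> carrier G. x \<otimes> a = a \<otimes> x} G" by (rule centraliser_subgroup) simp
    show "inv (h 2) \<otimes> h k \<in> {x \<in> carrier G. x \<otimes> a = a \<otimes> x}" if k: "k \<in> {2..n}" for k
    proof -
      have "conj_by (inv (g 2) \<otimes> g k) a = conj_by (inv (g 2)) (conj_by (g k) a)"
        using g_closed[OF k] by (simp add: conj_by_comp)
      also have "\<dots> = a" using rel_g_a[OF k] s_Suc[of 0] by (simp add: s_0)
      finally show ?thesis using g_closed[OF k] by (simp add: h_inv_h[OF k] conj_by_eq_iff)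
    qed
    show "s 1 \<otimes> h k \<in> {x \<in> carrier G. x \<otimes> a = a \<otimes> x}" if k: "k \<in> {2..n}" for k
    proof -
      have "conj_by (s 1 \<otimes> h k) a = conj_by (s 1) (conj_by a (s 1))"
        using g_closed[OF k] rel_g_a[OF k] by (simp add: h_def conj_by_comp[symmetric])
      also have "conj_by a (s 1) = s 1 \<otimes> a \<otimes> s 1" unfolding conj_by_def inv_a by (rule rel_braid)
      also have "conj_by (s 1) (s 1 \<otimes> a \<otimes> s 1) = a"
      proof -
        have ss: "s 1 \<otimes> s 1 = \<one>" 
        proof -
          have "s 1 = conj_by (g 2) a" by (simp add: s_def)
          then have "s 1 \<otimes> s 1 = conj_by (g 2) (a \<otimes> a)" by (simp add: conj_by_mult)
          then show ?thesis by (simp add: rel_a conj_by_def)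
        qed
        then have s1i: "inv (s 1) = s 1" by (simp add: inv_equality)
        have "conj_by (s 1) (s 1 \<otimes> a \<otimes> s 1) = (s 1 \<otimes> s 1) \<otimes> a \<otimes> (s 1 \<otimes> s 1)"
          unfolding conj_by_def s1i by (simp add: m_assoc)
        then show ?thesis unfolding ss by simp
      qed
      finally show ?thesis using h_closed[OF k] by (simp add: conj_by_eq_iff)
    qed
    show "conj_by (inv (h 2 [^] m)) (s 1) \<in> {x \<in> carrier G. x \<otimes> a = a \<otimes> x}" if "2 \<le> m" for m :: nat
      unfolding conj_h_inv_power_s[OF that] using a_commutes_e[OF that] by simp
    show "conj_by (h i [^] m) (s 1) \<in> {x \<in> carrier G. x \<otimes> a = a \<otimes> x}" if "i \<in> {2..n}" "1 \<le> (m::nat)" for i m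
      unfolding conj_h_power_s[OF that(1)] using a_commutes_s[of "Suc m"] that by simp
    show "h i \<otimes> h j = s 1 \<otimes> (h j \<otimes> h i)" if "i \<in> {2..n}" "j \<in> {2..n}" "i \<noteq> j" for i j
      by (rule h_commutator[OF that])
    show "\<rho> (h k) (shift_star v) = shift_star (houghton_gen n k v)" if "k \<in> {2..n}" "v \<in> V" for k v
      by (rule \<rho>_h_shift[OF that])
    show "v = w" if "v \<in> V" "w \<in> V" "shift_star v = shift_star w" for v w
      by (rule shift_star_inj[OF that])
    show "shift_star v \<in> V" if "v \<in> V" for v using shift_star_closed that n3 by simp
  qed (simp_all add: h_closed)
  then show ?thesis by simp
qed

text \<open>The transversals of both applications of Schreier's method are combined: \<open>y\<close> moves the centre to \<open>u\<close>, and
  \<open>z\<close> corrects the image of the neighbour without moving the centre.\<close>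

lemma two_transitive:
  assumes "u \<in> V" "v \<in> V" "u \<noteq> v"
  shows "\<exists>x\<in>carrier G. \<rho> x Centre = u \<and> \<rho> x (Ray 1 1) = v"
proof -
  define y where "y = transversal g u"
  have y: "y \<in> carrier G" "\<rho> y Centre = u"
    unfolding y_def using transversal_act[of g "\<lambda>v. v" u] g_closed \<rho>_g assms by auto
  define w where "w = \<rho> (inv y) v"
  have w: "w \<in> V" "\<rho> y w = v" using y assms by (simp_all add: w_def \<rho>_closed \<rho>_inv')
  then have "w \<noteq> Centre" using y assms by auto
  then obtain w' where w': "w' \<in> V" "w = shift_star w'" using shift_star_surj w by blast
  define z where "z = transversal h w'"
  have z: "z \<in> carrier G" "\<rho> z (shift_star Centre) = shift_star w'"
    unfolding z_def using transversal_act[of h shift_star w'] h_closed \<rho>_h_shift shift_star_closed n3 w' by auto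
  have "z \<in> generate G (h ` {2..n})"
  proof -
    have pw: "h k [^] (m::nat) \<in> generate G (h ` {2..n})" if "k \<in> {2..n}" for k m
      by (induction m) (use h_in[OF that] in \<open>auto intro: generate.one generate.eng\<close>)
    then have "inv (h k [^] (m::nat)) \<in> generate G (h ` {2..n})" if "k \<in> {2..n}" for k m
      using that subgroup.m_inv_closed[OF h_generate_subgroup] by blast
    then show ?thesis using w'(1) pw n3
      unfolding z_def transversal_def by (auto intro: generate.one split: star_vertex.splits)
  qed
  then have "\<rho> z Centre = Centre" using h_fixes_Centre by blast
  then have "\<rho> (y \<otimes> z) Centre = u \<and> \<rho> (y \<otimes> z) (Ray 1 1) = v"
    using y z w w' n3 by (simp add: \<rho>_mult shift_star_def)
  then show ?thesis using y z by blast
qed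

text \<open>The lift of the transposition of \<open>u\<close> and \<open>v\<close>. Any conjugating element gives the same result.\<close>

definition T :: "star_vertex \<Rightarrow> star_vertex \<Rightarrow> 'a" where
  "T u v = conj_by (SOME x. x \<in> carrier G \<and> \<rho> x Centre = u \<and> \<rho> x (Ray 1 1) = v) a"

lemma T_eq:
  assumes x: "x \<in> carrier G" "\<rho> x Centre = u" "\<rho> x (Ray 1 1) = v"
  shows "T u v = conj_by x a"
proof -
  define y where "y = (SOME x. x \<in> carrier G \<and> \<rho> x Centre = u \<and> \<rho> x (Ray 1 1) = v)"
  have "y \<in> carrier G \<and> \<rho> y Centre = u \<and> \<rho> y (Ray 1 1) = v"
    unfolding y_def by (rule someI[of _ x]) (use x in simp)
  then have y: "y \<in> carrier G" "\<rho> y Centre = u" "\<rho> y (Ray 1 1) = v" by auto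
  have "\<rho> (inv x \<otimes> y) Centre = Centre" "\<rho> (inv x \<otimes> y) (Ray 1 1) = Ray 1 1"
    using x y n3 \<rho>_inv[OF x(1), of Centre] \<rho>_inv[OF x(1), of "Ray 1 1"] by (simp_all add: \<rho>_mult)
  then have "conj_by (inv x \<otimes> y) a = a"
    using x(1) y(1) by (intro conj_fix stabiliser_of_pair_centralises) auto
  then have "conj_by x (conj_by (inv x \<otimes> y) a) = conj_by x a" by simp
  moreover have "conj_by x (conj_by (inv x \<otimes> y) a) = conj_by y a"
    using x(1) y(1) by (simp add: conj_by_comp m_assoc[symmetric])
  ultimately show ?thesis by (simp add: T_def y_def)
qed

lemma T_witness:
  assumes "u \<in> V" "v \<in> V" "u \<noteq> v"
  obtains x where "x \<in> carrier G" "\<rho> x Centre = u" "\<rho> x (Ray 1 1) = v" "T u v = conj_by x a"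
  using two_transitive[OF assms] T_eq by blast

lemma T_closed: "u \<in> V \<Longrightarrow> v \<in> V \<Longrightarrow> u \<noteq> v \<Longrightarrow> T u v \<in> carrier G"
  using T_witness[of u v] by (metis a_closed conj_by_closed)

lemma T_conj:
  assumes "y \<in> carrier G" "u \<in> V" "v \<in> V" "u \<noteq> v"
  shows "conj_by y (T u v) = T (\<rho> y u) (\<rho> y v)"
proof -
  obtain x where x: "x \<in> carrier G" "\<rho> x Centre = u" "\<rho> x (Ray 1 1) = v" "T u v = conj_by x a"
    using T_witness assms(2-) by blast
  have "T (\<rho> y u) (\<rho> y v) = conj_by (y \<otimes> x) a"
    by (rule T_eq) (use assms(1) x n3 in \<open>auto simp: \<rho>_mult\<close>)
  then show ?thesis using x assms(1) by (simp add: conj_by_comp)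
qed

lemma T_involution:
  assumes "u \<in> V" "v \<in> V" "u \<noteq> v"
  shows "T u v \<otimes> T u v = \<one>"
proof -
  obtain x where x: "x \<in> carrier G" "T u v = conj_by x a" using T_witness assms by blast
  have "T u v \<otimes> T u v = conj_by x (a \<otimes> a)" using x by (simp add: conj_by_mult)
  then show ?thesis using x by (simp add: rel_a conj_by_def)
qed

lemma T_inv: "u \<in> V \<Longrightarrow> v \<in> V \<Longrightarrow> u \<noteq> v \<Longrightarrow> inv (T u v) = T u v"
  using T_involution T_closed by (simp add: inv_equality)

lemma T_sym:
  assumes "u \<in> V" "v \<in> V" "u \<noteq> v"
  shows "T v u = T u v"
proof -
  obtain x where x: "x \<in> carrier G" "\<rho> x Centre = u" "\<rho> x (Ray 1 1) = v" "T u v = conj_by x a"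
    using T_witness assms by blast
  have "T v u = conj_by (x \<otimes> a) a"
    by (rule T_eq) (use x n3 in \<open>auto simp: \<rho>_mult \<rho>_a\<close>)
  also have "\<dots> = conj_by x (conj_by a a)" using x by (simp add: conj_by_comp)
  also have "conj_by a a = a" by (simp add: conj_fix)
  finally show ?thesis using x by simp
qed

lemma \<rho>_T:
  assumes "u \<in> V" "v \<in> V" "u \<noteq> v" "w \<in> V"
  shows "\<rho> (T u v) w = transpose u v w"
proof -
  obtain x where x: "x \<in> carrier G" "\<rho> x Centre = u" "\<rho> x (Ray 1 1) = v" "T u v = conj_by x a"
    using T_witness assms by blast
  define w' where "w' = \<rho> (inv x) w"
  have w': "w' \<in> V" "\<rho> x w' = w" using x assms by (simp_all add: w'_def \<rho>_closed \<rho>_inv')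
  have R: "Ray 1 1 \<in> V" using n3 by simp
  have c: "w = u \<longleftrightarrow> w' = Centre" "w = v \<longleftrightarrow> w' = Ray 1 1"
    using x w' R \<rho>_inj[OF x(1)] by (metis Centre_in)+
  have "transpose Centre (Ray 1 1) w' \<in> V" using w' R by (simp add: transpose_def)
  then have "\<rho> (T u v) w = \<rho> x (transpose Centre (Ray 1 1) w')"
    using x w' assms(4) by (simp add: conj_by_def \<rho>_mult \<rho>_closed \<rho>_a w'_def[symmetric])
  then show ?thesis using c x w' by (auto simp: transpose_def)
qed

section \<open>Products of transpositions\<close>

definition T_group :: "star_vertex set \<Rightarrow> 'a set" where
  "T_group F = generate G {T u v | u v. u \<in> F \<and> v \<in> F \<and> u \<noteq> v}"

lemma T_gens_closed: "F \<subseteq> V \<Longrightarrow> {T u v | u v. u \<in> F \<and> v \<in> F \<and> u \<noteq> v} \<subseteq> carrier G"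
  using T_closed by blast

lemma T_group_subgroup: "F \<subseteq> V \<Longrightarrow> subgroup (T_group F) G"
  unfolding T_group_def by (rule generate_is_subgroup[OF T_gens_closed])

lemma T_in_group: "u \<in> F \<Longrightarrow> v \<in> F \<Longrightarrow> u \<noteq> v \<Longrightarrow> T u v \<in> T_group F"
  unfolding T_group_def by (rule generate.incl) blast

lemma T_group_mono: "F \<subseteq> F' \<Longrightarrow> F' \<subseteq> V \<Longrightarrow> T_group F \<subseteq> T_group F'"
  unfolding T_group_def by (rule mono_generate) blast

lemma T_group_fixes:
  assumes F: "F \<subseteq> V" and x: "x \<in> T_group F" and w: "w \<in> V" "w \<notin> F"
  shows "x \<in> carrier G \<and> \<rho> x w = w"
  using x unfolding T_group_def
proof (induction x rule: generate.induct)
  case one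
  then show ?case using \<rho>_one w by simp
next
  case (incl t)
  then obtain u v where t: "t = T u v" "u \<in> F" "v \<in> F" "u \<noteq> v" by blast
  then have "\<rho> t w = transpose u v w" using F w by (simp add: \<rho>_T subset_iff)
  then show ?case using t F w T_closed by (auto simp: transpose_def)
next
  case (inv t)
  then obtain u v where t: "t = T u v" "u \<in> F" "v \<in> F" "u \<noteq> v" by blast
  then have "inv t = t" using T_inv F by blast
  moreover have "\<rho> t w = transpose u v w" using t F w by (simp add: \<rho>_T subset_iff)
  ultimately show ?case using t F w T_closed by (auto simp: transpose_def)
qed (use w \<rho>_mult in auto)

text \<open>A vertex \<open>x\<^sub>0\<close> can be moved to the right in a product of transpositions until it occurs in the last factor only.
  The set of products of this form is closed under multiplication by each transposition from the right.\<close>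

lemma T_group_eliminate:
  assumes F: "insert x\<^sub>0 F \<subseteq> V" "x\<^sub>0 \<notin> F" and x: "x \<in> T_group (insert x\<^sub>0 F)"
  shows "x \<in> T_group F \<or> (\<exists>v\<in>F. \<exists>y\<in>T_group F. x = y \<otimes> T x\<^sub>0 v)"
proof -
  have FV: "F \<subseteq> V" and x0: "x\<^sub>0 \<in> V" using F by auto
  note Sm = subgroup.m_closed[OF T_group_subgroup[OF FV]]
  have Fc: "y \<in> carrier G" if "y \<in> T_group F" for y
    using subgroup.mem_carrier[OF T_group_subgroup[OF FV] that] .
  define M where "M = {x. x \<in> T_group F \<or> (\<exists>v\<in>F. \<exists>y\<in>T_group F. x = y \<otimes> T x\<^sub>0 v)}"
  have Mc: "m \<in> carrier G" if "m \<in> M" for m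
    using that Fc T_closed[OF x0] FV F(2) unfolding M_def by auto
  have step: "m \<otimes> t \<in> M" if m: "m \<in> M" and t: "t \<in> {T u v | u v. u \<in> insert x\<^sub>0 F \<and> v \<in> insert x\<^sub>0 F \<and> u \<noteq> v}" for m t
  proof -
    have "(\<exists>u\<in>F. \<exists>w\<in>F. u \<noteq> w \<and> t = T u w) \<or> (\<exists>w\<in>F. t = T x\<^sub>0 w)"
    proof -
      obtain u w where uw: "t = T u w" "u \<in> insert x\<^sub>0 F" "w \<in> insert x\<^sub>0 F" "u \<noteq> w" using t by blast
      show ?thesis
      proof (cases "w = x\<^sub>0")
        case True
        then have "u \<in> F" "t = T x\<^sub>0 u" using uw F T_sym[of u x\<^sub>0] by auto
        then show ?thesis by blast
      next
        case False
        then show ?thesis using uw by blast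
      qed
    qed
    then consider (in_F) u w where "u \<in> F" "w \<in> F" "u \<noteq> w" "t = T u w" | (x0) w where "w \<in> F" "t = T x\<^sub>0 w" by blast
    then show ?thesis
    proof cases
      case in_F
      have tF: "t \<in> T_group F" using in_F T_in_group by simp
      show ?thesis
      proof (cases "m \<in> T_group F")
        case True
        then show ?thesis using Sm tF by (simp add: M_def)
      next
        case False
        then obtain v y where vy: "v \<in> F" "y \<in> T_group F" "m = y \<otimes> T x\<^sub>0 v" using m by (auto simp: M_def)
        have ne: "v \<noteq> x\<^sub>0" "u \<noteq> x\<^sub>0" "w \<noteq> x\<^sub>0" and V: "v \<in> V" "u \<in> V" "w \<in> V" using vy in_F F by auto
        have tc: "t \<in> carrier G" using tF Fc by simp
        have Tc: "T x\<^sub>0 v \<in> carrier G" using T_closed x0 V ne by metis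
        have "conj_by (inv t) (T x\<^sub>0 v) = T x\<^sub>0 (transpose u w v)"
          using T_conj[of t x\<^sub>0 v] tc x0 V ne in_F T_inv by (simp add: \<rho>_T transpose_def)
        moreover have "T x\<^sub>0 v \<otimes> t = t \<otimes> conj_by (inv t) (T x\<^sub>0 v)"
          using tc Tc by (simp add: conj_by_def m_assoc[symmetric])
        ultimately have "m \<otimes> t = (y \<otimes> t) \<otimes> T x\<^sub>0 (transpose u w v)"
          using vy Fc tc Tc by (metis conj_by_closed inv_closed m_assoc)
        moreover have "transpose u w v \<in> F" using vy in_F by (simp add: transpose_def)
        ultimately show ?thesis unfolding M_def using Sm[OF vy(2) tF] by blast
      qed
    next
      case x0
      show ?thesis
      proof (cases "m \<in> T_group F")
        case True
        then show ?thesis using x0 by (auto simp: M_def)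
      next
        case False
        then obtain v y where vy: "v \<in> F" "y \<in> T_group F" "m = y \<otimes> T x\<^sub>0 v" using m by (auto simp: M_def)
        have ne: "v \<noteq> x\<^sub>0" "w \<noteq> x\<^sub>0" and V: "v \<in> V" "w \<in> V" using vy x0 F by auto
        have Tc: "T x\<^sub>0 v \<in> carrier G" "T x\<^sub>0 w \<in> carrier G" using T_closed \<open>x\<^sub>0 \<in> V\<close> V ne by metis+
        show ?thesis
        proof (cases "v = w")
          case True
          then have "m \<otimes> t = y"
            using vy x0 Fc Tc T_involution[OF \<open>x\<^sub>0 \<in> V\<close> V(2)] ne by (simp add: m_assoc)
          then show ?thesis using vy by (simp add: M_def)
        next
          case False
          have "T x\<^sub>0 v \<otimes> T x\<^sub>0 w = conj_by (T x\<^sub>0 v) (T x\<^sub>0 w) \<otimes> T x\<^sub>0 v" by (rule conj_by_move[OF Tc])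
          also have "conj_by (T x\<^sub>0 v) (T x\<^sub>0 w) = T v w"
            using T_conj[OF Tc(1) \<open>x\<^sub>0 \<in> V\<close> V(2)] ne False V \<open>x\<^sub>0 \<in> V\<close> by (simp add: \<rho>_T transpose_def)
          finally have e: "T x\<^sub>0 v \<otimes> T x\<^sub>0 w = T v w \<otimes> T x\<^sub>0 v" .
          have Tvw: "T v w \<in> T_group F" using T_in_group vy x0 False by simp
          have "m \<otimes> t = y \<otimes> (T x\<^sub>0 v \<otimes> T x\<^sub>0 w)" using vy x0 Fc Tc by (simp add: m_assoc)
          also have "\<dots> = (y \<otimes> T v w) \<otimes> T x\<^sub>0 v" unfolding e using vy Fc Tc Tvw by (simp add: m_assoc)
          finally show ?thesis unfolding M_def using Sm[OF vy(2) Tvw] vy(1) by blast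
        qed
      qed
    qed
  qed
  have "x \<in> carrier G \<and> (\<forall>m\<in>M. m \<otimes> x \<in> M)"
    using x unfolding T_group_def[of "insert x\<^sub>0 F"]
  proof (induction x rule: generate.induct)
    case one
    then show ?case using Mc by simp
  next
    case (incl t)
    then show ?case using step T_gens_closed[OF F(1)] by blast
  next
    case (inv t)
    then obtain u v where t: "t = T u v" "u \<in> insert x\<^sub>0 F" "v \<in> insert x\<^sub>0 F" "u \<noteq> v" by blast
    then have it: "inv t = t" using T_inv F by blast
    have "t \<in> carrier G" using inv T_gens_closed[OF F(1)] by blast
    then show ?case unfolding it using step[OF _ inv] by blast
  next
    case (eng y z)
    then show ?case using Mc by (auto simp: m_assoc[symmetric])
  qed
  moreover have "\<one> \<in> M" using subgroup.one_closed[OF T_group_subgroup[OF FV]] by (simp add: M_def)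
  ultimately have "x \<in> M" by force
  then show ?thesis by (simp add: M_def)
qed

text \<open>A product \<open>y T x\<^sub>0 v\<close>, where \<open>y\<close> fixes \<open>x\<^sub>0\<close>, maps \<open>v\<close> to \<open>x\<^sub>0\<close>, so an element that acts trivially has no such last
  factor.\<close>

lemma T_group_faithful_finite:
  assumes "finite F" "F \<subseteq> V" "x \<in> T_group F" "\<And>v. v \<in> V \<Longrightarrow> \<rho> x v = v"
  shows "x = \<one>"
  using assms
proof (induction F rule: finite_induct)
  case empty
  then show ?case by (simp add: T_group_def generate_empty)
next
  case (insert x\<^sub>0 F)
  have FV: "F \<subseteq> V" "x\<^sub>0 \<in> V" using insert.prems by auto
  from T_group_eliminate[OF insert.prems(1) insert.hyps(2) insert.prems(2)]
  show ?case
  proof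
    assume "x \<in> T_group F"
    then show ?thesis using insert.IH FV insert.prems by blast
  next
    assume "\<exists>v\<in>F. \<exists>y\<in>T_group F. x = y \<otimes> T x\<^sub>0 v"
    then obtain v y where vy: "v \<in> F" "y \<in> T_group F" "x = y \<otimes> T x\<^sub>0 v" by blast
    have v: "v \<in> V" "v \<noteq> x\<^sub>0" using vy FV insert.hyps by auto
    have y: "y \<in> carrier G" "\<rho> y x\<^sub>0 = x\<^sub>0" using T_group_fixes[OF FV(1) vy(2) FV(2) insert.hyps(2)] by auto
    have "\<rho> x v = x\<^sub>0"
      using vy y v FV T_closed[OF FV(2) v(1)] by (simp add: \<rho>_mult \<rho>_T transpose_def)
    then show ?thesis using insert.prems(3)[OF v(1)] v by simp
  qed
qed

lemma T_group_faithful: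
  assumes "x \<in> T_group V" "\<And>v. v \<in> V \<Longrightarrow> \<rho> x v = v"
  shows "x = \<one>"
proof -
  have "\<exists>F. finite F \<and> F \<subseteq> V \<and> x \<in> T_group F"
    using assms(1) unfolding T_group_def[of V]
  proof (induction x rule: generate.induct)
    case one
    then show ?case using subgroup.one_closed[OF T_group_subgroup[of "{}"]] by blast
  next
    case (incl t)
    then obtain u v where t: "t = T u v" "u \<in> V" "v \<in> V" "u \<noteq> v" by blast
    then show ?case using T_in_group[of u "{u, v}" v] by (intro exI[of _ "{u, v}"]) simp
  next
    case (inv t)
    then obtain u v where t: "t = T u v" "u \<in> V" "v \<in> V" "u \<noteq> v" by blast
    then show ?case using T_in_group[of u "{u, v}" v] T_inv by (intro exI[of _ "{u, v}"]) simp
  next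
    case (eng y z)
    then obtain F F' where F: "finite F" "F \<subseteq> V" "y \<in> T_group F" "finite F'" "F' \<subseteq> V" "z \<in> T_group F'" by blast
    have U: "F \<union> F' \<subseteq> V" using F by auto
    have "y \<in> T_group (F \<union> F')" "z \<in> T_group (F \<union> F')"
      using T_group_mono[OF _ U] F(3,6) by blast+
    then have "y \<otimes> z \<in> T_group (F \<union> F')" using subgroup.m_closed[OF T_group_subgroup[OF U]] by blast
    then show ?case using F U by (intro exI[of _ "F \<union> F'"]) simp
  qed
  then show ?thesis using T_group_faithful_finite assms(2) by blast
qed

lemma T_group_normal: "T_group V \<lhd> G"
  unfolding T_group_def
proof (rule normal_generateI[OF T_gens_closed[OF order_refl]])
  fix t y assume "t \<in> {T u v | u v. u \<in> V \<and> v \<in> V \<and> u \<noteq> v}" and y: "y \<in> carrier G"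
  then obtain u v where t: "t = T u v" "u \<in> V" "v \<in> V" "u \<noteq> v" by blast
  have "y \<otimes> t \<otimes> inv y = T (\<rho> y u) (\<rho> y v)" using T_conj[OF y t(2-4)] t(1) by (simp add: conj_by_def)
  moreover have "\<rho> y u \<in> V" "\<rho> y v \<in> V" "\<rho> y u \<noteq> \<rho> y v" using y t \<rho>_closed \<rho>_inj by blast+
  ultimately show "y \<otimes> t \<otimes> inv y \<in> {T u v | u v. u \<in> V \<and> v \<in> V \<and> u \<noteq> v}" by blast
qed

text \<open>Modulo the normal subgroup generated by \<open>a\<close> the group is abelian, and an element is determined
  there by its translation lengths on the rays.\<close>

theorem faithful:
  assumes x: "x \<in> carrier G" and triv: "\<And>v. v \<in> V \<Longrightarrow> \<rho> x v = v"
  shows "x = \<one>"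
proof -
  let ?\<Phi> = "T_group V"
  let ?A = "G Mod ?\<Phi>"
  interpret \<Phi>: normal ?\<Phi> G by (rule T_group_normal)
  interpret A: group ?A by (rule \<Phi>.factorgroup_is_group)
  define \<pi> where "\<pi> y = ?\<Phi> #> y" for y
  interpret \<pi>: group_hom G ?A \<pi>
    unfolding \<pi>_def by unfold_locales (rule \<Phi>.r_coset_hom_Mod)
  have R: "Ray 1 1 \<in> V" using n3 by simp
  have a\<Phi>: "a \<in> ?\<Phi>"
  proof -
    have "T Centre (Ray 1 1) = a" using T_eq[of \<one> Centre "Ray 1 1"] \<rho>_one R by simp
    then show ?thesis using T_in_group[of Centre V "Ray 1 1"] R by simp
  qed
  have \<pi>a: "\<pi> a = \<one>\<^bsub>?A\<^esub>" using a\<Phi> \<Phi>.rcos_const by (simp add: \<pi>_def)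
  have Agen: "carrier ?A = generate ?A ((\<lambda>k. \<pi> (g k)) ` {2..n})"
  proof -
    have "generate ?A (\<pi> ` (g ` {2..n})) = \<pi> ` generate G (g ` {2..n})"
      by (rule \<pi>.generate_img) (use g_closed in auto)
    then show ?thesis using generated by (simp add: image_image carrier_FactGroup \<pi>_def)
  qed
  have "\<pi> (g i) \<otimes>\<^bsub>?A\<^esub> \<pi> (g j) = \<pi> (g j) \<otimes>\<^bsub>?A\<^esub> \<pi> (g i)" if ij: "i \<in> {2..n}" "j \<in> {2..n}" for i j
  proof (cases "i = j")
    case False
    have gc: "g i \<in> carrier G" "g j \<in> carrier G" using ij g_closed by auto
    have "\<pi> (g i) \<otimes>\<^bsub>?A\<^esub> \<pi> (g j) = \<pi> (a \<otimes> (g j \<otimes> g i))"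
      unfolding \<pi>.hom_mult[OF gc, symmetric] rel_g_g[OF ij False] ..
    also have "\<dots> = \<pi> a \<otimes>\<^bsub>?A\<^esub> (\<pi> (g j) \<otimes>\<^bsub>?A\<^esub> \<pi> (g i))"
      using gc by (simp only: \<pi>.hom_mult a_closed m_closed)
    also have "\<dots> = \<pi> (g j) \<otimes>\<^bsub>?A\<^esub> \<pi> (g i)"
      unfolding \<pi>a using gc by (intro A.l_one A.m_closed) (auto intro: \<pi>.hom_closed)
    finally show ?thesis .
  qed simp
  then interpret A: comm_group ?A
    by (intro A.commuting_generators[OF _ _ Agen]) (use g_closed \<pi>.hom_closed in auto)
  have \<pi>g: "\<pi> (g k) \<in> carrier ?A" if "k \<in> {2..n}" for k using that g_closed \<pi>.hom_closed by blast
  define P where "P c = finprod ?A (\<lambda>k. \<pi> (g k) [^]\<^bsub>?A\<^esub> (c k :: int)) {2..n}" for c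
  have Pmult: "P c \<otimes>\<^bsub>?A\<^esub> P d = P (\<lambda>k. c k + d k)" for c d
  proof -
    have "P (\<lambda>k. c k + d k) = finprod ?A (\<lambda>k. \<pi> (g k) [^]\<^bsub>?A\<^esub> c k \<otimes>\<^bsub>?A\<^esub> \<pi> (g k) [^]\<^bsub>?A\<^esub> d k) {2..n}"
      unfolding P_def by (rule A.finprod_cong') (use \<pi>g in \<open>auto simp: A.int_pow_mult simp del: mult_FactGroup\<close>)
    also have "\<dots> = P c \<otimes>\<^bsub>?A\<^esub> P d"
      unfolding P_def by (rule A.finprod_multf) (use \<pi>g in auto)
    finally show ?thesis by simp
  qed
  have Psingle: "P (\<lambda>k. if k = j then c else 0) = \<pi> (g j) [^]\<^bsub>?A\<^esub> c" if j: "j \<in> {2..n}" for j c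
  proof -
    have "P (\<lambda>k. if k = j then c else 0) = finprod ?A (\<lambda>k. if k = j then \<pi> (g k) [^]\<^bsub>?A\<^esub> c else \<one>\<^bsub>?A\<^esub>) {2..n}"
      unfolding P_def by (rule A.finprod_cong') (use \<pi>g in \<open>auto simp del: one_FactGroup\<close>)
    also have "\<dots> = \<pi> (g j) [^]\<^bsub>?A\<^esub> c"
      by (rule A.finprod_singleton_swap[OF j]) (use \<pi>g in auto)
    finally show ?thesis .
  qed
  \<comment> \<open>far out on the \<open>k\<close>-th ray, \<open>y\<close> is the translation by \<open>c k\<close> towards the centre; each \<open>g j\<close> with \<open>j \<noteq> k\<close> is the identity there\<close>
  define moves where "moves y c \<longleftrightarrow> (\<forall>k\<in>{2..n}. \<exists>M. \<forall>m\<ge>M. \<rho> y (Ray k m) = Ray k (nat (int m - c k)))" for y c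
  have "y \<in> carrier G \<and> (\<exists>c. \<pi> y = P c \<and> moves y c)" if "y \<in> generate G (g ` {2..n})" for y
    using that
  proof (induction y rule: generate.induct)
    case one
    have "P (\<lambda>k. 0) = \<one>\<^bsub>?A\<^esub>" unfolding P_def by (rule A.finprod_one_eqI) simp
    then have "\<pi> \<one> = P (\<lambda>k. 0)" using \<pi>.hom_one by simp
    moreover have "moves \<one> (\<lambda>k. 0)"
      unfolding moves_def by (intro ballI exI[of _ 1]) (auto simp: \<rho>_one)
    ultimately show ?case by blast
  next
    case (incl y)
    then obtain j where j: "j \<in> {2..n}" "y = g j" by blast
    have "\<rho> y (Ray k m) = Ray k (nat (int m - (if k = j then 1 else 0)))" if k: "k \<in> {2..n}" and m: "m \<ge> 2" for k m
    proof -
      obtain m' where "m = Suc m'" "1 \<le> m'" using m by (cases m) auto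
      then show ?thesis using k j by (auto simp: \<rho>_g)
    qed
    then have "moves y (\<lambda>k. if k = j then 1 else 0)" unfolding moves_def by blast
    moreover have "\<pi> y = P (\<lambda>k. if k = j then 1 else 0)"
      using Psingle[OF j(1), of 1] \<pi>g[OF j(1)] j by (simp add: A.int_pow_1)
    ultimately show ?case using j g_closed by blast
  next
    case (inv y)
    then obtain j where j: "j \<in> {2..n}" "y = g j" by blast
    have "\<rho> (inv y) (Ray k m) = Ray k (nat (int m - (if k = j then - 1 else 0)))" if k: "k \<in> {2..n}" and m: "m \<ge> 1" for k m
    proof -
      let ?m = "if k = j then Suc m else m"
      have "\<rho> (g j) (Ray k ?m) = Ray k m" using that j by (auto simp: \<rho>_g)
      then have "\<rho> (inv y) (Ray k m) = Ray k ?m"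
        using \<rho>_inv[of "g j" "Ray k ?m"] g_closed j k m by auto
      then show ?thesis by (simp add: nat_add_distrib)
    qed
    then have "moves (inv y) (\<lambda>k. if k = j then - 1 else 0)" unfolding moves_def by blast
    moreover have "\<pi> (inv y) = P (\<lambda>k. if k = j then - 1 else 0)"
      using Psingle[OF j(1), of "- 1"] \<pi>g[OF j(1)] j g_closed[OF j(1)] \<pi>.hom_inv[of "g j"]
      by (simp add: A.int_pow_neg A.int_pow_1)
    ultimately show ?case using j g_closed by blast
  next
    case (eng y z)
    then obtain c d where y: "y \<in> carrier G" "\<pi> y = P c" "moves y c" and z: "z \<in> carrier G" "\<pi> z = P d" "moves z d" by blast
    have "\<exists>M. \<forall>m\<ge>M. \<rho> (y \<otimes> z) (Ray k m) = Ray k (nat (int m - (c k + d k)))" if k: "k \<in> {2..n}" for k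
    proof -
      obtain M M' where M: "\<forall>m\<ge>M. \<rho> y (Ray k m) = Ray k (nat (int m - c k))"
        and M': "\<forall>m\<ge>M'. \<rho> z (Ray k m) = Ray k (nat (int m - d k))" using y z k unfolding moves_def by meson
      have "\<rho> (y \<otimes> z) (Ray k m) = Ray k (nat (int m - (c k + d k)))" if m: "m \<ge> M + M' + nat \<bar>d k\<bar> + 1" for m
      proof -
        have "Ray k m \<in> V" using k m by simp
        then have "\<rho> (y \<otimes> z) (Ray k m) = \<rho> y (Ray k (nat (int m - d k)))" using y z M' m by (simp add: \<rho>_mult)
        also have "\<dots> = Ray k (nat (int (nat (int m - d k)) - c k))" using M m by simp
        also have "int (nat (int m - d k)) - c k = int m - (c k + d k)" using m by simp
        finally show ?thesis .
      qed
      then show ?thesis by blast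
    qed
    then have "moves (y \<otimes> z) (\<lambda>k. c k + d k)" unfolding moves_def by blast
    moreover have "\<pi> (y \<otimes> z) = P (\<lambda>k. c k + d k)" using y z Pmult[of c d] by simp
    ultimately show ?case using y z by blast
  qed
  from this[of x] obtain c where c: "\<pi> x = P c" "moves x c" using x generated by blast
  have "c k = 0" if k: "k \<in> {2..n}" for k
  proof -
    obtain M where M: "\<forall>m\<ge>M. \<rho> x (Ray k m) = Ray k (nat (int m - c k))" using c(2) k unfolding moves_def by blast
    define m where "m = M + nat \<bar>c k\<bar> + 1"
    have "Ray k m \<in> V" using k by (simp add: m_def)
    moreover have "M \<le> m" by (simp add: m_def)
    ultimately have "Ray k m = Ray k (nat (int m - c k))" using triv[of "Ray k m"] M by simp
    then have "int m = int (nat (int m - c k))" by simp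
    moreover have "c k \<le> int m" by (simp add: m_def)
    ultimately show ?thesis by simp
  qed
  then have "P c = \<one>\<^bsub>?A\<^esub>" unfolding P_def by (intro A.finprod_one_eqI) simp
  then have "?\<Phi> #> x = ?\<Phi>" using c(1) by (simp add: \<pi>_def)
  then have "x \<in> ?\<Phi>" using x \<Phi>.is_subgroup rcos_self by blast
  then show ?thesis using T_group_faithful triv by blast
qed

end

section \<open>Groups of permutations\<close>

lemma BijGroup_simps:
  "carrier (BijGroup X) = Bij X"
  "\<sigma> \<in> Bij X \<Longrightarrow> \<tau> \<in> Bij X \<Longrightarrow> \<sigma> \<otimes>\<^bsub>BijGroup X\<^esub> \<tau> = compose X \<sigma> \<tau>"
  "\<one>\<^bsub>BijGroup X\<^esub> = (\<lambda>x\<in>X. x)"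
  by (simp_all add: BijGroup_def)

lemma Bij_apply: "\<sigma> \<in> Bij X \<Longrightarrow> x \<in> X \<Longrightarrow> \<sigma> x \<in> X"
  using Bij_imp_funcset by blast

lemma Bij_inj: "\<sigma> \<in> Bij X \<Longrightarrow> x \<in> X \<Longrightarrow> y \<in> X \<Longrightarrow> \<sigma> x = \<sigma> y \<Longrightarrow> x = y"
  by (auto simp: Bij_def bij_betw_def inj_on_def)

lemma Bij_eqI: "\<sigma> \<in> Bij X \<Longrightarrow> \<tau> \<in> Bij X \<Longrightarrow> (\<And>x. x \<in> X \<Longrightarrow> \<sigma> x = \<tau> x) \<Longrightarrow> \<sigma> = \<tau>"
  by (rule extensionalityI[of _ X]) (auto simp: Bij_def)

lemma inv_BijGroup_apply:
  assumes "\<sigma> \<in> Bij X" "x \<in> X"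
  shows "\<sigma> ((inv\<^bsub>BijGroup X\<^esub> \<sigma>) x) = x" "(inv\<^bsub>BijGroup X\<^esub> \<sigma>) x \<in> X"
proof -
  interpret group "BijGroup X" by (rule group_BijGroup)
  have i: "inv\<^bsub>BijGroup X\<^esub> \<sigma> \<in> Bij X" using inv_closed[of \<sigma>] assms(1) by (simp add: BijGroup_simps)
  have "compose X \<sigma> (inv\<^bsub>BijGroup X\<^esub> \<sigma>) x = (\<lambda>x\<in>X. x) x"
    using r_inv[of \<sigma>] assms(1) i by (simp add: BijGroup_simps)
  then show "\<sigma> ((inv\<^bsub>BijGroup X\<^esub> \<sigma>) x) = x" using assms(2) by (simp add: compose_def)
  show "(inv\<^bsub>BijGroup X\<^esub> \<sigma>) x \<in> X" using Bij_apply[OF i assms(2)] .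
qed

text \<open>Composition with the transposition of \<open>v\<close> and \<open>\<sigma> v\<close> fixes \<open>v\<close> and keeps all fixed points of \<open>\<sigma>\<close>.\<close>

lemma finitary_perms_generated:
  assumes H: "subgroup H (BijGroup X)"
    and transp: "\<And>u v. u \<in> X \<Longrightarrow> v \<in> X \<Longrightarrow> u \<noteq> v \<Longrightarrow> (\<lambda>x\<in>X. transpose u v x) \<in> H"
  shows "finitary_perms X \<subseteq> H"
proof
  fix \<sigma> assume "\<sigma> \<in> finitary_perms X"
  then have "\<sigma> \<in> Bij X" "finite {x \<in> X. \<sigma> x \<noteq> x}" by (auto simp: finitary_perms_def)
  then show "\<sigma> \<in> H"
  proof (induction "card {x \<in> X. \<sigma> x \<noteq> x}" arbitrary: \<sigma> rule: less_induct)
    case less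
    show ?case
    proof (cases "\<exists>x\<in>X. \<sigma> x \<noteq> x")
      case False
      then have "\<sigma> = (\<lambda>x\<in>X. x)" by (intro Bij_eqI[OF less.prems(1) id_Bij]) auto
      then show ?thesis using subgroup.one_closed[OF H] by (simp add: BijGroup_simps)
    next
      case True
      then obtain v where v: "v \<in> X" "\<sigma> v \<noteq> v" by blast
      define u where "u = \<sigma> v"
      define t where "t = (\<lambda>x\<in>X. transpose u v x)"
      have u: "u \<in> X" "u \<noteq> v" using Bij_apply less.prems(1) v by (auto simp: u_def)
      have tH: "t \<in> H" unfolding t_def by (rule transp) (use u v in auto)
      then have t: "t \<in> Bij X" using subgroup.mem_carrier[OF H] by (simp add: BijGroup_simps)
      define \<tau> where "\<tau> = compose X t \<sigma>"
      have \<tau>: "\<tau> \<in> Bij X" unfolding \<tau>_def by (rule compose_Bij[OF t less.prems(1)])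
      have \<tau>x: "\<tau> x = transpose u v (\<sigma> x)" if "x \<in> X" for x
        using that Bij_apply[OF less.prems(1) that] by (simp add: \<tau>_def compose_def t_def)
      have sub: "{x \<in> X. \<tau> x \<noteq> x} \<subset> {x \<in> X. \<sigma> x \<noteq> x}"
      proof
        show "{x \<in> X. \<tau> x \<noteq> x} \<subseteq> {x \<in> X. \<sigma> x \<noteq> x}"
        proof (rule subsetI, rule CollectI)
          fix x assume x: "x \<in> {x \<in> X. \<tau> x \<noteq> x}"
          have "\<sigma> x \<noteq> x"
          proof
            assume fix_x: "\<sigma> x = x"
            have "x \<noteq> v" using fix_x v by auto
            then have "\<sigma> x \<noteq> u" using Bij_inj[OF less.prems(1), of x v] x v by (auto simp: u_def)
            then show False using fix_x \<open>x \<noteq> v\<close> x \<tau>x[of x] by (auto simp: transpose_def)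
          qed
          then show "x \<in> X \<and> \<sigma> x \<noteq> x" using x by simp
        qed
        have "\<tau> v = v" using \<tau>x[OF v(1)] by (simp add: u_def)
        then show "{x \<in> X. \<tau> x \<noteq> x} \<noteq> {x \<in> X. \<sigma> x \<noteq> x}" using v by blast
      qed
      have "\<tau> \<in> H"
        by (rule less.hyps[OF psubset_card_mono[OF less.prems(2) sub] \<tau>])
          (rule finite_subset[OF psubset_imp_subset[OF sub] less.prems(2)])
      then have "t \<otimes>\<^bsub>BijGroup X\<^esub> \<tau> \<in> H" using tH subgroup.m_closed[OF H] by blast
      moreover have "t \<otimes>\<^bsub>BijGroup X\<^esub> \<tau> = \<sigma>"
        unfolding BijGroup_simps(2)[OF t \<tau>]
      proof (rule Bij_eqI[OF compose_Bij[OF t \<tau>] less.prems(1)])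
        fix x assume x: "x \<in> X"
        then show "compose X t \<tau> x = \<sigma> x"
          using Bij_apply[OF \<tau> x] \<tau>x[OF x] by (simp add: compose_def t_def)
      qed
      ultimately show ?thesis by simp
    qed
  qed
qed

lemma bounded_displacement_finitary:
  assumes "\<sigma> \<in> finitary_perms X"
  shows "bounded_displacement X idx \<sigma>"
proof -
  let ?S = "{x \<in> X. \<sigma> x \<noteq> x}"
  let ?f = "\<lambda>x. idx (\<sigma> x) + idx x"
  have fin: "finite ?S" using assms by (simp add: finitary_perms_def)
  have "idx (\<sigma> x) \<le> idx x + sum ?f ?S \<and> idx x \<le> idx (\<sigma> x) + sum ?f ?S" if "x \<in> X" for x
  proof (cases "\<sigma> x = x")
    case False
    then have "?f x \<le> sum ?f ?S" using that fin by (intro member_le_sum) auto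
    then show ?thesis by simp
  qed simp
  then show ?thesis unfolding bounded_displacement_def by blast
qed

lemma subgroup_bounded_displacement:
  "subgroup {\<sigma> \<in> Bij X. bounded_displacement X idx \<sigma>} (BijGroup X)"
proof -
  interpret group "BijGroup X" by (rule group_BijGroup)
  show ?thesis
  proof (rule subgroupI)
    have "bounded_displacement X idx (\<lambda>x\<in>X. x)" by (simp add: bounded_displacement_def)
    then show "{\<sigma> \<in> Bij X. bounded_displacement X idx \<sigma>} \<noteq> {}" using id_Bij by blast
  next
    fix \<sigma> assume "\<sigma> \<in> {\<sigma> \<in> Bij X. bounded_displacement X idx \<sigma>}"
    then obtain k where \<sigma>: "\<sigma> \<in> Bij X"
      and k: "\<And>x. x \<in> X \<Longrightarrow> idx (\<sigma> x) \<le> idx x + k \<and> idx x \<le> idx (\<sigma> x) + k"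
      by (auto simp: bounded_displacement_def)
    have i: "inv\<^bsub>BijGroup X\<^esub> \<sigma> \<in> Bij X" using inv_closed[of \<sigma>] \<sigma> by (simp add: BijGroup_simps)
    have "idx ((inv\<^bsub>BijGroup X\<^esub> \<sigma>) x) \<le> idx x + k \<and> idx x \<le> idx ((inv\<^bsub>BijGroup X\<^esub> \<sigma>) x) + k" if "x \<in> X" for x
      using k[OF inv_BijGroup_apply(2)[OF \<sigma> that]] inv_BijGroup_apply(1)[OF \<sigma> that] by simp
    then show "inv\<^bsub>BijGroup X\<^esub> \<sigma> \<in> {\<sigma> \<in> Bij X. bounded_displacement X idx \<sigma>}"
      using i unfolding bounded_displacement_def by blast
  next
    fix \<sigma> \<tau> assume "\<sigma> \<in> {\<sigma> \<in> Bij X. bounded_displacement X idx \<sigma>}" "\<tau> \<in> {\<sigma> \<in> Bij X. bounded_displacement X idx \<sigma>}"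
    then obtain k l where \<sigma>: "\<sigma> \<in> Bij X" and \<tau>: "\<tau> \<in> Bij X"
      and k: "\<And>x. x \<in> X \<Longrightarrow> idx (\<sigma> x) \<le> idx x + k \<and> idx x \<le> idx (\<sigma> x) + k"
      and l: "\<And>x. x \<in> X \<Longrightarrow> idx (\<tau> x) \<le> idx x + l \<and> idx x \<le> idx (\<tau> x) + l"
      by (auto simp: bounded_displacement_def)
    have "idx (compose X \<sigma> \<tau> x) \<le> idx x + (k + l) \<and> idx x \<le> idx (compose X \<sigma> \<tau> x) + (k + l)" if "x \<in> X" for x
      using k[OF Bij_apply[OF \<tau> that]] l[OF that] that by (simp add: compose_def)
    then show "\<sigma> \<otimes>\<^bsub>BijGroup X\<^esub> \<tau> \<in> {\<sigma> \<in> Bij X. bounded_displacement X idx \<sigma>}"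
      using compose_Bij[OF \<sigma> \<tau>] unfolding BijGroup_simps(2)[OF \<sigma> \<tau>] bounded_displacement_def by blast
  qed (auto simp: BijGroup_simps)
qed

lemma twin_width_perm_group:
  assumes X: "infinite X" and idx: "bij_betw idx X UNIV" and C: "finitary_perms X \<subseteq> C" "C \<subseteq> Bij X"
    and bd: "\<And>g. g \<in> C \<Longrightarrow> bounded_displacement X idx g"
  shows "finite_twin_width ((BijGroup X)\<lparr>carrier := C\<rparr>) \<and> utww ((BijGroup X)\<lparr>carrier := C\<rparr>) = \<infinity>"
proof
  have "(\<lambda>x\<in>X. x) \<in> finitary_perms X" using id_Bij by (auto simp: finitary_perms_def)
  then have "C \<noteq> {}" using C by blast
  then show "finite_twin_width ((BijGroup X)\<lparr>carrier := C\<rparr>)"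
    by (intro finite_twin_width_bounded_displacement[OF idx C(2)] bd)
  show "utww ((BijGroup X)\<lparr>carrier := C\<rparr>) = \<infinity>" by (rule utww_perm_group_infinite[OF X C(1)])
qed

section \<open>The infinite star graph\<close>

text \<open>The rays are enumerated in parallel, so that adjacent vertices have indices that differ by at most \<open>n\<close>.\<close>

definition star_index :: "nat \<Rightarrow> star_vertex \<Rightarrow> nat" where
  "star_index n v = (case v of Centre \<Rightarrow> 0 | Ray i m \<Rightarrow> n * (m - 1) + i)"

lemma bij_star_index:
  assumes n: "1 \<le> n"
  shows "bij_betw (star_index n) (star_vertices n) UNIV"
proof (rule bij_betw_byWitness[where f' = "\<lambda>k. if k = 0 then Centre else Ray ((k - 1) mod n + 1) ((k - 1) div n + 1)"])
  show "\<forall>v\<in>star_vertices n. (if star_index n v = 0 then Centre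
      else Ray ((star_index n v - 1) mod n + 1) ((star_index n v - 1) div n + 1)) = v"
  proof
    fix v assume v: "v \<in> star_vertices n"
    show "(if star_index n v = 0 then Centre
      else Ray ((star_index n v - 1) mod n + 1) ((star_index n v - 1) div n + 1)) = v"
    proof (cases v)
      case (Ray i m)
      then have im: "1 \<le> i" "i \<le> n" "1 \<le> m" using v by auto
      then obtain i' m' where e: "i = Suc i'" "m = Suc m'" "i' < n" by (cases i; cases m) auto
      show ?thesis using Ray e by (simp add: star_index_def)
    qed (simp add: star_index_def)
  qed
  show "\<forall>k\<in>UNIV. star_index n (if k = 0 then Centre else Ray ((k - 1) mod n + 1) ((k - 1) div n + 1)) = k"
    by (simp add: star_index_def)
  show "(\<lambda>k. if k = 0 then Centre else Ray ((k - 1) mod n + 1) ((k - 1) div n + 1)) ` UNIV \<subseteq> star_vertices n"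
    using n by (auto simp: Suc_le_eq)
qed simp

lemma infinite_star_vertices: "1 \<le> n \<Longrightarrow> infinite (star_vertices n)"
  using bij_betw_finite[OF bij_star_index] by simp

lemma star_index_adj: "(u, v) \<in> star_adj n \<Longrightarrow> star_index n u \<le> star_index n v + n \<and> star_index n v \<le> star_index n u + n"
  unfolding star_adj_def Let_def
  by (auto simp: star_index_def algebra_simps)

lemma star_index_relpow:
  "(u, v) \<in> star_adj n ^^ k \<Longrightarrow> star_index n u \<le> star_index n v + k * n \<and> star_index n v \<le> star_index n u + k * n"
proof (induction k arbitrary: v)
  case (Suc k)
  then obtain w where "(u, w) \<in> star_adj n ^^ k" "(w, v) \<in> star_adj n" by auto
  then show ?case using Suc.IH[of w] star_index_adj[of w v n] by simp
qed simp

lemma star_adj_connected: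
  assumes "u \<in> star_vertices n" "v \<in> star_vertices n"
  shows "\<exists>k. (u, v) \<in> star_adj n ^^ k"
proof -
  have s: "sym (star_adj n)" unfolding star_adj_def Let_def by (rule sym_Un_converse)
  have c: "(Centre, w) \<in> (star_adj n)\<^sup>*" if "w \<in> star_vertices n" for w
  proof (cases w)
    case (Ray i m)
    then have im: "1 \<le> i" "i \<le> n" "1 \<le> m" using that by auto
    have "(Centre, Ray i m) \<in> (star_adj n)\<^sup>*" using im(3)
    proof (induction m rule: dec_induct)
      case base
      show ?case using im by (intro r_into_rtrancl) (auto simp: star_adj_def Let_def)
    next
      case (step m)
      have "(Ray i m, Ray i (Suc m)) \<in> star_adj n" using im step.hyps by (auto simp: star_adj_def Let_def)
      then show ?case using step.IH by (rule rtrancl.rtrancl_into_rtrancl[rotated])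
    qed
    then show ?thesis using Ray by simp
  qed simp
  have "(u, Centre) \<in> (star_adj n)\<^sup>*" using c[OF assms(1)] sym_rtrancl[OF s] by (rule symD[rotated])
  then have "(u, v) \<in> (star_adj n)\<^sup>*" using c[OF assms(2)] by (rule rtrancl_trans)
  then show ?thesis by (rule rtrancl_imp_relpow)
qed

text \<open>The distance of two vertices is a least element; it is attained because the star is connected.\<close>

lemma star_index_dist:
  assumes "u \<in> star_vertices n" "v \<in> star_vertices n"
  shows "star_index n u \<le> star_index n v + star_dist n u v * n \<and> star_index n v \<le> star_index n u + star_dist n u v * n"
proof -
  have "(u, v) \<in> star_adj n ^^ star_dist n u v"
    unfolding star_dist_def by (rule LeastI_ex[OF star_adj_connected[OF assms]])
  then show ?thesis by (rule star_index_relpow)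
qed

lemma bounded_displacement_wobbling:
  assumes \<sigma>: "\<sigma> \<in> Bij (star_vertices n)"
    and wob: "(SUP v \<in> star_vertices n. enat (star_dist n (\<sigma> v) v)) < \<infinity>"
  shows "bounded_displacement (star_vertices n) (star_index n) \<sigma>"
proof -
  obtain d where d: "(SUP v \<in> star_vertices n. enat (star_dist n (\<sigma> v) v)) = enat d"
    using wob by (metis enat_ord_simps(4) not_enat_eq)
  have "star_index n (\<sigma> v) \<le> star_index n v + d * n \<and> star_index n v \<le> star_index n (\<sigma> v) + d * n"
    if v: "v \<in> star_vertices n" for v
  proof -
    have "enat (star_dist n (\<sigma> v) v) \<le> enat d" unfolding d[symmetric] by (rule SUP_upper[OF v])
    then have "star_dist n (\<sigma> v) v * n \<le> d * n" by simp
    then show ?thesis using star_index_dist[OF Bij_apply[OF \<sigma> v] v] by linarith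
  qed
  then show ?thesis unfolding bounded_displacement_def by blast
qed

lemma finitary_wobbling:
  assumes "\<sigma> \<in> finitary_perms (star_vertices n)"
  shows "(SUP v \<in> star_vertices n. enat (star_dist n (\<sigma> v) v)) < \<infinity>"
proof -
  let ?S = "{v \<in> star_vertices n. \<sigma> v \<noteq> v}"
  have fin: "finite ?S" using assms by (simp add: finitary_perms_def)
  have "enat (star_dist n (\<sigma> v) v) \<le> enat (\<Sum>v\<in>?S. star_dist n (\<sigma> v) v)" if "v \<in> star_vertices n" for v
  proof (cases "\<sigma> v = v")
    case True
    have "star_dist n v v = 0" unfolding star_dist_def by (rule Least_eq_0) simp
    then show ?thesis using True by simp
  next
    case False
    then show ?thesis unfolding enat_ord_simps
      using that fin by (intro member_le_sum[where f = "\<lambda>v. star_dist n (\<sigma> v) v"]) auto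
  qed
  then have "(SUP v \<in> star_vertices n. enat (star_dist n (\<sigma> v) v)) \<le> enat (\<Sum>v\<in>?S. star_dist n (\<sigma> v) v)"
    by (rule SUP_least)
  then show ?thesis by (rule le_less_trans) simp
qed

theorem twin_width_wobbling_group:
  assumes "1 \<le> n"
  shows "finite_twin_width (wobbling_group n) \<and> utww (wobbling_group n) = \<infinity>"
  unfolding wobbling_group_def
proof (rule twin_width_perm_group[OF infinite_star_vertices[OF assms] bij_star_index[OF assms]])
  show "finitary_perms (star_vertices n) \<subseteq> {\<sigma> \<in> Bij (star_vertices n). (SUP v \<in> star_vertices n. enat (star_dist n (\<sigma> v) v)) < \<infinity>}"
    using finitary_wobbling by (auto simp: finitary_perms_def)
qed (use bounded_displacement_wobbling in auto)

theorem twin_width_FSym_star: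
  assumes "1 \<le> n"
  shows "finite_twin_width (FSym (star_vertices n)) \<and> utww (FSym (star_vertices n)) = \<infinity>"
  unfolding FSym_def
  by (rule twin_width_perm_group[OF infinite_star_vertices[OF assms] bij_star_index[OF assms] order_refl _ bounded_displacement_finitary])
    (auto simp: finitary_perms_def)

section \<open>The Houghton groups\<close>

lemma generated_perm_group_bounded:
  assumes S: "S \<subseteq> Bij X" and bd: "\<And>s. s \<in> S \<Longrightarrow> bounded_displacement X idx s"
  shows "generate (BijGroup X) S \<subseteq> {\<sigma> \<in> Bij X. bounded_displacement X idx \<sigma>}"
proof -
  interpret group "BijGroup X" by (rule group_BijGroup)
  show ?thesis by (rule generate_subgroup_incl[OF _ subgroup_bounded_displacement]) (use S bd in blast)
qed

theorem twin_width_houghton_group_2: "finite_twin_width houghton_group_2 \<and> utww houghton_group_2 = \<infinity>"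
proof -
  let ?S = "insert (\<lambda>l::int. l + 1) (finitary_perms UNIV)"
  have "bij (\<lambda>l::int. l + 1)" by (rule bij_betw_byWitness[where f' = "\<lambda>l. l - 1"]) auto
  then have S: "?S \<subseteq> Bij UNIV" by (auto simp: Bij_def finitary_perms_def)
  \<comment> \<open>the enumeration alternates between nonnegative and negative numbers, so a translation by 1 is a step of length 2, or 1 at the origin\<close>
  have tr: "bounded_displacement UNIV int_encode (\<lambda>l. l + 1)"
    unfolding bounded_displacement_def
    by (rule exI[of _ 2]) (auto simp: int_encode_def sum_encode_def)
  have bd: "bounded_displacement UNIV int_encode s" if "s \<in> ?S" for s
    using that tr bounded_displacement_finitary by auto
  have e: "houghton_group_2 = (BijGroup UNIV)\<lparr>carrier := generate (BijGroup UNIV) ?S\<rparr>"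
    using S by (simp add: houghton_group_2_def subgroup_generated_def BijGroup_simps Int_absorb1)
  show ?thesis unfolding e
  proof (rule twin_width_perm_group[OF infinite_UNIV_int bij_int_encode])
    show "finitary_perms UNIV \<subseteq> generate (BijGroup UNIV) ?S"
      by (intro subsetI generate.incl insertI2)
    show "generate (BijGroup UNIV) ?S \<subseteq> Bij UNIV"
      by (rule order_trans[OF generated_perm_group_bounded[OF S bd]]) auto
    show "bounded_displacement UNIV int_encode s" if "s \<in> generate (BijGroup UNIV) ?S" for s
      using subsetD[OF generated_perm_group_bounded[OF S bd] that] by simp
  qed
qed

lemma houghton_gen_bounded:
  assumes k: "k \<in> {2..n}"
  shows "bounded_displacement (star_vertices n) (star_index n) (houghton_gen n k)"
proof -
  have "houghton_gen n k v = v \<or> (v, houghton_gen n k v) \<in> star_adj n" if "v \<in> star_vertices n" for v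
    using that
  proof (cases rule: star_vertices_cases)
    case Centre
    then show ?thesis using k by (auto simp: star_adj_def Let_def)
  next
    case (First m)
    then show ?thesis using k by (auto simp: star_adj_def Let_def)
  next
    case (Other i m)
    then obtain m' where "m = Suc m'" by (cases m) auto
    then show ?thesis using Other k by (cases "i = k"; cases m') (auto simp: star_adj_def Let_def)
  qed
  then have "star_index n (houghton_gen n k v) \<le> star_index n v + n \<and> star_index n v \<le> star_index n (houghton_gen n k v) + n"
    if "v \<in> star_vertices n" for v
    using that star_index_adj[of v "houghton_gen n k v" n] by fastforce
  then show ?thesis unfolding bounded_displacement_def by blast
qed

lemma houghton_group_eq:
  "houghton_group n = (BijGroup (star_vertices n))\<lparr>carrier := generate (BijGroup (star_vertices n)) (houghton_gen n ` {2..n})\<rparr>"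
proof -
  have "houghton_gen n ` {2..n} \<subseteq> Bij (star_vertices n)" using houghton_gen_Bij by blast
  then show ?thesis by (simp add: houghton_group_def subgroup_generated_def BijGroup_simps Int_absorb1)
qed

lemma houghton_group_subgroup: "subgroup (carrier (houghton_group n)) (BijGroup (star_vertices n))"
proof -
  interpret group "BijGroup (star_vertices n)" by (rule group_BijGroup)
  have "houghton_gen n ` {2..n} \<subseteq> carrier (BijGroup (star_vertices n))"
    using houghton_gen_Bij by (auto simp: BijGroup_simps)
  then show ?thesis unfolding houghton_group_eq using generate_is_subgroup by simp
qed

lemma houghton_gen_in_group: "k \<in> {2..n} \<Longrightarrow> houghton_gen n k \<in> carrier (houghton_group n)"
  unfolding houghton_group_eq by (auto intro: generate.incl)

lemma houghton_group_acts:
  assumes "3 \<le> n"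
  shows "group_acting_on_star (houghton_group n) n (\<lambda>\<sigma>. \<sigma>)"
proof -
  interpret B: group "BijGroup (star_vertices n)" by (rule group_BijGroup)
  interpret group "houghton_group n"
    using subgroup.subgroup_is_group[OF houghton_group_subgroup group_BijGroup] unfolding houghton_group_eq by simp
  have "(\<lambda>\<sigma>. \<sigma>) \<in> hom (houghton_group n) (BijGroup (star_vertices n))"
    using subgroup.mem_carrier[OF houghton_group_subgroup[of n]] by (auto simp: hom_def houghton_group_eq)
  then show ?thesis using assms by unfold_locales
qed

lemma houghton_group_generated:
  "carrier (houghton_group n) = generate (houghton_group n) (houghton_gen n ` {2..n})"
proof -
  interpret B: group "BijGroup (star_vertices n)" by (rule group_BijGroup)
  have "generate (BijGroup (star_vertices n)\<lparr>carrier := carrier (houghton_group n)\<rparr>) (houghton_gen n ` {2..n}) =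
      generate (BijGroup (star_vertices n)) (houghton_gen n ` {2..n})"
    by (rule B.generate_consistent[OF _ houghton_group_subgroup]) (use houghton_gen_in_group in blast)
  then show ?thesis unfolding houghton_group_eq by simp
qed

lemma houghton_group_relations:
  assumes n: "3 \<le> n" and g: "\<And>k. k \<in> {2..n} \<Longrightarrow> g k = houghton_gen n k"
    and lr: "(l, r) \<in> houghton_relations (houghton_group n) g n"
  shows "l = r"
proof -
  interpret group_acting_on_star "houghton_group n" n "\<lambda>\<sigma>. \<sigma>" by (rule houghton_group_acts[OF n])
  have gc: "g k \<in> carrier (houghton_group n)" if "k \<in> {2..n}" for k
    using g[OF that] houghton_gen_in_group[OF that] by simp
  have "l \<in> carrier (houghton_group n)" "r \<in> carrier (houghton_group n)"
    using houghton_relations_closed[OF n gc lr] by auto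
  then show ?thesis
    using houghton_relations_act[OF gc g lr] by (intro Bij_eqI[OF \<rho>_Bij \<rho>_Bij]) auto
qed

lemma finitary_perms_in_houghton_group:
  assumes n: "3 \<le> n"
  shows "finitary_perms (star_vertices n) \<subseteq> carrier (houghton_group n)"
proof -
  interpret A: group_acting_on_star "houghton_group n" n "\<lambda>\<sigma>. \<sigma>" by (rule houghton_group_acts[OF n])
  interpret houghton_presented "houghton_group n" n "\<lambda>\<sigma>. \<sigma>" "houghton_gen n"
    by unfold_locales
      (rule houghton_gen_in_group houghton_group_generated refl houghton_group_relations[OF n] | assumption)+
  show ?thesis
  proof (rule finitary_perms_generated[OF houghton_group_subgroup])
    fix u v assume uv: "u \<in> star_vertices n" "v \<in> star_vertices n" "u \<noteq> v"
    have "T u v = (\<lambda>x\<in>star_vertices n. transpose u v x)"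
      using \<rho>_T[OF uv] Bij_imp_extensional[OF A.\<rho>_Bij[OF T_closed[OF uv]]]
      by (intro extensionalityI[of _ "star_vertices n"]) auto
    then show "(\<lambda>x\<in>star_vertices n. transpose u v x) \<in> carrier (houghton_group n)" using T_closed[OF uv] by simp
  qed
qed

theorem twin_width_houghton_group:
  assumes n: "3 \<le> n"
  shows "finite_twin_width (houghton_group n) \<and> utww (houghton_group n) = \<infinity>"
proof -
  let ?C = "generate (BijGroup (star_vertices n)) (houghton_gen n ` {2..n})"
  have n1: "1 \<le> n" using n by simp
  have C: "?C \<subseteq> {\<sigma> \<in> Bij (star_vertices n). bounded_displacement (star_vertices n) (star_index n) \<sigma>}"
    by (rule generated_perm_group_bounded) (use houghton_gen_Bij houghton_gen_bounded in auto)
  show ?thesis unfolding houghton_group_eq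
  proof (rule twin_width_perm_group[OF infinite_star_vertices[OF n1] bij_star_index[OF n1]])
    show "finitary_perms (star_vertices n) \<subseteq> ?C"
      using finitary_perms_in_houghton_group[OF n] unfolding houghton_group_eq by simp
    show "?C \<subseteq> Bij (star_vertices n)" by (rule order_trans[OF C]) auto
    show "bounded_displacement (star_vertices n) (star_index n) s" if "s \<in> ?C" for s
      using subsetD[OF C that] by simp
  qed
qed

text \<open>The group \<open>?\<Gamma>\<close> defined by the relations maps onto the Houghton group and thus acts on the star. This action
  is faithful, so a word which is trivial in the Houghton group is trivial in \<open>?\<Gamma>\<close>.\<close>

theorem finitely_presented_houghton_group:
  assumes n: "3 \<le> n"
  shows "finitely_presented (houghton_group n)"
proof -
  let ?H = "houghton_group n" and ?F = "free_group {2..n}"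
  interpret H: group_acting_on_star ?H n "\<lambda>\<sigma>. \<sigma>" by (rule houghton_group_acts[OF n])
  interpret F: group ?F by (rule group_free_group)
  let ?w = "H.word_value (houghton_gen n)"
  interpret w: group_hom ?F ?H ?w
    by unfold_locales (rule H.word_value_hom[OF houghton_gen_in_group])
  have fg: "free_gen k \<in> carrier ?F" if "k \<in> {2..n}" for k
    using that by (simp add: carrier_free_group reduced_Cons)
  have wg: "?w (free_gen k) = houghton_gen n k" if "k \<in> {2..n}" for k
    using houghton_gen_in_group[OF that] by (simp add: H.letter_value_def)
  define R where "R = (\<lambda>(l, r). l \<otimes>\<^bsub>?F\<^esub> inv\<^bsub>?F\<^esub> r) ` houghton_relations ?F free_gen n"
  have rc: "l \<in> carrier ?F" "r \<in> carrier ?F" if "(l, r) \<in> houghton_relations ?F free_gen n" for l r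
    using F.houghton_relations_closed[OF n fg that] by auto
  have Rc: "R \<subseteq> carrier ?F" using rc by (auto simp: R_def)
  define N where "N = normal_closure ?F R"
  interpret N: normal N ?F unfolding N_def by (rule F.normal_normal_closure(1)[OF Rc])
  have RN: "R \<subseteq> N" unfolding N_def by (rule F.normal_normal_closure(2)[OF Rc])
  have wR: "?w r = \<one>\<^bsub>?H\<^esub>" if r: "r \<in> R" for r
  proof -
    obtain l r' where lr: "(l, r') \<in> houghton_relations ?F free_gen n" "r = l \<otimes>\<^bsub>?F\<^esub> inv\<^bsub>?F\<^esub> r'"
      using r by (auto simp: R_def)
    have mem: "(\<lambda>(l, r). (?w l, ?w r)) (l, r') \<in> houghton_relations ?H (\<lambda>k. ?w (free_gen k)) n"
      using imageI[OF lr(1)] by (subst w.houghton_relations_image[OF n]) (intro fg)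
    have "?w l = ?w r'" by (intro houghton_group_relations[OF n _ mem[unfolded prod.case]] wg)
    then show ?thesis using rc[OF lr(1)] lr(2) by simp
  qed
  have NK: "N \<subseteq> kernel ?F ?H ?w"
    unfolding N_def by (rule F.normal_closure_minimal[OF w.normal_kernel]) (use wR Rc in \<open>auto simp: kernel_def\<close>)
  let ?\<Gamma> = "?F Mod N"
  interpret \<Gamma>: group ?\<Gamma> by (rule N.factorgroup_is_group)
  define p where "p x = N #>\<^bsub>?F\<^esub> x" for x
  interpret p: group_hom ?F ?\<Gamma> p
    unfolding p_def by unfold_locales (rule N.r_coset_hom_Mod)
  obtain \<rho> where \<rho>: "\<rho> \<in> hom ?\<Gamma> ?H" "\<And>x. x \<in> carrier ?F \<Longrightarrow> \<rho> (p x) = ?w x"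
    using w.FactGroup_universal_kernel[OF N.normal_axioms NK] unfolding p_def by blast
  have \<rho>B: "\<rho> \<in> hom ?\<Gamma> (BijGroup (star_vertices n))"
    using hom_compose[OF \<rho>(1) H.\<rho>_hom] by (simp add: comp_def)
  interpret P: houghton_presented ?\<Gamma> n \<rho> "\<lambda>k. p (free_gen k)"
  proof unfold_locales
    show "3 \<le> n" by (rule n)
    show "\<rho> \<in> hom ?\<Gamma> (BijGroup (star_vertices n))" by (rule \<rho>B)
    show "p (free_gen k) \<in> carrier ?\<Gamma>" if "k \<in> {2..n}" for k using p.hom_closed[OF fg[OF that]] .
    show "\<rho> (p (free_gen k)) = houghton_gen n k" if "k \<in> {2..n}" for k
      using \<rho>(2)[OF fg[OF that]] wg[OF that] by simp
    have "p ` carrier ?F = generate ?\<Gamma> (p ` free_gen ` {2..n})"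
      unfolding generate_free_gens[symmetric] by (rule p.generate_img[symmetric]) (use fg in blast)
    then show "carrier ?\<Gamma> = generate ?\<Gamma> ((\<lambda>k. p (free_gen k)) ` {2..n})"
      by (simp add: image_image carrier_FactGroup p_def)
    show "l = r" if lr: "(l, r) \<in> houghton_relations ?\<Gamma> (\<lambda>k. p (free_gen k)) n" for l r
    proof -
      have "houghton_relations ?\<Gamma> (\<lambda>k. p (free_gen k)) n = (\<lambda>(l, r). (p l, p r)) ` houghton_relations ?F free_gen n"
        by (intro p.houghton_relations_image[OF n] fg)
      then obtain l' r' where lr': "(l', r') \<in> houghton_relations ?F free_gen n" "l = p l'" "r = p r'"
        using lr by auto
      have "l' \<otimes>\<^bsub>?F\<^esub> inv\<^bsub>?F\<^esub> r' \<in> N" using RN lr'(1) by (force simp: R_def)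
      then have "p (l' \<otimes>\<^bsub>?F\<^esub> inv\<^bsub>?F\<^esub> r') = \<one>\<^bsub>?\<Gamma>\<^esub>" using N.rcos_const by (simp add: p_def)
      then have "p l' \<otimes>\<^bsub>?\<Gamma>\<^esub> inv\<^bsub>?\<Gamma>\<^esub> p r' = \<one>\<^bsub>?\<Gamma>\<^esub>" using rc[OF lr'(1)] p.hom_mult p.hom_inv by (metis F.inv_closed)
      then have "p l' = p r'"
        using \<Gamma>.inv_solve_right'[of "\<one>\<^bsub>?\<Gamma>\<^esub>" "p l'" "p r'"] p.hom_closed[OF rc(1)[OF lr'(1)]] p.hom_closed[OF rc(2)[OF lr'(1)]]
        by (metis \<Gamma>.inv_equality \<Gamma>.inv_inv \<Gamma>.inv_closed)
      then show ?thesis using lr' by simp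
    qed
  qed
  show ?thesis
  proof (rule finitely_presentedI[where X = "{2..n}" and R = R and g = "houghton_gen n"])
    show "group ?H" by (rule H.group_axioms)
    show "houghton_gen n k \<in> carrier ?H" if "k \<in> {2..n}" for k using houghton_gen_in_group[OF that] .
    show "carrier ?H = generate ?H (houghton_gen n ` {2..n})" by (rule houghton_group_generated)
    show "finite R" unfolding R_def by (intro finite_imageI finite_houghton_relations)
    fix x assume x: "x \<in> carrier ?F" "?w x = \<one>\<^bsub>?H\<^esub>"
    have "p x = \<one>\<^bsub>?\<Gamma>\<^esub>"
      by (rule P.faithful) (use x \<rho>(2)[OF x(1)] H.\<rho>_one p.hom_closed in auto)
    then have "N #>\<^bsub>?F\<^esub> x = N" by (simp add: p_def)
    then show "x \<in> normal_closure ?F R"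
      using F.rcos_self[OF x(1) N.is_subgroup] unfolding N_def by simp
  qed (use Rc wR in auto)
qed

theorem theorem27:
  fixes n :: nat
  assumes "n \<ge> 2"
  shows "(finite_twin_width (wobbling_group n) \<and> utww (wobbling_group n) = \<infinity>) \<and>
         (finite_twin_width (FSym (star_vertices n)) \<and> utww (FSym (star_vertices n)) = \<infinity>) \<and>
         (n = 2 \<longrightarrow> finite_twin_width houghton_group_2 \<and> utww houghton_group_2 = \<infinity>) \<and>
         (n \<ge> 3 \<longrightarrow> finite_twin_width (houghton_group n) \<and> utww (houghton_group n) = \<infinity>) \<and>
         (n \<ge> 3 \<longrightarrow> finitely_presented (houghton_group n))"
  using assms twin_width_wobbling_group[of n] twin_width_FSym_star[of n] twin_width_houghton_group_2
    twin_width_houghton_group[of n] finitely_presented_houghton_group[of n]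
  by simp

end
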